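(* There exists a polynomially bounded function $m(n)$ such that the symmetrized determinant family $(\{T^{(n)}_{k,l}\}_{k,l\in[m(n)]})_{n\ge1}$ over $\operatorname{Mat}(\mathbb{F},m(n),m(n))$ with non-commuting variables is $\mathsf{VNP}_{\mathsf{A,\overline{C}}}$-complete under $c$-reductions: each of its members is in $\mathsf{VNP}_{\mathsf{A,\overline{C}}}$, and every family in $\mathsf{VNP}_{\mathsf{A,\overline{C}}}$ $c$-reduces to it.
   Context: Fix a field $\mathbb{F}$ of characteristic $0$ (e.g. $\mathbb{Q}$). For $n,m\ge1$ take non-commuting variables $y^{i,j}_{a,b}$ ($i,j\in[n]$, $a,b\in[m]$) and let $M$ be the $n\times n$ matrix whose $(i,j)$ entry is the $m\times m$ matrix $(y^{i,j}_{a,b})_{a,b}$ over the free algebra. Let $T=\mathsf{sdet}\,M$, where for an $n\times n$ matrix $(m_{ij})$ over an associative algebra $\mathsf{sdet} = \frac{1}{n!}\sum_{(\sigma,\tau)\in\mathsf{Sym}_n^2}(\operatorname{sgn}\sigma)(\operatorname{sgn}\tau)\, m_{\sigma(1)\tau(1)}\cdots m_{\sigma(n)\tau(n)}$ (ordered matrix products). $T^{(n)}_{k,l}$ is the $(k,l)$ entry of $T$ for $m=m(n)$, a non-commutative polynomial. $\mathsf{VP}_{\mathsf{A,\overline{C}}}$: families of non-commutative polynomials with polynomially bounded number of variables and degree computed by polynomial-size non-commutative arithmetic circuits. $\mathsf{VNP}_{\mathsf{A,\overline{C}}}$: families $f_n(x)=\sum_{e\in\{0,1\}^{r(n)}}g_n(x,e)$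 with $(g_n)\in\mathsf{VP}_{\mathsf{A,\overline{C}}}$ and $r$ polynomially bounded. A family $(f_n)$ $c$-reduces to a family $(h_n)$ if $f_n$ is computed by a polynomial-size non-commutative arithmetic circuit that may additionally use oracle gates computing members of $(h_j)$ with $j$ polynomially bounded in $n$. *)

theory Defs
  imports
    "HOL-Library.Poly_Mapping"
    "HOL-Combinatorics.Permutations"
    "Jordan_Normal_Form.Matrix"
begin

section \<open>Non-commutative polynomials\<close>

text \<open>The free monoid, written additively because the convolution product of
  \<^typ>\<open>'a \<Rightarrow>\<^sub>0 'b\<close> is indexed by an additive monoid. It is a type of its own so that no
  arithmetic is put on lists.\<close>

datatype 'v nc_word = NC_Word (letters: "'v list")

instantiation nc_word :: (type) monoid_add
begin

definition zero_nc_word :: "'v nc_word" where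
  "zero_nc_word = NC_Word []"

definition plus_nc_word :: "'v nc_word \<Rightarrow> 'v nc_word \<Rightarrow> 'v nc_word" where
  "plus_nc_word u w = NC_Word (letters u @ letters w)"

instance
  by intro_classes (simp_all add: zero_nc_word_def plus_nc_word_def)

end

text \<open>With the ring structure of \<^theory>\<open>HOL-Library.Poly_Mapping\<close> this is the free
  associative unital algebra over the coefficient field.\<close>

type_synonym ('v, 'f) ncpoly = "'v nc_word \<Rightarrow>\<^sub>0 'f"

definition nc_const :: "'f::zero \<Rightarrow> ('v, 'f) ncpoly" where
  "nc_const c = Poly_Mapping.single 0 c"

definition nc_var :: "'v \<Rightarrow> ('v, 'f::zero_neq_one) ncpoly" where
  "nc_var v = Poly_Mapping.single (NC_Word [v]) 1"

definition nc_vars :: "('v, 'f::zero) ncpoly \<Rightarrow> 'v set" where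
  "nc_vars p = (\<Union>w\<in>Poly_Mapping.keys p. set (letters w))"

definition nc_degree :: "('v, 'f::zero) ncpoly \<Rightarrow> nat" where
  "nc_degree p = Max (insert 0 ((\<lambda>w. length (letters w)) ` Poly_Mapping.keys p))"

definition nc_subst :: "('v \<Rightarrow> ('w, 'f::ring_1) ncpoly) \<Rightarrow> ('v, 'f) ncpoly \<Rightarrow> ('w, 'f) ncpoly" where
  "nc_subst s p =
     (\<Sum>w\<in>Poly_Mapping.keys p. nc_const (Poly_Mapping.lookup p w) * prod_list (map s (letters w)))"


section \<open>Non-commutative arithmetic circuits with oracle gates\<close>

text \<open>A circuit is a topologically sorted list of gates; an argument of a gate is the position of
  another gate in the list. The gate \<^term>\<open>Oracle h a\<close> evaluates the polynomial \<^term>\<open>h\<close>,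
  with the value of gate \<^term>\<open>a x\<close> plugged in for each variable \<^term>\<open>x\<close> of \<^term>\<open>h\<close>.
  A \<^term>\<open>Mult i j\<close> gate multiplies with the value of gate \<^term>\<open>i\<close> on the left.\<close>

declare [[typedef_overloaded]]

datatype ('v, 'w, 'f::zero) gate =
    Input 'v
  | Const 'f
  | Add nat nat
  | Mult nat nat
  | Oracle "('w, 'f) ncpoly" "'w \<Rightarrow> nat"

type_synonym ('v, 'w, 'f) circuit = "('v, 'w, 'f) gate list"

fun gate_args :: "('v, 'w, 'f::zero) gate \<Rightarrow> nat set" where
  "gate_args (Input v) = {}"
| "gate_args (Const c) = {}"
| "gate_args (Add i j) = {i, j}"
| "gate_args (Mult i j) = {i, j}"
| "gate_args (Oracle h a) = a ` nc_vars h"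

fun gate_oracles :: "('v, 'w, 'f::zero) gate \<Rightarrow> ('w, 'f) ncpoly set" where
  "gate_oracles (Oracle h a) = {h}"
| "gate_oracles _ = {}"

fun gate_value :: "('v, 'f) ncpoly list \<Rightarrow> ('v, 'w, 'f::ring_1) gate \<Rightarrow> ('v, 'f) ncpoly" where
  "gate_value vs (Input v) = nc_var v"
| "gate_value vs (Const c) = nc_const c"
| "gate_value vs (Add i j) = vs ! i + vs ! j"
| "gate_value vs (Mult i j) = vs ! i * vs ! j"
| "gate_value vs (Oracle h a) = nc_subst (\<lambda>x. vs ! a x) h"

definition circuit_values :: "('v, 'w, 'f::ring_1) circuit \<Rightarrow> ('v, 'f) ncpoly list" where
  "circuit_values C = foldl (\<lambda>vs g. vs @ [gate_value vs g]) [] C"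

definition wf_circuit :: "('v, 'w, 'f::zero) circuit \<Rightarrow> bool" where
  "wf_circuit C \<longleftrightarrow> C \<noteq> [] \<and> (\<forall>i<length C. gate_args (C ! i) \<subseteq> {..<i})"

definition circuit_oracles :: "('v, 'w, 'f::zero) circuit \<Rightarrow> ('w, 'f) ncpoly set" where
  "circuit_oracles C = (\<Union>g\<in>set C. gate_oracles g)"

definition computes :: "('v, 'w, 'f::ring_1) circuit \<Rightarrow> ('v, 'f) ncpoly \<Rightarrow> bool" where
  "computes C p \<longleftrightarrow> wf_circuit C \<and> last (circuit_values C) = p"


section \<open>Complexity classes and reductions\<close>

text \<open>Families are indexed by the positive integers; the value at index 0 is ignored throughout.\<close>

definition poly_bounded :: "(nat \<Rightarrow> nat) \<Rightarrow> bool" where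
  "poly_bounded t \<longleftrightarrow> (\<exists>c. \<forall>n\<ge>1. t n \<le> n ^ c + c)"

text \<open>In an oracle-free circuit the type of oracle variables plays no role; here it is
  instantiated by \<^typ>\<open>'v\<close>.\<close>

definition VP :: "(nat \<Rightarrow> ('v, 'f::ring_1) ncpoly) set" where
  "VP = {f. poly_bounded (\<lambda>n. card (nc_vars (f n))) \<and>
            poly_bounded (\<lambda>n. nc_degree (f n)) \<and>
            (\<exists>s. poly_bounded s \<and>
               (\<forall>n\<ge>1. \<exists>C :: ('v, 'v, 'f) circuit.
                  circuit_oracles C = {} \<and> length C \<le> s n \<and> computes C (f n)))}"

text \<open>The variables of \<^term>\<open>g n\<close> are the variables \<^term>\<open>Inl x\<close> of \<^term>\<open>f n\<close> and
  the auxiliary variables \<^term>\<open>Inr i\<close> for \<^term>\<open>i < r n\<close>.\<close>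

definition VNP :: "(nat \<Rightarrow> ('v, 'f::ring_1) ncpoly) set" where
  "VNP = {f. \<exists>(g :: nat \<Rightarrow> ('v + nat, 'f) ncpoly) r.
            g \<in> VP \<and> poly_bounded r \<and>
            (\<forall>n\<ge>1. nc_vars (g n) \<subseteq> range Inl \<union> Inr ` {..<r n} \<and>
               f n = (\<Sum>e\<in>{..<r n} \<rightarrow>\<^sub>E {0, 1}.
                        nc_subst (case_sum nc_var (\<lambda>i. nc_const (e i))) (g n)))}"

text \<open>The target of a reduction is a family of finite sets of polynomials, such as the set of all
  entries of a matrix; an oracle gate may use any element of the sets with admissible index.\<close>

definition c_reduces ::
    "(nat \<Rightarrow> ('v, 'f::ring_1) ncpoly) \<Rightarrow> (nat \<Rightarrow> ('w, 'f) ncpoly set) \<Rightarrow> bool" where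
  "c_reduces f H \<longleftrightarrow>
     (\<exists>s t. poly_bounded s \<and> poly_bounded t \<and>
        (\<forall>n\<ge>1. \<exists>C :: ('v, 'w, 'f) circuit.
           circuit_oracles C \<subseteq> (\<Union>j\<in>{1..t n}. H j) \<and> length C \<le> s n \<and> computes C (f n)))"

text \<open>Members of the family are all sequences that select one element for each index. The families
  to be reduced are over the variables $x_0, x_1, \dots$.\<close>

definition VNP_complete :: "(nat \<Rightarrow> ('w, 'f::ring_1) ncpoly set) \<Rightarrow> bool" where
  "VNP_complete H \<longleftrightarrow>
     (\<forall>h. (\<forall>n\<ge>1. h n \<in> H n) \<longrightarrow> h \<in> VNP) \<and>
     (\<forall>f :: nat \<Rightarrow> (nat, 'f) ncpoly. f \<in> VNP \<longrightarrow> c_reduces f H)"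


section \<open>The symmetrized determinant\<close>

text \<open>A \<^typ>\<open>('f, 'a) module\<close> record carries a ring structure together with a scalar
  multiplication, so it serves as the record of an associative algebra.\<close>

definition sdet :: "('f::field_char_0, 'a, 'b) module_scheme \<Rightarrow> nat \<Rightarrow> 'a mat \<Rightarrow> 'a" where
  "sdet R n A =
     (1 / fact n) \<odot>\<^bsub>R\<^esub>
       finsum R (\<lambda>(\<sigma>, \<tau>). (of_int (sign \<sigma>) * of_int (sign \<tau>)) \<odot>\<^bsub>R\<^esub>
                   foldr (mult R) (map (\<lambda>i. A $$ (\<sigma> i, \<tau> i)) [0..<n]) \<one>\<^bsub>R\<^esub>)
         ({\<sigma>. \<sigma> permutes {..<n}} \<times> {\<tau>. \<tau> permutes {..<n}})"

definition mat_algebra :: "nat \<Rightarrow> ('f::field_char_0, ('v, 'f) ncpoly mat) module" where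
  "mat_algebra m =
     \<lparr>carrier = carrier_mat m m, mult = (*), one = 1\<^sub>m m, zero = 0\<^sub>m m m, add = (+),
      smult = (\<lambda>c A. nc_const c \<cdot>\<^sub>m A)\<rparr>"

text \<open>The variable $y^{i,j}_{a,b}$ is \<^term>\<open>(i, j, a, b)\<close>; all indices start at 0.\<close>

definition generic_matrix ::
    "nat \<Rightarrow> nat \<Rightarrow> (nat \<times> nat \<times> nat \<times> nat, 'f::field_char_0) ncpoly mat mat" where
  "generic_matrix n m = mat n n (\<lambda>(i, j). mat m m (\<lambda>(a, b). nc_var (i, j, a, b)))"

definition sdet_family ::
    "(nat \<Rightarrow> nat) \<Rightarrow> nat \<Rightarrow> (nat \<times> nat \<times> nat \<times> nat, 'f::field_char_0) ncpoly set" where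
  "sdet_family m n =
     {sdet (mat_algebra (m n)) n (generic_matrix n (m n)) $$ (k, l) | k l. k < m n \<and> l < m n}"

end

theory Submission
  imports Defs "HOL-Combinatorics.Multiset_Permutations"
begin

text \<open>The theorem holds for \<^term>\<open>m = (\<lambda>n. n)\<close>.

  Hardness: on a block diagonal matrix the signs of the two permutations cancel, and the symmetrized
  determinant becomes the sum of the products of the blocks in all orders. Its entries therefore sum
  over the runs of an automaton that reads every letter exactly once, in an arbitrary order. A
  polynomial computed by a small circuit is a sum over parse trees. Such an automaton can traverse a
  parse tree depth first without a stack: the right child of a product starts at a position of the
  word that no other right child shares, it is stored by consuming a letter, and it is guessed again
  when this position is reached by consuming all competing letters. The boolean
  variables of the exponential sum are guessed at the beginning in the same way.

  Membership: a permutation is a sum over bits that are checked by small formulas, its sign is a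
  product over the pairs of rows, and for fixed permutations the product of the matrices is computed
  by a small circuit.\<close>

section \<open>The free algebra\<close>

text \<open>A matrix product is evaluated strictly from left to right, like a run of an automaton
  with polynomially many states, whereas a circuit nests its products, so that a depth first
  traversal seems to need a stack. What helps is that every run must use every letter exactly once
  while all orders are summed over: the set of letters not yet consumed is an exponentially large
  memory. To make the start positions of right children distinct, one degree is treated at a time
  and a word is only split into two non-empty parts. A word of length d has d - 1 inner boundaries,
  and each of them is the split point of exactly one product of the parse tree. A summation bit may
  be needed at several leaves but a letter is read only once, hence one copy of each bit per
  position. Since the number of blocks equals their dimension for
  \<open>m = (\<lambda>n. n)\<close>, the letters are padded with K letters that consume no token.
  Their order is immaterial, which multiplies every run by K!; together with the 1 / n! in
  \<open>sdet\<close> this is a rational factor that one constant undoes in characteristic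
  0.\<close>

lemma nc_const_0 [simp]: "nc_const 0 = 0"
  by (simp add: nc_const_def)

lemma nc_const_1 [simp]: "nc_const 1 = 1"
  by (simp add: nc_const_def)

lemma nc_const_add: "nc_const (a + b) = nc_const a + nc_const b"
  by (simp add: nc_const_def single_add)

lemma nc_const_uminus: "nc_const (- a) = - nc_const (a :: 'f::ring_1)"
  by (simp add: nc_const_def single_uminus)

lemma nc_const_mult: "nc_const (a * b) = nc_const a * nc_const (b :: 'f::ring_1)"
  by (simp add: nc_const_def mult_single)

lemma nc_const_of_nat: "nc_const (of_nat n) = (of_nat n :: ('v, 'f::ring_1) ncpoly)"
  by (simp add: nc_const_def)

lemma nc_const_of_bool: "nc_const (of_bool b) = (of_bool b :: ('v, 'f::ring_1) ncpoly)"
  by (cases b) simp_all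

lemma nc_const_sum: "nc_const (sum f A) = (\<Sum>x\<in>A. nc_const (f x :: 'f::ring_1))"
  by (induction A rule: infinite_finite_induct) (simp_all add: nc_const_add)

text \<open>The linear extension of a function on words. Both \<open>nc_subst\<close> and
  \<open>nc_subst_hom\<close> are instances, so their additivity is proved only once.\<close>

definition nc_lin :: "('v nc_word \<Rightarrow> ('w, 'f::ring_1) ncpoly) \<Rightarrow> ('v, 'f) ncpoly \<Rightarrow> ('w, 'f) ncpoly" where
  "nc_lin h p = (\<Sum>w\<in>Poly_Mapping.keys p. nc_const (Poly_Mapping.lookup p w) * h w)"

lemma nc_lin_superset:
  assumes "finite K" "Poly_Mapping.keys p \<subseteq> K"
  shows "nc_lin h p = (\<Sum>w\<in>K. nc_const (Poly_Mapping.lookup p w) * h w)"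
  unfolding nc_lin_def using assms by (intro sum.mono_neutral_left) (auto simp: in_keys_iff)

lemma nc_lin_add: "nc_lin h (p + q) = nc_lin h p + nc_lin h q"
proof -
  let ?K = "Poly_Mapping.keys p \<union> Poly_Mapping.keys q"
  have "nc_lin h (p + q) = (\<Sum>w\<in>?K. nc_const (Poly_Mapping.lookup (p + q) w) * h w)"
    by (intro nc_lin_superset) (simp_all add: keys_add)
  also have "\<dots> = (\<Sum>w\<in>?K. nc_const (Poly_Mapping.lookup p w) * h w)
                 + (\<Sum>w\<in>?K. nc_const (Poly_Mapping.lookup q w) * h w)"
    by (simp add: lookup_add nc_const_add algebra_simps sum.distrib)
  also have "\<dots> = nc_lin h p + nc_lin h q"
    by (simp add: nc_lin_superset[symmetric])
  finally show ?thesis .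
qed

lemma nc_lin_0 [simp]: "nc_lin h 0 = 0"
  by (simp add: nc_lin_def)

lemma nc_lin_sum: "nc_lin h (sum p A) = (\<Sum>x\<in>A. nc_lin h (p x))"
  by (induction A rule: infinite_finite_induct) (simp_all add: nc_lin_add)

lemma nc_lin_single: "nc_lin h (Poly_Mapping.single w c) = nc_const c * h w"
  by (cases "c = 0") (simp_all add: nc_lin_def)

lemma ncpoly_sum_monomials:
  "(\<Sum>w\<in>Poly_Mapping.keys p. Poly_Mapping.single w (Poly_Mapping.lookup p w)) = p"
  by (rule poly_mapping_eqI)
     (auto simp: lookup_sum lookup_single when_def in_keys_iff sum.delta[where ?'b = 'b for b])

text \<open>Commutativity of the coefficients makes the constants central; on monomials this is
  immediate.\<close>

lemma nc_const_commute:
  fixes p :: "('v, 'f::comm_ring_1) ncpoly"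
  shows "nc_const c * p = p * nc_const c"
proof -
  let ?p = "\<Sum>w\<in>Poly_Mapping.keys p. Poly_Mapping.single w (Poly_Mapping.lookup p w)"
  have "nc_const c * ?p = ?p * nc_const c"
    by (simp add: nc_const_def sum_distrib_left sum_distrib_right mult_single mult.commute)
  then show ?thesis
    by (simp only: ncpoly_sum_monomials)
qed

text \<open>No multiplicativity of \<open>h\<close> is assumed: it holds for
  \<open>nc_subst\<close>, but for \<open>nc_subst_hom\<close> it is replaced by a convolution over
  the degrees.\<close>

lemma nc_lin_times:
  fixes p q :: "('v, 'f::comm_ring_1) ncpoly"
  shows "nc_lin h (p * q) = (\<Sum>u\<in>Poly_Mapping.keys p. \<Sum>w\<in>Poly_Mapping.keys q.
           nc_const (Poly_Mapping.lookup p u) * nc_const (Poly_Mapping.lookup q w) * h (u + w))"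
proof -
  let ?m = "\<lambda>p :: ('v, 'f) ncpoly. \<Sum>w\<in>Poly_Mapping.keys p. Poly_Mapping.single w (Poly_Mapping.lookup p w)"
  have "?m p * ?m q = (\<Sum>u\<in>Poly_Mapping.keys p. \<Sum>w\<in>Poly_Mapping.keys q.
      Poly_Mapping.single (u + w) (Poly_Mapping.lookup p u * Poly_Mapping.lookup q w))"
    by (simp only: sum_product mult_single)
  then show ?thesis
    by (simp add: ncpoly_sum_monomials nc_lin_sum nc_lin_single nc_const_mult)
qed

lemma nc_subst_eq_nc_lin: "nc_subst s = nc_lin (\<lambda>w. prod_list (map s (letters w)))"
  by (simp add: fun_eq_iff nc_subst_def nc_lin_def)

lemma letters_0 [simp]: "letters 0 = []"
  by (simp add: zero_nc_word_def)

lemma letters_plus [simp]: "letters (u + w) = letters u @ letters w"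
  by (simp add: plus_nc_word_def)

lemma nc_subst_add [simp]: "nc_subst s (p + q) = nc_subst s p + nc_subst s q"
  by (simp add: nc_subst_eq_nc_lin nc_lin_add)

lemma nc_subst_0 [simp]: "nc_subst s 0 = 0"
  by (simp add: nc_subst_eq_nc_lin)

lemma nc_subst_sum [simp]: "nc_subst s (sum p A) = (\<Sum>x\<in>A. nc_subst s (p x))"
  by (simp add: nc_subst_eq_nc_lin nc_lin_sum)

lemma nc_subst_const [simp]: "nc_subst s (nc_const c) = nc_const c"
  by (simp add: nc_subst_eq_nc_lin nc_const_def[of c] nc_lin_single)

lemma nc_subst_1 [simp]: "nc_subst s 1 = 1"
  using nc_subst_const[of s 1] by (simp del: nc_subst_const)

lemma nc_subst_var [simp]: "nc_subst s (nc_var v) = s v"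
  by (simp add: nc_subst_eq_nc_lin nc_var_def nc_lin_single)

lemma nc_subst_times [simp]:
  fixes p q :: "('v, 'f::comm_ring_1) ncpoly" and s :: "'v \<Rightarrow> ('w, 'f) ncpoly"
  shows "nc_subst s (p * q) = nc_subst s p * nc_subst s q"
proof -
  have "nc_const a * nc_const b * (x * y) = nc_const a * x * (nc_const b * y)"
    for a b :: 'f and x y :: "('w, 'f) ncpoly"
    by (metis mult.assoc nc_const_commute)
  then show ?thesis
    unfolding nc_subst_eq_nc_lin by (simp add: nc_lin_times) (simp add: nc_lin_def sum_product)
qed

lemma nc_subst_prod_list [simp]:
  fixes ps :: "('v, 'f::comm_ring_1) ncpoly list"
  shows "nc_subst s (prod_list ps) = prod_list (map (nc_subst s) ps)"
  by (induction ps) simp_all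

lemma nc_subst_cong:
  assumes "\<And>x. x \<in> nc_vars p \<Longrightarrow> s x = t x"
  shows "nc_subst s p = nc_subst t p"
  unfolding nc_subst_def
proof (intro sum.cong refl arg_cong2[where f = "(*)"] arg_cong[where f = prod_list] map_cong)
  fix w x assume "w \<in> Poly_Mapping.keys p" "x \<in> set (letters w)"
  then show "s x = t x"
    using assms by (auto simp: nc_vars_def)
qed

text \<open>The homogeneous component of degree \<open>d\<close>, evaluated at \<open>s\<close>. The
  degree is counted before the substitution, so a bit variable still occupies one position of the
  word after it has been replaced by 0 or 1.\<close>

definition nc_subst_hom ::
    "('v \<Rightarrow> ('w, 'f::ring_1) ncpoly) \<Rightarrow> nat \<Rightarrow> ('v, 'f) ncpoly \<Rightarrow> ('w, 'f) ncpoly" where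
  "nc_subst_hom s d = nc_lin (\<lambda>w. if length (letters w) = d then prod_list (map s (letters w)) else 0)"

lemma nc_subst_hom_add: "nc_subst_hom s d (p + q) = nc_subst_hom s d p + nc_subst_hom s d q"
  by (simp add: nc_subst_hom_def nc_lin_add)

lemma nc_subst_hom_const: "nc_subst_hom s d (nc_const c) = (if d = 0 then nc_const c else 0)"
  by (simp add: nc_subst_hom_def nc_const_def[of c] nc_lin_single)

lemma nc_subst_hom_var: "nc_subst_hom s d (nc_var v) = (if d = 1 then s v else 0)"
  by (simp add: nc_subst_hom_def nc_var_def nc_lin_single)

text \<open>Only the empty word contributes. The result does not depend on \<open>s\<close>, hence
  not on the summation bits, which is why constant parts can later serve as fixed weights.\<close>

lemma nc_subst_hom_0: "nc_subst_hom s 0 p = nc_const (Poly_Mapping.lookup p 0)"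
proof -
  have eq: "(if length (letters w) = 0 then prod_list (map s (letters w)) else 0) = of_bool (w = 0)" for w
    by (cases w) (simp add: zero_nc_word_def)
  show ?thesis
    unfolding nc_subst_hom_def nc_lin_def eq
    by (cases "0 \<in> Poly_Mapping.keys p") (simp_all add: in_keys_iff)
qed

text \<open>Lengths add under concatenation, so for words \<open>u\<close> and \<open>w\<close> the
  only surviving term of the convolution is the one where \<open>i\<close> is the length of
  \<open>u\<close>.\<close>

lemma nc_subst_hom_times:
  fixes p q :: "('v, 'f::comm_ring_1) ncpoly" and s :: "'v \<Rightarrow> ('w, 'f) ncpoly"
  shows "nc_subst_hom s d (p * q) = (\<Sum>i\<le>d. nc_subst_hom s i p * nc_subst_hom s (d - i) q)"
proof -
  define h :: "nat \<Rightarrow> 'v nc_word \<Rightarrow> ('w, 'f) ncpoly"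
    where "h = (\<lambda>d w. if length (letters w) = d then prod_list (map s (letters w)) else 0)"
  have hom: "nc_subst_hom s d = nc_lin (h d)" for d
    by (simp add: nc_subst_hom_def h_def)
  have h: "h d (u + w) = (\<Sum>i\<le>d. h i u * h (d - i) w)" for u w
  proof (cases "length (letters u) \<le> d")
    case True
    have "(\<Sum>i\<le>d. h i u * h (d - i) w) = (\<Sum>i\<in>{length (letters u)}. h i u * h (d - i) w)"
      using True by (intro sum.mono_neutral_right) (auto simp: h_def)
    then show ?thesis
      using True by (auto simp: h_def)
  next
    case False
    then have "(\<Sum>i\<le>d. h i u * h (d - i) w) = 0"
      by (intro sum.neutral) (auto simp: h_def)
    then show ?thesis
      using False by (simp add: h_def)
  qed
  have comm: "nc_const a * nc_const b * (x * y) = nc_const a * x * (nc_const b * y)"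
    for a b :: 'f and x y :: "('w, 'f) ncpoly"
    by (metis mult.assoc nc_const_commute)
  have "nc_subst_hom s d (p * q) = (\<Sum>u\<in>Poly_Mapping.keys p. \<Sum>w\<in>Poly_Mapping.keys q. \<Sum>i\<le>d.
      nc_const (Poly_Mapping.lookup p u) * h i u * (nc_const (Poly_Mapping.lookup q w) * h (d - i) w))"
    by (simp only: hom nc_lin_times h sum_distrib_left comm)
  also have "\<dots> = (\<Sum>i\<le>d. \<Sum>u\<in>Poly_Mapping.keys p. \<Sum>w\<in>Poly_Mapping.keys q.
      nc_const (Poly_Mapping.lookup p u) * h i u * (nc_const (Poly_Mapping.lookup q w) * h (d - i) w))"
    by (subst sum.swap[of _ "{..d}"]) (intro sum.cong refl sum.swap)
  also have "\<dots> = (\<Sum>i\<le>d. nc_subst_hom s i p * nc_subst_hom s (d - i) q)"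
    by (simp only: hom nc_lin_def sum_product)
  finally show ?thesis .
qed

lemma nc_degree_leI:
  assumes "\<And>w. w \<in> Poly_Mapping.keys p \<Longrightarrow> length (letters w) \<le> d"
  shows "nc_degree p \<le> d"
  using assms by (auto simp: nc_degree_def)

lemma length_le_nc_degree: "w \<in> Poly_Mapping.keys p \<Longrightarrow> length (letters w) \<le> nc_degree p"
  by (auto simp: nc_degree_def)

lemma nc_subst_eq_sum_hom:
  assumes "nc_degree p \<le> d"
  shows "nc_subst s p = (\<Sum>i\<le>d. nc_subst_hom s i p)"
proof -
  have "nc_subst s p = (\<Sum>w\<in>Poly_Mapping.keys p. \<Sum>i\<le>d. nc_const (Poly_Mapping.lookup p w) *
      (if length (letters w) = i then prod_list (map s (letters w)) else 0))"
    unfolding nc_subst_def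
  proof (intro sum.cong refl)
    fix w assume "w \<in> Poly_Mapping.keys p"
    then have "length (letters w) \<le> d"
      using length_le_nc_degree assms le_trans by blast
    then show "nc_const (Poly_Mapping.lookup p w) * prod_list (map s (letters w)) =
        (\<Sum>i\<le>d. nc_const (Poly_Mapping.lookup p w) *
          (if length (letters w) = i then prod_list (map s (letters w)) else 0))"
      by (simp add: sum_distrib_left[symmetric])
  qed
  also have "\<dots> = (\<Sum>i\<le>d. nc_subst_hom s i p)"
    unfolding nc_subst_hom_def nc_lin_def by (rule sum.swap)
  finally show ?thesis .
qed

section \<open>Composing circuits\<close>

lemma circuit_values_Nil [simp]: "circuit_values [] = []"
  by (simp add: circuit_values_def)

lemma circuit_values_snoc [simp]:
  "circuit_values (C @ [g]) = circuit_values C @ [gate_value (circuit_values C) g]"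
  by (simp add: circuit_values_def)

lemma length_circuit_values [simp]: "length (circuit_values C) = length C"
  by (induction C rule: rev_induct) simp_all

lemma circuit_values_append_nth:
  "i < length C \<Longrightarrow> circuit_values (C @ C') ! i = circuit_values C ! i"
proof (induction C' rule: rev_induct)
  case (snoc g C')
  then show ?case
    by (simp add: nth_append flip: append_assoc)
qed simp

lemma circuit_values_take: "circuit_values (take i C) = take i (circuit_values C)"
proof (rule nth_equalityI)
  fix j assume "j < length (circuit_values (take i C))"
  then show "circuit_values (take i C) ! j = take i (circuit_values C) ! j"
    using circuit_values_append_nth[of j "take i C" "drop i C"] by simp
qed simp

lemma circuit_values_nth:
  assumes "i < length C"
  shows "circuit_values C ! i = gate_value (take i (circuit_values C)) (C ! i)"
proof -
  have "circuit_values C ! i = circuit_values (take (Suc i) C) ! i"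
    using assms by (simp add: circuit_values_take)
  then show ?thesis
    using assms by (simp add: take_Suc_conv_app_nth nth_append flip: circuit_values_take)
qed

text \<open>Unlike \<open>wf_circuit\<close> it admits the empty list, from which circuits are grown
  by extension.\<close>

definition circuit_over :: "('w, 'f::zero) ncpoly set \<Rightarrow> ('v, 'w, 'f) circuit \<Rightarrow> bool" where
  "circuit_over H C \<longleftrightarrow> (\<forall>i<length C. gate_args (C ! i) \<subseteq> {..<i}) \<and> circuit_oracles C \<subseteq> H"

lemma circuit_over_Nil [simp]: "circuit_over H []"
  by (simp add: circuit_over_def circuit_oracles_def)

lemma circuit_over_snoc:
  "circuit_over H (C @ [g]) \<longleftrightarrow>
     circuit_over H C \<and> gate_args g \<subseteq> {..<length C} \<and> gate_oracles g \<subseteq> H"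
  by (auto simp: circuit_over_def circuit_oracles_def nth_append less_Suc_eq)

lemma set_circuit_values_append: "set (circuit_values C) \<subseteq> set (circuit_values (C @ C'))"
proof
  fix p assume "p \<in> set (circuit_values C)"
  then obtain i where "i < length C" "circuit_values C ! i = p"
    by (auto simp: in_set_conv_nth)
  then show "p \<in> set (circuit_values (C @ C'))"
    using circuit_values_append_nth[of i C C'] by (auto simp: in_set_conv_nth intro!: exI[of _ i])
qed

text \<open>Quantifying over all circuits that are to be extended makes gadgets composable without
  renumbering their gates; \<^term>\<open>A\<close> collects the values that are already available.\<close>

definition computable_over ::
    "('w, 'f::ring_1) ncpoly set \<Rightarrow> ('v, 'f) ncpoly set \<Rightarrow> nat \<Rightarrow> ('v, 'f) ncpoly \<Rightarrow> bool" where
  "computable_over H A s p \<longleftrightarrow> (\<forall>C :: ('v, 'w, 'f) circuit. circuit_over H C \<longrightarrow>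
     A \<subseteq> set (circuit_values C) \<longrightarrow>
     (\<exists>C'. length C' \<le> s \<and> circuit_over H (C @ C') \<and> p \<in> set (circuit_values (C @ C'))))"

lemma computable_overE:
  fixes p :: "('v, 'f::ring_1) ncpoly" and C :: "('v, 'w, 'f) circuit"
  assumes "computable_over H A s p" "circuit_over H C" "A \<subseteq> set (circuit_values C)"
  obtains C' where "length C' \<le> s" "circuit_over H (C @ C')" "p \<in> set (circuit_values (C @ C'))"
  using assms unfolding computable_over_def by blast

lemma computable_over_computes:
  fixes p :: "('v, 'f::ring_1) ncpoly" and H :: "('w, 'f) ncpoly set"
  assumes "computable_over H {} s p"
  obtains C :: "('v, 'w, 'f) circuit" where
    "circuit_oracles C \<subseteq> H" "length C \<le> s + 2" "computes C p"
proof -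
  obtain C :: "('v, 'w, 'f) circuit" where C: "length C \<le> s" "circuit_over H C"
    "p \<in> set (circuit_values C)"
    using computable_overE[OF assms circuit_over_Nil] by auto
  then obtain i where i: "i < length C" "circuit_values C ! i = p"
    by (auto simp: in_set_conv_nth)
  \<comment> \<open>\<open>computes\<close> reads the last gate, so the value is copied to the end
    by adding 0. This accounts for the two additional gates.\<close>
  define C' where "C' = (C @ [Const 0]) @ [Add i (length C)]"
  have "circuit_over H C'"
    using C(2) i(1) unfolding C'_def by (simp only: circuit_over_snoc) simp
  moreover have "last (circuit_values C') = p"
    using i unfolding C'_def by (simp only: circuit_values_snoc) (simp add: nth_append)
  ultimately show ?thesis
    using C(1) by (intro that[of C']) (auto simp: computes_def wf_circuit_def circuit_over_def C'_def)
qed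

lemma computable_over_mono: "computable_over H A s p \<Longrightarrow> s \<le> t \<Longrightarrow> computable_over H A t p"
  unfolding computable_over_def by (meson le_trans)

lemma computable_over_weaken: "computable_over H A s p \<Longrightarrow> A \<subseteq> B \<Longrightarrow> computable_over H B s p"
  unfolding computable_over_def by blast

lemma computable_over_mem: "p \<in> A \<Longrightarrow> computable_over H A 0 p"
  unfolding computable_over_def by (intro allI impI exI[of _ "[]"]) auto

lemma computable_over_var: "computable_over H A 1 (nc_var v)"
  unfolding computable_over_def
  by (intro allI impI exI[of _ "[Input v]"]) (simp add: circuit_over_snoc)

lemma computable_over_const: "computable_over H A 1 (nc_const c)"
  unfolding computable_over_def
  by (intro allI impI exI[of _ "[Const c]"]) (simp add: circuit_over_snoc)

text \<open>The gadgets are appended one after the other. Old values survive an extension, so each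
  gadget applies to the circuit built so far.\<close>

lemma computable_over_all:
  fixes f :: "'i \<Rightarrow> ('v, 'f::ring_1) ncpoly" and C :: "('v, 'w, 'f) circuit"
  assumes "finite I" "\<And>i. i \<in> I \<Longrightarrow> computable_over H A s (f i)"
    and "circuit_over H C" "A \<subseteq> set (circuit_values C)"
  shows "\<exists>C'. length C' \<le> card I * s \<and> circuit_over H (C @ C') \<and> f ` I \<subseteq> set (circuit_values (C @ C'))"
  using assms(1,2)
proof (induction I rule: finite_induct)
  case empty
  then show ?case
    using assms(3) by (intro exI[of _ "[]"]) simp
next
  case (insert i I)
  then obtain C1 where C1: "length C1 \<le> card I * s" "circuit_over H (C @ C1)"
    "f ` I \<subseteq> set (circuit_values (C @ C1))"
    by blast
  obtain C2 where C2: "length C2 \<le> s" "circuit_over H ((C @ C1) @ C2)"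
    "f i \<in> set (circuit_values ((C @ C1) @ C2))"
    using computable_overE[of H A s "f i" "C @ C1"] insert.prems C1(2) assms(4)
      set_circuit_values_append[of C C1] by blast
  have "f ` insert i I \<subseteq> set (circuit_values (C @ (C1 @ C2)))"
    using C1(3) C2(3) set_circuit_values_append[of "C @ C1" C2] by auto
  then show ?case
    using C1 C2 insert.hyps by (intro exI[of _ "C1 @ C2"]) simp
qed

text \<open>The cut rule: the values \<open>f i\<close> are paid for once and may then be used any
  number of times. It expresses the sharing that distinguishes circuits from formulas.\<close>

lemma computable_over_cut:
  assumes "finite I" "\<And>i. i \<in> I \<Longrightarrow> computable_over H A s (f i)"
    and "computable_over H (A \<union> f ` I) t q"
  shows "computable_over H A (card I * s + t) q"
  unfolding computable_over_def
proof (intro allI impI)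
  fix C assume C: "circuit_over H C" "A \<subseteq> set (circuit_values C)"
  obtain C1 where C1: "length C1 \<le> card I * s" "circuit_over H (C @ C1)" "f ` I \<subseteq> set (circuit_values (C @ C1))"
    using computable_over_all[of I H A s f C] assms(1,2) C by blast
  obtain C2 where "length C2 \<le> t" "circuit_over H ((C @ C1) @ C2)" "q \<in> set (circuit_values ((C @ C1) @ C2))"
    using computable_overE[OF assms(3) C1(2)] C1(3) C(2) set_circuit_values_append[of C C1] by blast
  then show "\<exists>C'. length C' \<le> card I * s + t \<and> circuit_over H (C @ C') \<and> q \<in> set (circuit_values (C @ C'))"
    using C1 by (intro exI[of _ "C1 @ C2"]) simp
qed

lemma computable_over_binop_mem:
  fixes p q :: "('v, 'f::ring_1) ncpoly" and H :: "('w, 'f) ncpoly set"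
  assumes "p \<in> A" "q \<in> A"
  shows "computable_over H A 1 (p + q)" "computable_over H A 1 (p * q)"
proof -
  have "\<exists>C'. length C' \<le> 1 \<and> circuit_over H (C @ C') \<and> x \<in> set (circuit_values (C @ C'))"
    if C: "circuit_over H C" "A \<subseteq> set (circuit_values C)" and x: "x \<in> {p + q, p * q}"
    for C :: "('v, 'w, 'f) circuit" and x
  proof -
    obtain i j where "i < length C" "circuit_values C ! i = p" "j < length C" "circuit_values C ! j = q"
      using assms C(2) by (metis in_set_conv_nth length_circuit_values subsetD)
    then show ?thesis
      using C(1) x
      by (intro exI[of _ "[if x = p + q then Add i j else Mult i j]"]) (auto simp: circuit_over_snoc)
  qed
  then show "computable_over H A 1 (p + q)" "computable_over H A 1 (p * q)"
    unfolding computable_over_def by blast+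
qed

lemma
  assumes p: "computable_over H A s p" and q: "computable_over H A t q"
  shows computable_over_add: "computable_over H A (s + t + 1) (p + q)"
    and computable_over_times: "computable_over H A (s + t + 1) (p * q)"
proof -
  have *: "computable_over H A (s + t + 1) x" if x: "computable_over H (insert q (insert p A)) 1 x" for x
  proof -
    have "computable_over H (insert p A) (t + 1) x"
      using computable_over_cut[of "{()}" H "insert p A" t "\<lambda>_. q" 1 x] x
        computable_over_weaken[OF q, of "insert p A"] by auto
    then show ?thesis
      using computable_over_cut[of "{()}" H A s "\<lambda>_. p" "t + 1" x] p by (auto simp: add.assoc)
  qed
  show "computable_over H A (s + t + 1) (p + q)" "computable_over H A (s + t + 1) (p * q)"
    by (rule *, rule computable_over_binop_mem; simp)+
qed

lemma computable_over_sum: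
  assumes "finite I" "\<And>x. x \<in> I \<Longrightarrow> computable_over H A s (p x)"
  shows "computable_over H A (card I * (s + 1) + 1) (sum p I)"
  using assms
proof (induction I rule: finite_induct)
  case empty
  then show ?case
    using computable_over_const[of H A 0] by simp
next
  case (insert x I)
  have "computable_over H A (s + (card I * (s + 1) + 1) + 1) (p x + sum p I)"
    by (rule computable_over_add) (use insert in auto)
  then show ?case
    using insert.hyps by (simp add: algebra_simps)
qed

text \<open>An oracle call is a single gate, so apart from it only the arguments cost anything.
  Their positions in the extended circuit form the argument map \<open>a\<close> of the
  gate.\<close>

lemma computable_over_oracle:
  fixes h :: "('w, 'f::ring_1) ncpoly" and p :: "'w \<Rightarrow> ('v, 'f) ncpoly"
  assumes h: "h \<in> H" and X: "finite X" "nc_vars h \<subseteq> X"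
    and p: "\<And>x. x \<in> X \<Longrightarrow> computable_over H A s (p x)"
  shows "computable_over H A (card X * s + 1) (nc_subst p h)"
  unfolding computable_over_def
proof (intro allI impI)
  fix C :: "('v, 'w, 'f) circuit" assume "circuit_over H C" "A \<subseteq> set (circuit_values C)"
  then obtain C' where C': "length C' \<le> card X * s"
    "circuit_over H (C @ C')" "p ` X \<subseteq> set (circuit_values (C @ C'))"
    using computable_over_all[of X H A s p C] X(1) p by blast
  then have "\<forall>x\<in>X. \<exists>i. i < length (C @ C') \<and> circuit_values (C @ C') ! i = p x"
    by (metis image_subset_iff in_set_conv_nth length_circuit_values)
  then obtain a where a: "\<And>x. x \<in> X \<Longrightarrow> a x < length (C @ C') \<and> circuit_values (C @ C') ! a x = p x"
    by metis
  have "nc_subst (\<lambda>x. circuit_values (C @ C') ! a x) h = nc_subst p h"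
    using a X by (intro nc_subst_cong) blast
  then have "circuit_values (C @ C' @ [Oracle h a]) = circuit_values (C @ C') @ [nc_subst p h]"
    using circuit_values_snoc[of "C @ C'" "Oracle h a"] by simp
  moreover have "a ` nc_vars h \<subseteq> {..<length (C @ C')}"
    using a X(2) by blast
  ultimately show "\<exists>C'. length C' \<le> card X * s + 1 \<and> circuit_over H (C @ C') \<and>
      nc_subst p h \<in> set (circuit_values (C @ C'))"
    using C' h circuit_over_snoc[of H "C @ C'" "Oracle h a"] by (intro exI[of _ "C' @ [Oracle h a]"]) auto
qed

section \<open>Polynomially bounded functions\<close>

lemma poly_bounded_mono:
  assumes "poly_bounded u" "\<And>n. n \<ge> 1 \<Longrightarrow> t n \<le> u n"
  shows "poly_bounded t"
  using assms unfolding poly_bounded_def by (meson le_trans)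

text \<open>The form \<open>c * n ^ c\<close> is convenient for products. For n \<ge> 2 the factor c
  is absorbed because c \<le> 2 ^ c \<le> n ^ c; the case n = 1 is separate.\<close>

lemma poly_bounded_iff: "poly_bounded t \<longleftrightarrow> (\<exists>c. \<forall>n\<ge>1. t n \<le> c * n ^ c)"
proof
  assume "poly_bounded t"
  then obtain c where c: "\<And>n. n \<ge> 1 \<Longrightarrow> t n \<le> n ^ c + c"
    unfolding poly_bounded_def by blast
  have "n ^ c + c \<le> (c + 1) * n ^ (c + 1)" if "n \<ge> 1" for n :: nat
  proof -
    have "n ^ c + c \<le> n ^ c + c * n ^ c" using that by simp
    also have "\<dots> = (c + 1) * n ^ c" by simp
    also have "\<dots> \<le> (c + 1) * n ^ (c + 1)" using that by (intro mult_le_mono power_increasing) auto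
    finally show ?thesis .
  qed
  then show "\<exists>c. \<forall>n\<ge>1. t n \<le> c * n ^ c"
    using c by (meson le_trans)
next
  assume "\<exists>c. \<forall>n\<ge>1. t n \<le> c * n ^ c"
  then obtain c where c: "\<And>n. n \<ge> 1 \<Longrightarrow> t n \<le> c * n ^ c" by blast
  have "c * n ^ c \<le> n ^ (2 * c) + 2 * c" if "n \<ge> 1" for n :: nat
  proof (cases "n = 1")
    case False
    have "c \<le> 2 ^ c" by (simp add: less_imp_le)
    also have "(2::nat) ^ c \<le> n ^ c" using that False by (intro power_mono) auto
    finally have "c * n ^ c \<le> n ^ c * n ^ c" by (rule mult_le_mono1)
    then show ?thesis unfolding mult_2 power_add by linarith
  qed simp
  then show "poly_bounded t"
    unfolding poly_bounded_def using c by (meson le_trans)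
qed

lemma poly_bounded_const [intro]: "poly_bounded (\<lambda>_. k)"
  unfolding poly_bounded_def by (meson le_add2)

lemma poly_bounded_id [intro]: "poly_bounded (\<lambda>n. n)"
  unfolding poly_bounded_def by (intro exI[of _ 1]) simp

lemma poly_bounded_mult [intro]:
  assumes "poly_bounded t" "poly_bounded u"
  shows "poly_bounded (\<lambda>n. t n * u n)"
proof -
  obtain c d where cd: "\<And>n. n \<ge> 1 \<Longrightarrow> t n \<le> c * n ^ c" "\<And>n. n \<ge> 1 \<Longrightarrow> u n \<le> d * n ^ d"
    using assms unfolding poly_bounded_iff by blast
  have "t n * u n \<le> (c + d + c * d) * n ^ (c + d + c * d)" if "n \<ge> 1" for n
  proof -
    have "t n * u n \<le> (c * n ^ c) * (d * n ^ d)"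
      using cd that by (intro mult_le_mono) auto
    also have "\<dots> = (c * d) * n ^ (c + d)" by (simp add: power_add algebra_simps)
    also have "\<dots> \<le> (c + d + c * d) * n ^ (c + d + c * d)"
      using that by (intro mult_le_mono power_increasing) auto
    finally show ?thesis .
  qed
  then show ?thesis unfolding poly_bounded_iff by blast
qed

text \<open>Reduced to products by t + u \<le> (t + 1) (u + 1).\<close>

lemma poly_bounded_add [intro]:
  assumes "poly_bounded t" "poly_bounded u"
  shows "poly_bounded (\<lambda>n. t n + u n)"
proof -
  have "poly_bounded (\<lambda>n. (t n + 1) * (u n + 1))" if
    "poly_bounded (\<lambda>n. t n + 1)" "poly_bounded (\<lambda>n. u n + 1)"
    by (rule poly_bounded_mult[OF that])
  moreover have "poly_bounded (\<lambda>n. v n + 1)" if v: "poly_bounded v" for v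
  proof -
    obtain c where c: "\<And>n. n \<ge> 1 \<Longrightarrow> v n \<le> n ^ c + c"
      using v unfolding poly_bounded_def by blast
    have "v n + 1 \<le> n ^ (c + 1) + (c + 1)" if "n \<ge> 1" for n
      using c[OF that] power_increasing[of c "c + 1" n] that by linarith
    then show ?thesis unfolding poly_bounded_def by blast
  qed
  ultimately have "poly_bounded (\<lambda>n. (t n + 1) * (u n + 1))"
    using assms by blast
  then show ?thesis
    by (rule poly_bounded_mono) simp
qed

lemma poly_bounded_power [intro]: "poly_bounded t \<Longrightarrow> poly_bounded (\<lambda>n. t n ^ k)"
  by (induction k) auto

section \<open>The symmetrized determinant as a sum over walks\<close>

text \<open>The entry \<open>(a, z)\<close> of the product of the listed matrices. The index set
  \<open>X\<close> is arbitrary, so that automata can use their own states as indices.\<close>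

fun walk :: "'x set \<Rightarrow> 'x \<Rightarrow> ('x \<Rightarrow> 'x \<Rightarrow> 'r::ring_1) list \<Rightarrow> 'x \<Rightarrow> 'r" where
  "walk X z [] a = of_bool (a = z)"
| "walk X z (F # Fs) a = (\<Sum>c\<in>X. F a c * walk X z Fs c)"

lemma walk_eq_0:
  assumes "F \<in> set Fs" "\<And>a c. F a c = 0"
  shows "walk X z Fs a = 0"
  using assms by (induction Fs arbitrary: a) auto

lemma nc_subst_of_bool [simp]: "nc_subst s (of_bool b) = of_bool b"
  by (cases b) simp_all

lemma nc_subst_walk:
  fixes Fs :: "('x \<Rightarrow> 'x \<Rightarrow> ('v, 'f::comm_ring_1) ncpoly) list"
  shows "nc_subst s (walk X z Fs a) = walk X z (map (\<lambda>F a c. nc_subst s (F a c)) Fs) a"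
  by (induction Fs arbitrary: a) simp_all

lemma foldr_mat_mult:
  fixes Ms :: "'r::ring_1 mat list"
  assumes "set Ms \<subseteq> carrier_mat m m"
  shows "foldr (*) Ms (1\<^sub>m m) \<in> carrier_mat m m"
    and "a < m \<Longrightarrow> z < m \<Longrightarrow>
      foldr (*) Ms (1\<^sub>m m) $$ (a, z) = walk {..<m} z (map (\<lambda>M a c. M $$ (a, c)) Ms) a"
proof -
  have *: "foldr (*) Ms (1\<^sub>m m) \<in> carrier_mat m m" if "set Ms \<subseteq> carrier_mat m m" for Ms :: "'r mat list"
    using that by (induction Ms) auto
  then show "foldr (*) Ms (1\<^sub>m m) \<in> carrier_mat m m"
    using assms by blast
  show "a < m \<Longrightarrow> z < m \<Longrightarrow>
      foldr (*) Ms (1\<^sub>m m) $$ (a, z) = walk {..<m} z (map (\<lambda>M a c. M $$ (a, c)) Ms) a"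
    using assms
  proof (induction Ms arbitrary: a)
    case (Cons M Ms)
    then have "M \<in> carrier_mat m m" "foldr (*) Ms (1\<^sub>m m) \<in> carrier_mat m m"
      using * by auto
    then have "foldr (*) (M # Ms) (1\<^sub>m m) $$ (a, z) =
        (\<Sum>c<m. M $$ (a, c) * foldr (*) Ms (1\<^sub>m m) $$ (c, z))"
      using Cons.prems by (simp add: times_mat_def scalar_prod_def lessThan_atLeast0)
    then show ?case
      using Cons by simp
  qed simp
qed

lemma abelian_monoid_mat_algebra: "abelian_monoid (mat_algebra m)"
  by (rule abelian_monoidI) (auto simp: mat_algebra_def)

text \<open>Turns the \<open>finsum\<close> in \<open>sdet\<close> entrywise into an ordinary sum of
  polynomials.\<close>

lemma finsum_mat_algebra_index:
  assumes "finite A" "f \<in> A \<rightarrow> carrier_mat m m" "k < m" "l < m"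
  shows "finsum (mat_algebra m) f A \<in> carrier_mat m m"
    and "finsum (mat_algebra m) f A $$ (k, l) = (\<Sum>x\<in>A. f x $$ (k, l))"
proof -
  interpret abelian_monoid "mat_algebra m"
    by (rule abelian_monoid_mat_algebra)
  have carr: "carrier (mat_algebra m) = carrier_mat m m" and zero: "\<zero>\<^bsub>mat_algebra m\<^esub> = 0\<^sub>m m m"
    and add: "x \<oplus>\<^bsub>mat_algebra m\<^esub> y = x + y" for x y
    by (simp_all add: mat_algebra_def)
  have "finsum (mat_algebra m) f A \<in> carrier_mat m m \<and>
      finsum (mat_algebra m) f A $$ (k, l) = (\<Sum>x\<in>A. f x $$ (k, l))"
    using assms(1,2)
  proof (induction A rule: finite_induct)
    case empty
    then show ?case
      using assms(3,4) by (simp add: zero)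
  next
    case (insert x A)
    then have "f \<in> A \<rightarrow> carrier (mat_algebra m)" "f x \<in> carrier (mat_algebra m)"
      by (auto simp: carr)
    then have "finsum (mat_algebra m) f (insert x A) = f x + finsum (mat_algebra m) f A"
      using insert.hyps by (simp add: finsum_insert add)
    then show ?case
      using insert assms(3,4) by auto
  qed
  then show "finsum (mat_algebra m) f A \<in> carrier_mat m m"
    and "finsum (mat_algebra m) f A $$ (k, l) = (\<Sum>x\<in>A. f x $$ (k, l))"
    by auto
qed

lemma sdet_generic_matrix_index:
  assumes "k < m" "l < m"
  shows "sdet (mat_algebra m) n (generic_matrix n m :: (_, 'f::field_char_0) ncpoly mat mat) $$ (k, l) =
    nc_const (1 / fact n) * (\<Sum>(\<sigma>, \<tau>)\<in>{\<sigma>. \<sigma> permutes {..<n}} \<times> {\<tau>. \<tau> permutes {..<n}}.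
      nc_const (of_int (sign \<sigma>) * of_int (sign \<tau>)) *
      walk {..<m} l (map (\<lambda>i a b. nc_var (\<sigma> i, \<tau> i, a, b)) [0..<n]) k)"
    (is "_ = _ * sum ?g (?P \<times> ?P)")
proof -
  define f where "f = (\<lambda>(\<sigma>, \<tau>). (of_int (sign \<sigma>) * of_int (sign \<tau>)) \<odot>\<^bsub>mat_algebra m\<^esub>
      foldr (mult (mat_algebra m)) (map (\<lambda>i. generic_matrix n m $$ (\<sigma> i, \<tau> i)) [0..<n])
        \<one>\<^bsub>mat_algebra m\<^esub> :: (nat \<times> nat \<times> nat \<times> nat, 'f) ncpoly mat)"
  have fin: "finite (?P \<times> ?P)"
    by (simp add: finite_permutations)
  have f: "f p \<in> carrier_mat m m \<and> f p $$ (k, l) = (case p of (\<sigma>, \<tau>) \<Rightarrow> nc_const (of_int (sign \<sigma>) * of_int (sign \<tau>)) *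
      walk {..<m} l (map (\<lambda>i a b. nc_var (\<sigma> i, \<tau> i, a, b)) [0..<n]) k)"
    if p_in: "p \<in> ?P \<times> ?P" for p
  proof -
    obtain \<sigma> \<tau> where p: "p = (\<sigma>, \<tau>)" "\<sigma> permutes {..<n}" "\<tau> permutes {..<n}"
      using p_in by blast
    define Ms :: "(nat \<times> nat \<times> nat \<times> nat, 'f) ncpoly mat list"
      where "Ms = map (\<lambda>i. generic_matrix n m $$ (\<sigma> i, \<tau> i)) [0..<n]"
    have lt: "\<sigma> i < n" "\<tau> i < n" if "i < n" for i
      using that p permutes_in_image[of _ "{..<n}" i] by auto
    have Ms: "Ms = map (\<lambda>i. mat m m (\<lambda>(a, b). nc_var (\<sigma> i, \<tau> i, a, b))) [0..<n]"
      using lt by (auto simp: Ms_def generic_matrix_def)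
    have "foldr (*) Ms (1\<^sub>m m) $$ (k, l) = walk {..<m} l (map (\<lambda>M a c. M $$ (a, c)) Ms) k"
      "foldr (*) Ms (1\<^sub>m m) \<in> carrier_mat m m"
      using assms by (intro foldr_mat_mult; auto simp: Ms)+
    \<comment> \<open>The two entry functions agree only for indices below \<open>m\<close>, so the
      walks are compared by induction on the list instead of rewriting the functions.\<close>
    moreover have "walk {..<m} l (map (\<lambda>M a c. M $$ (a, c)) Ms) a =
        walk {..<m} l (map (\<lambda>i a b. nc_var (\<sigma> i, \<tau> i, a, b)) [0..<n]) a" if "a < m" for a
    proof -
      have "walk {..<m} l (map (\<lambda>M a c. M $$ (a, c)) (map (\<lambda>i. mat m m (\<lambda>(a, b). nc_var (\<sigma> i, \<tau> i, a, b))) xs)) a =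
          (walk {..<m} l (map (\<lambda>i a b. nc_var (\<sigma> i, \<tau> i, a, b)) xs) a :: (nat \<times> nat \<times> nat \<times> nat, 'f) ncpoly)" for xs
        using that by (induction xs arbitrary: a) auto
      then show ?thesis unfolding Ms .
    qed
    ultimately show ?thesis
      using assms by (simp add: p(1) f_def mat_algebra_def flip: Ms_def)
  qed
  have "sdet (mat_algebra m) n (generic_matrix n m) =
      nc_const (1 / fact n) \<cdot>\<^sub>m finsum (mat_algebra m) f (?P \<times> ?P)"
    by (simp add: sdet_def f_def mat_algebra_def)
  moreover have "finsum (mat_algebra m) f (?P \<times> ?P) \<in> carrier_mat m m"
    "finsum (mat_algebra m) f (?P \<times> ?P) $$ (k, l) = (\<Sum>p\<in>?P \<times> ?P. f p $$ (k, l))"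
    using f by (intro finsum_mat_algebra_index[OF fin _ assms]; auto)+
  moreover have "(\<Sum>p\<in>?P \<times> ?P. f p $$ (k, l)) = sum ?g (?P \<times> ?P)"
    using f by (intro sum.cong refl) simp
  ultimately show ?thesis
    using assms by simp
qed

lemma bij_betw_permutations_of_set:
  "bij_betw (\<lambda>\<sigma>. map \<sigma> [0..<n]) {\<sigma>. \<sigma> permutes {..<n}} (permutations_of_set {..<n})"
  unfolding bij_betw_def
proof
  show "inj_on (\<lambda>\<sigma>. map \<sigma> [0..<n]) {\<sigma>. \<sigma> permutes {..<n}}"
  proof (rule inj_onI, rule ext)
    fix \<sigma> \<tau> i assume *: "\<sigma> \<in> {\<sigma>. \<sigma> permutes {..<n}}" "\<tau> \<in> {\<sigma>. \<sigma> permutes {..<n}}"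
      "map \<sigma> [0..<n] = map \<tau> [0..<n]"
    show "\<sigma> i = \<tau> i"
    proof (cases "i < n")
      case False
      then show ?thesis using * by (auto simp: permutes_def)
    qed (use *(3) in auto)
  qed
  show "(\<lambda>\<sigma>. map \<sigma> [0..<n]) ` {\<sigma>. \<sigma> permutes {..<n}} = permutations_of_set {..<n}"
  proof (intro equalityI subsetI)
    fix xs assume "xs \<in> (\<lambda>\<sigma>. map \<sigma> [0..<n]) ` {\<sigma>. \<sigma> permutes {..<n}}"
    then obtain \<sigma> where \<sigma>: "xs = map \<sigma> [0..<n]" "\<sigma> permutes {..<n}" by auto
    then have "set xs = {..<n}" "inj_on \<sigma> {..<n}"
      using permutes_image[OF \<sigma>(2)] permutes_inj_on[OF \<sigma>(2)] by (simp_all add: atLeast0LessThan)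
    then show "xs \<in> permutations_of_set {..<n}"
      using \<sigma>(1) by (intro permutations_of_setI) (simp_all add: distinct_map atLeast0LessThan)
  next
    fix xs assume xs: "xs \<in> permutations_of_set {..<n}"
    then have set: "set xs = {..<n}" and dist: "distinct xs"
      by (auto simp: permutations_of_set_def)
    then have len: "length xs = n"
      using distinct_card[of xs] by simp
    define \<sigma> where "\<sigma> = (\<lambda>i. if i < n then xs ! i else i)"
    have "bij_betw ((!) xs) {..<n} {..<n}"
      by (rule bij_betw_nth) (simp_all add: dist set len)
    moreover have "bij_betw \<sigma> {..<n} {..<n} \<longleftrightarrow> bij_betw ((!) xs) {..<n} {..<n}"
      by (rule bij_betw_cong) (simp add: \<sigma>_def)
    ultimately have "bij_betw \<sigma> {..<n} {..<n}"
      by simp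
    then have "\<sigma> permutes {..<n}"
      by (rule bij_imp_permutes) (simp add: \<sigma>_def)
    moreover have "xs = map \<sigma> [0..<n]"
      using len by (intro nth_equalityI) (auto simp: \<sigma>_def)
    ultimately show "xs \<in> (\<lambda>\<sigma>. map \<sigma> [0..<n]) ` {\<sigma>. \<sigma> permutes {..<n}}"
      by blast
  qed
qed

text \<open>For a block diagonal matrix only the pairs \<^term>\<open>\<sigma> = \<tau>\<close> survive, so the signs cancel and the
  symmetrized determinant becomes the sum of the products of the blocks in all orders.\<close>

lemma nc_subst_sdet_diagonal:
  fixes D :: "nat \<Rightarrow> nat \<Rightarrow> nat \<Rightarrow> ('v, 'f::field_char_0) ncpoly"
  assumes "k < m" "l < m"
  defines "s \<equiv> \<lambda>(i, j, a, b). if i = j then D i a b else 0"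
  shows "nc_subst s (sdet (mat_algebra m) n (generic_matrix n m) $$ (k, l)) =
    nc_const (1 / fact n) * (\<Sum>xs\<in>permutations_of_set {..<n}. walk {..<m} l (map D xs) k)"
proof -
  let ?P = "{\<sigma>. \<sigma> permutes {..<n}}"
  have fin: "finite ?P"
    by (simp add: finite_permutations)
  define G where "G = (\<lambda>\<sigma> \<tau>. walk {..<m} l (map (\<lambda>i a b. s (\<sigma> i, \<tau> i, a, b)) [0..<n]) k)"
  have off: "G \<sigma> \<tau> = 0" if st: "\<sigma> \<in> ?P" "\<tau> \<in> ?P" "\<sigma> \<noteq> \<tau>" for \<sigma> \<tau>
  proof -
    obtain i where i: "\<sigma> i \<noteq> \<tau> i"
      using st(3) by blast
    then have "i < n"
      using st by (metis lessThan_iff mem_Collect_eq permutes_not_in)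
    then show ?thesis
      unfolding G_def using i
      by (intro walk_eq_0[of "\<lambda>a b. s (\<sigma> i, \<tau> i, a, b)"] list.set_map[THEN equalityD2, THEN subsetD])
        (auto simp: s_def intro!: image_eqI[of _ _ i])
  qed
  have diag: "G \<sigma> \<sigma> = walk {..<m} l (map D (map \<sigma> [0..<n])) k" for \<sigma>
    by (simp add: G_def s_def comp_def)
  have "nc_subst s (sdet (mat_algebra m) n (generic_matrix n m) $$ (k, l)) =
      nc_const (1 / fact n) * (\<Sum>(\<sigma>, \<tau>)\<in>?P \<times> ?P. nc_const (of_int (sign \<sigma>) * of_int (sign \<tau>)) * G \<sigma> \<tau>)"
    unfolding sdet_generic_matrix_index[OF assms(1,2)]
    by (simp add: case_prod_unfold nc_subst_walk G_def comp_def)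
  also have "(\<Sum>(\<sigma>, \<tau>)\<in>?P \<times> ?P. nc_const (of_int (sign \<sigma>) * of_int (sign \<tau>)) * G \<sigma> \<tau>) =
      (\<Sum>\<sigma>\<in>?P. \<Sum>\<tau>\<in>?P. nc_const (of_int (sign \<sigma>) * of_int (sign \<tau>)) * G \<sigma> \<tau>)"
    by (rule sum.cartesian_product[symmetric])
  also have "\<dots> = (\<Sum>\<sigma>\<in>?P. G \<sigma> \<sigma>)"
  proof (rule sum.cong[OF refl])
    fix \<sigma> assume \<sigma>: "\<sigma> \<in> ?P"
    have "nc_const (of_int (sign \<sigma>) * of_int (sign \<tau>)) * G \<sigma> \<tau> = 0" if "\<tau> \<in> ?P - {\<sigma>}" for \<tau>
      using off[OF \<sigma>, of \<tau>] that by auto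
    then have "(\<Sum>\<tau>\<in>?P. nc_const (of_int (sign \<sigma>) * of_int (sign \<tau>)) * G \<sigma> \<tau>) =
        (\<Sum>\<tau>\<in>{\<sigma>}. nc_const (of_int (sign \<sigma>) * of_int (sign \<tau>)) * G \<sigma> \<tau>)"
      using \<sigma> fin by (intro sum.mono_neutral_right) blast+
    also have "\<dots> = G \<sigma> \<sigma>"
      by (simp flip: of_int_mult)
    finally show "(\<Sum>\<tau>\<in>?P. nc_const (of_int (sign \<sigma>) * of_int (sign \<tau>)) * G \<sigma> \<tau>) = G \<sigma> \<sigma>" .
  qed
  also have "\<dots> = (\<Sum>xs\<in>permutations_of_set {..<n}. walk {..<m} l (map D xs) k)"
    unfolding diag by (rule sum.reindex_bij_betw[OF bij_betw_permutations_of_set])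
  finally show ?thesis .
qed

section \<open>Variables that occur in a polynomial\<close>

lemma nc_vars_add: "nc_vars (p + q) \<subseteq> nc_vars p \<union> nc_vars q"
  using keys_add[of p q] by (fastforce simp: nc_vars_def)

lemma nc_vars_times: "nc_vars (p * q) \<subseteq> nc_vars p \<union> nc_vars q"
  using keys_mult[of p q] by (fastforce simp: nc_vars_def)

lemma nc_vars_const [simp]: "nc_vars (nc_const c) = {}"
  by (simp add: nc_vars_def nc_const_def)

lemma nc_vars_var: "nc_vars (nc_var v) \<subseteq> {v}"
  by (simp add: nc_vars_def nc_var_def)

lemma nc_vars_sum: "nc_vars (sum p A) \<subseteq> (\<Union>x\<in>A. nc_vars (p x))"
proof (induction A rule: infinite_finite_induct)
  case (insert x A)
  then show ?case
    using nc_vars_add[of "p x" "sum p A"] by auto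
qed (simp_all add: nc_vars_def)

lemma nc_vars_walk:
  assumes "\<And>F a c. F \<in> set Fs \<Longrightarrow> c \<in> X \<Longrightarrow> a \<in> X \<Longrightarrow> nc_vars (F a c) \<subseteq> V" "a \<in> X"
  shows "nc_vars (walk X z Fs a) \<subseteq> V"
  using assms
proof (induction Fs arbitrary: a)
  case Nil
  then show ?case by (simp add: nc_vars_def)
next
  case (Cons F Fs)
  have "nc_vars (F a c * walk X z Fs c) \<subseteq> V" if c: "c \<in> X" for c
  proof (rule subset_trans[OF nc_vars_times Un_least])
    show "nc_vars (F a c) \<subseteq> V"
      using Cons.prems c by simp
    show "nc_vars (walk X z Fs c) \<subseteq> V"
      using Cons.prems c by (intro Cons.IH) simp_all
  qed
  then show ?case
    by (simp add: subset_trans[OF nc_vars_sum UN_least])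
qed

text \<open>Bounds the number of arguments of an oracle gate for this entry.\<close>

lemma nc_vars_sdet_generic_matrix:
  assumes "k < m" "l < m"
  shows "nc_vars (sdet (mat_algebra m) n (generic_matrix n m :: (_, 'f::field_char_0) ncpoly mat mat) $$ (k, l)) \<subseteq>
    {..<n} \<times> {..<n} \<times> {..<m} \<times> {..<m}" (is "_ \<subseteq> ?V")
proof -
  have "nc_vars (nc_const c * walk {..<m} l (map (\<lambda>i a b. nc_var (\<sigma> i, \<tau> i, a, b)) [0..<n]) k) \<subseteq> ?V"
    if "\<sigma> permutes {..<n}" "\<tau> permutes {..<n}" for \<sigma> \<tau> and c :: 'f
  proof -
    have lt: "\<sigma> i < n" "\<tau> i < n" if "i < n" for i
      using that \<open>\<sigma> permutes _\<close> \<open>\<tau> permutes _\<close> permutes_in_image[of _ "{..<n}" i] by auto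
    have "nc_vars (walk {..<m} l (map (\<lambda>i a b. nc_var (\<sigma> i, \<tau> i, a, b)) [0..<n]) k) \<subseteq> ?V"
      using lt assms by (intro nc_vars_walk) (auto dest!: subsetD[OF nc_vars_var])
    then show ?thesis
      by (intro subset_trans[OF nc_vars_times Un_least]) simp_all
  qed
  note * = this
  have "nc_vars (\<Sum>(\<sigma>, \<tau>)\<in>{\<sigma>. \<sigma> permutes {..<n}} \<times> {\<tau>. \<tau> permutes {..<n}}.
      nc_const (of_int (sign \<sigma>) * of_int (sign \<tau>) :: 'f) *
      walk {..<m} l (map (\<lambda>i a b. nc_var (\<sigma> i, \<tau> i, a, b)) [0..<n]) k) \<subseteq> ?V"
    by (intro subset_trans[OF nc_vars_sum] UN_least)
      (elim SigmaE, simp only: case_prod_conv mem_Collect_eq, rule *)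
  then show ?thesis
    unfolding sdet_generic_matrix_index[OF assms]
    by (intro subset_trans[OF nc_vars_times Un_least]) simp_all
qed

section \<open>Automata that consume every letter exactly once\<close>

text \<open>For \<open>X = {..<m}\<close> and \<open>A = {..<n}\<close> this is, up to the factor 1
  / n!, the image of an entry of the symmetrized determinant under the block diagonal substitution
  given by \<open>D\<close>.\<close>

definition walk_sum :: "'x set \<Rightarrow> 'x \<Rightarrow> ('i \<Rightarrow> 'x \<Rightarrow> 'x \<Rightarrow> 'r::ring_1) \<Rightarrow> 'i set \<Rightarrow> 'x \<Rightarrow> 'r" where
  "walk_sum X z D A a = (\<Sum>js\<in>permutations_of_set A. walk X z (map D js) a)"

lemma walk_sum_empty [simp]: "walk_sum X z D {} a = of_bool (a = z)"
  by (simp add: walk_sum_def)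

lemma walk_sum_rec:
  assumes "finite A" "A \<noteq> {}"
  shows "walk_sum X z D A a = (\<Sum>i\<in>A. \<Sum>c\<in>X. D i a c * walk_sum X z D (A - {i}) c)"
proof -
  have "walk_sum X z D A a =
      (\<Sum>i\<in>A. \<Sum>js\<in>(#) i ` permutations_of_set (A - {i}). walk X z (map D js) a)"
    unfolding walk_sum_def permutations_of_set_nonempty[OF assms(2)]
    using assms by (intro sum.UNION_disjoint) auto
  also have "\<dots> = (\<Sum>i\<in>A. \<Sum>js\<in>permutations_of_set (A - {i}). \<Sum>c\<in>X. D i a c * walk X z (map D js) c)"
    by (intro sum.cong[OF refl]) (subst sum.reindex, simp_all)
  also have "\<dots> = (\<Sum>i\<in>A. \<Sum>c\<in>X. D i a c * walk_sum X z D (A - {i}) c)"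
    unfolding walk_sum_def sum_distrib_left by (rule sum.cong[OF refl], rule sum.swap)
  finally show ?thesis .
qed

text \<open>Matrix indices are numbers below \<open>m\<close>, of which there may be more than
  states. The states are numbered by \<open>g\<close>, and the surplus rows and columns are zero, so
  no walk of nonzero weight visits them.\<close>

lemma walk_reindex:
  fixes G :: "'i \<Rightarrow> 'x \<Rightarrow> 'x \<Rightarrow> 'r::ring_1" and m :: nat
  assumes g: "bij_betw g {..<k} X" and k: "k \<le> m" and "l < k" "a < k"
  defines "D \<equiv> \<lambda>i a b. if a < k \<and> b < k then G i (g a) (g b) else 0"
  shows "walk {..<m} l (map D js) a = walk X (g l) (map G js) (g a)"
  using assms(4)
proof (induction js arbitrary: a)
  case Nil
  then show ?case
    using g \<open>l < k\<close> by (auto simp: bij_betw_def inj_on_def)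
next
  case (Cons i js)
  have "walk {..<m} l (map D (i # js)) a = (\<Sum>b<m. D i a b * walk {..<m} l (map D js) b)"
    by simp
  also have "\<dots> = (\<Sum>b<k. D i a b * walk {..<m} l (map D js) b)"
    using k by (intro sum.mono_neutral_right) (auto simp: D_def)
  also have "\<dots> = (\<Sum>b<k. G i (g a) (g b) * walk X (g l) (map G js) (g b))"
    using Cons by (intro sum.cong) (auto simp: D_def)
  also have "\<dots> = walk X (g l) (map G (i # js)) (g a)"
    using sum.reindex_bij_betw[OF g, of "\<lambda>c. G i (g a) c * walk X (g l) (map G js) c"] by simp
  finally show ?case .
qed

lemma card_UN_le_mult:
  assumes "finite I" "\<And>i. i \<in> I \<Longrightarrow> card (A i) \<le> b"
  shows "card (\<Union>i\<in>I. A i) \<le> card I * b"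
proof -
  have "card (\<Union>i\<in>I. A i) \<le> (\<Sum>i\<in>I. card (A i))"
    using assms(1) by (rule card_UN_le)
  also have "\<dots> \<le> card I * b"
    using sum_bounded_above[of I "\<lambda>i. card (A i)" b] assms(2) by simp
  finally show ?thesis .
qed

text \<open>A transition from \<^term>\<open>a\<close> is a pair in \<^term>\<open>T a\<close>: the letters it consumes and its target.\<close>

locale once_automaton =
  fixes S :: "'s set" and fin :: 's and T :: "'s \<Rightarrow> ('l list \<times> 's) set"
    and wt :: "'s \<Rightarrow> 'l list \<times> 's \<Rightarrow> 'r::ring_1" and rk :: "'s \<Rightarrow> nat" and \<Lambda> :: "'l set"
  assumes finite_S: "finite S" and fin_S: "fin \<in> S" and rk_fin: "rk fin = 0" and finite_\<Lambda>: "finite \<Lambda>"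
    and finite_T: "a \<in> S \<Longrightarrow> finite (T a)"
    and T: "a \<in> S \<Longrightarrow> y \<in> T a \<Longrightarrow> snd y \<in> S \<and> distinct (fst y) \<and> set (fst y) \<subseteq> \<Lambda> \<and> rk (snd y) < rk a"
begin

text \<open>The total weight of the runs from \<open>a\<close> to \<open>fin\<close> that consume
  exactly the letters in \<open>A\<close>. The fuel makes the recursion primitive; since ranks
  decrease along transitions, every fuel of at least \<open>rk a\<close> gives the same
  value.\<close>

primrec fuelled_val :: "nat \<Rightarrow> 's \<Rightarrow> 'l set \<Rightarrow> 'r" where
  "fuelled_val 0 a A = of_bool (a = fin \<and> A = {})"
| "fuelled_val (Suc k) a A = (if a = fin then of_bool (A = {}) else
     (\<Sum>y\<in>T a. of_bool (set (fst y) \<subseteq> A) * (wt a y * fuelled_val k (snd y) (A - set (fst y)))))"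

definition val :: "'s \<Rightarrow> 'l set \<Rightarrow> 'r" where
  "val a = fuelled_val (rk a) a"

lemma T_rk_0: "a \<in> S \<Longrightarrow> rk a = 0 \<Longrightarrow> T a = {}"
  using T by fastforce

lemma fuelled_val_eq:
  "a \<in> S \<Longrightarrow> rk a \<le> k \<Longrightarrow> rk a \<le> k' \<Longrightarrow> fuelled_val k a A = fuelled_val k' a A"
proof (induction k arbitrary: k' a A)
  case 0
  then show ?case
    using T_rk_0 by (cases k') auto
next
  case (Suc k)
  show ?case
  proof (cases k')
    case 0
    then show ?thesis using T_rk_0 Suc.prems by auto
  next
    case k': (Suc k'')
    have "fuelled_val k (snd y) A' = fuelled_val k'' (snd y) A'" if "y \<in> T a" for y A'
      using Suc.prems T[OF \<open>a \<in> S\<close> that] by (intro Suc.IH) (auto simp: k')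
    then show ?thesis
      by (simp add: k')
  qed
qed

lemma val_fin [simp]: "val fin A = of_bool (A = {})"
  by (cases "rk fin") (simp_all add: val_def)

lemma val_rec:
  assumes "a \<in> S" "a \<noteq> fin"
  shows "val a A = (\<Sum>y\<in>T a. of_bool (set (fst y) \<subseteq> A) * (wt a y * val (snd y) (A - set (fst y))))"
proof -
  have "val a A = fuelled_val (Suc (rk a)) a A"
    unfolding val_def using assms by (intro fuelled_val_eq) auto
  also have "\<dots> = (\<Sum>y\<in>T a. of_bool (set (fst y) \<subseteq> A) * (wt a y * fuelled_val (rk a) (snd y) (A - set (fst y))))"
    using assms by simp
  also have "\<dots> = (\<Sum>y\<in>T a. of_bool (set (fst y) \<subseteq> A) * (wt a y * val (snd y) (A - set (fst y))))"
    unfolding val_def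
  proof (intro sum.cong refl arg_cong2[where f = "(*)"])
    fix y assume "y \<in> T a"
    then show "fuelled_val (rk a) (snd y) (A - set (fst y)) = fuelled_val (rk (snd y)) (snd y) (A - set (fst y))"
      using T[OF \<open>a \<in> S\<close>, of y] by (intro fuelled_val_eq) auto
  qed
  finally show ?thesis .
qed

text \<open>In state \<^term>\<open>(B, a)\<close> the letters in \<^term>\<open>B\<close> still have to be consumed before \<^term>\<open>a\<close> is
  reached; the label \<^term>\<open>None\<close> is a step without a letter.\<close>

definition hop :: "'l option \<Rightarrow> 'l list \<times> 's \<Rightarrow> 'l list \<times> 's \<Rightarrow> 'r" where
  "hop j x y = (case j of
     None \<Rightarrow> if fst x \<noteq> [] then 0 else if snd x = fin then of_bool (y = ([], fin))
       else if y \<in> T (snd x) then wt (snd x) y else 0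
   | Some j \<Rightarrow> of_bool (x = (j # fst y, snd y)))"

text \<open>Pending letters are always a suffix of the list of some transition. Admitting arbitrary
  lists of distinct letters would make the number of states exponential.\<close>

definition hop_states :: "('l list \<times> 's) set" where
  "hop_states = Pair [] ` S \<union> (\<Union>a\<in>S. \<Union>y\<in>T a. (\<lambda>k. (drop k (fst y), snd y)) ` {..length (fst y)})"

lemma finite_hop_states: "finite hop_states"
  unfolding hop_states_def using finite_S finite_T by auto

lemma hop_states_I: "a \<in> S \<Longrightarrow> y \<in> T a \<Longrightarrow> k \<le> length (fst y) \<Longrightarrow> (drop k (fst y), snd y) \<in> hop_states"
  unfolding hop_states_def by (intro UnI2 UN_I[of a] UN_I[of y] imageI) auto

lemma hop_states_cases:
  assumes "x \<in> hop_states"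
  obtains a where "x = ([], a)" "a \<in> S"
    | a y k where "a \<in> S" "y \<in> T a" "k \<le> length (fst y)" "x = (drop k (fst y), snd y)"
  using assms unfolding hop_states_def by blast

lemma T_subset_hop_states: "a \<in> S \<Longrightarrow> T a \<subseteq> hop_states"
  using hop_states_I[of a _ 0] by auto

lemma hop_states_distinct: "x \<in> hop_states \<Longrightarrow> snd x \<in> S \<and> distinct (fst x)"
  by (elim hop_states_cases) (auto dest: T)

lemma hop_states_Cons:
  assumes "(j # B, a) \<in> hop_states"
  shows "(B, a) \<in> hop_states"
  using assms
proof (cases rule: hop_states_cases)
  case (2 a' y k)
  then have "drop (Suc k) (fst y) = B" "k < length (fst y)"
    by (metis drop_Suc fst_conv list.sel(3) tl_drop, metis drop_eq_Nil2 fst_conv linorder_not_less list.distinct(1))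
  then show ?thesis
    using 2 hop_states_I[of a' y "Suc k"] by auto
qed simp

text \<open>A list of distinct letters from \<open>\<Lambda>\<close> has at most
  \<open>card \<Lambda> + 1\<close> suffixes.\<close>

lemma card_hop_states_le:
  assumes "\<And>a. a \<in> S \<Longrightarrow> card (T a) \<le> t"
  shows "card hop_states \<le> card S + card S * (t * (card \<Lambda> + 1))"
proof -
  define Z where "Z = (\<lambda>y :: 'l list \<times> 's. (\<lambda>k. (drop k (fst y), snd y)) ` {..length (fst y)})"
  have "card (Z y) \<le> card \<Lambda> + 1" if "a \<in> S" "y \<in> T a" for a y
  proof -
    have "length (fst y) \<le> card \<Lambda>"
      using T[OF that] card_mono[OF finite_\<Lambda>, of "set (fst y)"] distinct_card[of "fst y"] by simp
    moreover have "card (Z y) \<le> card {..length (fst y)}"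
      unfolding Z_def by (rule card_image_le) simp
    ultimately show ?thesis by simp
  qed
  then have *: "card (\<Union>y\<in>T a. Z y) \<le> card (T a) * (card \<Lambda> + 1)" if "a \<in> S" for a
    using that by (intro card_UN_le_mult finite_T) auto
  have "card (\<Union>y\<in>T a. Z y) \<le> t * (card \<Lambda> + 1)" if "a \<in> S" for a
    using *[OF that] mult_le_mono1[OF assms[OF that]] by (rule le_trans)
  then have "card (\<Union>a\<in>S. \<Union>y\<in>T a. Z y) \<le> card S * (t * (card \<Lambda> + 1))"
    by (intro card_UN_le_mult finite_S)
  moreover have "card ((Pair [] :: 's \<Rightarrow> 'l list \<times> 's) ` S) \<le> card S"
    using finite_S by (rule card_image_le)
  moreover have "card hop_states \<le> card ((Pair [] :: 's \<Rightarrow> 'l list \<times> 's) ` S) + card (\<Union>a\<in>S. \<Union>y\<in>T a. Z y)"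
    unfolding hop_states_def Z_def by (rule card_Un_le)
  ultimately show ?thesis by linarith
qed

text \<open>The letterless steps are interchangeable, which accounts for the factorial. The hypothesis on
  \<^term>\<open>rk\<close> provides enough of them; what is left over is spent in \<^term>\<open>fin\<close>.\<close>

lemma walk_sum_hop:
  assumes "finite A"
    and "\<And>i i' j. i \<in> A \<Longrightarrow> i' \<in> A \<Longrightarrow> lab i = Some j \<Longrightarrow> lab i' = Some j \<Longrightarrow> i = i'"
    and "(B, a) \<in> hop_states" "rk a \<le> card {i\<in>A. lab i = None}"
  shows "walk_sum hop_states ([], fin) (\<lambda>i. hop (lab i)) A (B, a) =
    of_nat (fact (card {i\<in>A. lab i = None})) *
    (of_bool (set B \<subseteq> {j. Some j \<in> lab ` A}) * val a ({j. Some j \<in> lab ` A} - set B))"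
  using assms
proof (induction "card A" arbitrary: A B a rule: less_induct)
  case less
  define P where "P = walk_sum hop_states ([], fin) (\<lambda>i. hop (lab i))"
  define none where "none = (\<lambda>A. card {i\<in>A. lab i = None})"
  define lets where "lets = (\<lambda>A. {j. Some j \<in> lab ` A})"
  define R where "R = (\<lambda>A B a. of_nat (fact (none A)) * (of_bool (set B \<subseteq> lets A) * val a (lets A - set B)))"
  note fin [simp] = \<open>finite A\<close>
  have a: "a \<in> S" "distinct B"
    using hop_states_distinct[OF less.prems(3)] by auto
  have rk: "rk a \<le> none A"
    using less.prems(4) by (simp add: none_def)
  have IH: "P (A - {i}) (B', a') = R (A - {i}) B' a'"
    if "i \<in> A" "(B', a') \<in> hop_states" "rk a' \<le> none (A - {i})" for i B' a'
    unfolding P_def R_def none_def lets_def using that less.prems(2) card_Diff1_less[OF fin that(1)]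
    by (intro less.hyps) (auto simp: none_def)
  have none_Some: "none (A - {i}) = none A" if i: "lab i = Some j" for i j
  proof -
    have "{i'\<in>A - {i}. lab i' = None} = {i\<in>A. lab i = None}" using i by auto
    then show ?thesis unfolding none_def by simp
  qed
  have none_None: "none A = Suc (none (A - {i}))" if "i \<in> A" "lab i = None" for i
  proof -
    have "{i\<in>A. lab i = None} = insert i {i'\<in>A - {i}. lab i' = None}" using that by auto
    then show ?thesis unfolding none_def by simp
  qed
  have lets_iff: "j \<in> lets A \<longleftrightarrow> (\<exists>i\<in>A. lab i = Some j)" for j A
    unfolding lets_def image_iff mem_Collect_eq by metis
  have lets_Some: "lets (A - {i}) = lets A - {j}" if i: "i \<in> A" "lab i = Some j" for i j
  proof (rule Set.set_eqI)
    fix j'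
    show "j' \<in> lets (A - {i}) \<longleftrightarrow> j' \<in> lets A - {j}"
    proof (cases "j' = j")
      case True
      have "i' = i" if "i' \<in> A" "lab i' = Some j" for i'
        using less.prems(2)[OF that(1) i(1) that(2) i(2)] .
      then show ?thesis using True by (auto simp: lets_iff)
    qed (use i in \<open>auto simp: lets_iff\<close>)
  qed
  have lets_None: "lets (A - {i}) = lets A" if "lab i = None" for i
    using that by (auto simp: set_eq_iff lets_iff)
  have "P A (B, a) = R A B a"
  proof (cases "A = {}")
    case True
    then have "rk a = 0" using less.prems by simp
    then have "val a {} = of_bool (a = fin)" by (simp add: val_def)
    then show ?thesis
      using True by (cases B) (auto simp: P_def R_def none_def lets_def)
  next
    case False
    have rec: "P A (B, a) = (\<Sum>i\<in>A. \<Sum>y\<in>hop_states. hop (lab i) (B, a) y * P (A - {i}) y)"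
      unfolding P_def using False by (intro walk_sum_rec) auto
    show ?thesis
    proof (cases B)
      case B: (Cons j B')
      have B': "(B', a) \<in> hop_states"
        using less.prems(3) hop_states_Cons B by blast
      \<comment> \<open>With \<open>j\<close> at the head of the pending list only an index labelled
        \<open>j\<close> can move. The fixed order of the list makes each transition count once; a
        pending set would count it once for every order of its letters.\<close>
      have steps: "(\<Sum>y\<in>hop_states. hop (lab i) (B, a) y * P (A - {i}) y) =
          of_bool (lab i = Some j) * P (A - {i}) (B', a)" for i
      proof -
        have "hop (lab i) (B, a) y = of_bool (lab i = Some j \<and> y = (B', a))" for y
          by (cases y) (auto simp: hop_def B split: option.splits)
        then have "(\<Sum>y\<in>hop_states. hop (lab i) (B, a) y * P (A - {i}) y) =
            (\<Sum>y\<in>hop_states. if y = (B', a) then of_bool (lab i = Some j) * P (A - {i}) (B', a) else 0)"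
          by (intro sum.cong) auto
        then show ?thesis
          using B' finite_hop_states by simp
      qed
      show ?thesis
      proof (cases "j \<in> lets A")
        case True
        then obtain i where i: "i \<in> A" "lab i = Some j" by (auto simp: lets_iff)
        have "P A (B, a) = (\<Sum>i'\<in>A. if i' = i then P (A - {i}) (B', a) else 0)"
          unfolding rec steps
        proof (rule sum.cong[OF refl])
          fix i' assume "i' \<in> A"
          then have "lab i' = Some j \<longleftrightarrow> i' = i"
            using less.prems(2)[OF _ i(1) _ i(2)] i by blast
          then show "of_bool (lab i' = Some j) * P (A - {i'}) (B', a) = (if i' = i then P (A - {i}) (B', a) else 0)"
            by simp
        qed
        also have "\<dots> = P (A - {i}) (B', a)" using i by simp
        also have "\<dots> = R (A - {i}) B' a"
          using i B' rk by (intro IH) (simp_all add: none_Some[OF i(2)])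
        also have "\<dots> = R A B a"
        proof -
          have "set B' \<subseteq> lets A - {j} \<longleftrightarrow> set B \<subseteq> lets A" "lets A - {j} - set B' = lets A - set B"
            using B a True by auto
          then show ?thesis
            unfolding R_def none_Some[OF i(2)] lets_Some[OF i] by simp
        qed
        finally show ?thesis .
      next
        case False
        then have "lab i \<noteq> Some j" if "i \<in> A" for i
          using that by (auto simp: lets_iff)
        then have "P A (B, a) = 0"
          unfolding rec steps by simp
        then show ?thesis
          using False B by (simp add: R_def)
      qed
    next
      case B: Nil
      have Some: "(\<Sum>y\<in>hop_states. hop (Some j) (B, a) y * P (A - {i}) y) = 0" for i j
        by (intro sum.neutral) (auto simp: hop_def B)
      define Q where "Q = (if a = fin then of_bool (lets A = {}) else
        (\<Sum>y\<in>T a. wt a y * (of_bool (set (fst y) \<subseteq> lets A) * val (snd y) (lets A - set (fst y)))))"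
      have None: "(\<Sum>y\<in>hop_states. hop None (B, a) y * P (A - {i}) y) = of_nat (fact (none (A - {i}))) * Q"
        if i: "i \<in> A" "lab i = None" for i
      proof (cases "a = fin")
        case True
        have "(\<Sum>y\<in>hop_states. hop None (B, a) y * P (A - {i}) y) =
            (\<Sum>y\<in>hop_states. if y = ([], fin) then P (A - {i}) ([], fin) else 0)"
          by (intro sum.cong) (auto simp: hop_def B True)
        also have "\<dots> = P (A - {i}) ([], fin)"
          using less.prems(3) finite_hop_states True B by simp
        also have "\<dots> = of_nat (fact (none (A - {i}))) * Q"
        proof -
          have "P (A - {i}) ([], fin) = R (A - {i}) [] fin"
            using i less.prems(3) True B by (intro IH) (auto simp: rk_fin)
          then show ?thesis
            unfolding R_def lets_None[OF i(2)] Q_def using True by simp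
        qed
        finally show ?thesis .
      next
        case False
        have "(\<Sum>y\<in>hop_states. hop None (B, a) y * P (A - {i}) y) =
            (\<Sum>y\<in>T a. hop None (B, a) y * P (A - {i}) y)"
          using finite_hop_states T_subset_hop_states[OF a(1)] False
          by (intro sum.mono_neutral_right) (auto simp: hop_def B)
        also have "\<dots> = (\<Sum>y\<in>T a. wt a y * (of_nat (fact (none (A - {i}))) *
            (of_bool (set (fst y) \<subseteq> lets A) * val (snd y) (lets A - set (fst y)))))"
        proof (rule sum.cong[OF refl])
          fix y assume y: "y \<in> T a"
          have "P (A - {i}) (fst y, snd y) = R (A - {i}) (fst y) (snd y)"
            using i y T_subset_hop_states[OF a(1)] T[OF a(1) y] rk none_None[OF i]
            by (intro IH) auto
          then show "hop None (B, a) y * P (A - {i}) y = wt a y * (of_nat (fact (none (A - {i}))) *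
            (of_bool (set (fst y) \<subseteq> lets A) * val (snd y) (lets A - set (fst y))))"
            using False y by (simp add: hop_def B R_def lets_None[OF i(2)])
        qed
        also have "\<dots> = of_nat (fact (none (A - {i}))) * Q"
          using False by (simp add: Q_def sum_distrib_left mult.assoc mult_of_nat_commute)
        finally show ?thesis .
      qed
      have Q: "Q = val a (lets A)"
      proof (cases "a = fin")
        case False
        then show ?thesis
          unfolding val_rec[OF a(1) False] by (auto simp: Q_def intro!: sum.cong)
      qed (simp add: Q_def)
      \<comment> \<open>Any of the \<open>none A\<close> letterless indices may be used now, with
        the same outcome; this turns the factorial of \<open>none A - 1\<close> into that of
        \<open>none A\<close>.\<close>
      have "P A (B, a) = (\<Sum>i\<in>{i\<in>A. lab i = None}. of_nat (fact (none A - 1)) * Q)"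
        unfolding rec
      proof (rule sum.mono_neutral_cong_right)
        fix i assume "i \<in> {i\<in>A. lab i = None}"
        then show "(\<Sum>y\<in>hop_states. hop (lab i) (B, a) y * P (A - {i}) y) = of_nat (fact (none A - 1)) * Q"
          using None[of i] none_None[of i] by simp
      next
        show "\<forall>i\<in>A - {i\<in>A. lab i = None}. (\<Sum>y\<in>hop_states. hop (lab i) (B, a) y * P (A - {i}) y) = 0"
        proof
          fix i assume "i \<in> A - {i\<in>A. lab i = None}"
          then obtain j where "lab i = Some j" by auto
          then show "(\<Sum>y\<in>hop_states. hop (lab i) (B, a) y * P (A - {i}) y) = 0"
            using Some by simp
        qed
      qed auto
      also have "\<dots> = of_nat (none A * fact (none A - 1)) * Q"
        by (simp add: none_def mult.assoc)
      also have "\<dots> = R A B a"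
      proof (cases "none A")
        case 0
        \<comment> \<open>Without letterless indices the walks contribute 0, while the factorial on
          the other side is 1, so the value itself must vanish. Indeed letters are left over if the
          state is \<open>fin\<close>, and otherwise its rank is 0 and it has no
          transitions.\<close>
        have "Q = 0"
        proof (cases "a = fin")
          case True
          obtain i where "i \<in> A" using \<open>A \<noteq> {}\<close> by auto
          moreover from this have "lab i \<noteq> None" using 0 none_None by auto
          ultimately have "lets A \<noteq> {}" by (auto simp: set_eq_iff lets_iff)
          then show ?thesis using True by (simp add: Q_def)
        next
          case False
          then have "T a = {}"
            using rk 0 a by (intro T_rk_0) simp_all
          then show ?thesis using False by (simp add: Q_def)
        qed
        then show ?thesis
          using 0 B Q by (simp add: R_def)
      next
        case (Suc k)
        then show ?thesis
          by (simp add: R_def B Q)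
      qed
      finally show ?thesis .
    qed
  qed
  then show ?case
    by (simp add: P_def R_def none_def lets_def)
qed

text \<open>The same \<open>N\<close> is the number of letters and the dimension of the matrices, as
  an oracle of the family with \<open>m = (\<lambda>n. n)\<close> requires. The \<open>K\<close>
  letterless indices provide for both: they suffice for the longest run from \<open>start\<close>,
  and they raise \<open>N\<close> to at least the number of states. \<open>Wt\<close> keeps track of
  which entries have to be plugged into the oracle.\<close>

lemma walk_sum_encoding:
  assumes start: "start \<in> S" and K: "rk start \<le> K" "card hop_states \<le> card \<Lambda> + K"
    and Wt: "0 \<in> Wt" "1 \<in> Wt" "\<And>a y. a \<in> S \<Longrightarrow> y \<in> T a \<Longrightarrow> wt a y \<in> Wt"
  defines "N \<equiv> card \<Lambda> + K"
  obtains D :: "nat \<Rightarrow> nat \<Rightarrow> nat \<Rightarrow> 'r" and k l where "k < N" "l < N" "\<And>i a b. D i a b \<in> Wt"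
    "walk_sum {..<N} l D {..<N} k = of_nat (fact K) * val start \<Lambda>"
proof -
  obtain ls where ls: "set ls = \<Lambda>" "distinct ls"
    using finite_distinct_list[OF finite_\<Lambda>] by blast
  have len: "length ls = card \<Lambda>"
    using ls distinct_card by fastforce
  define lab where "lab i = (if i < card \<Lambda> then Some (ls ! i) else None)" for i
  have none: "{i\<in>{..<N}. lab i = None} = {card \<Lambda>..<N}"
    by (auto simp: lab_def)
  have "x \<in> \<Lambda> \<longleftrightarrow> (\<exists>i<N. Some x = lab i)" for x
  proof -
    have "x \<in> \<Lambda> \<longleftrightarrow> (\<exists>i<card \<Lambda>. ls ! i = x)"
      using len by (auto simp: in_set_conv_nth simp flip: ls(1))
    also have "\<dots> \<longleftrightarrow> (\<exists>i<N. Some x = lab i)"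
      by (auto simp: lab_def N_def)
    finally show ?thesis .
  qed
  then have lets: "{x. Some x \<in> lab ` {..<N}} = \<Lambda>"
    by (simp add: set_eq_iff image_iff Bex_def)
  have walk_sum: "walk_sum hop_states ([], fin) (\<lambda>i. hop (lab i)) {..<N} ([], start) =
      of_nat (fact K) * val start \<Lambda>"
  proof (subst walk_sum_hop)
    show "i = i'" if "lab i = Some j" "lab i' = Some j" for i i' j
      using that ls(2) len by (auto simp: lab_def nth_eq_iff_index_eq split: if_splits)
    show "([], start) \<in> hop_states"
      using start by (simp add: hop_states_def)
    show "rk start \<le> card {i\<in>{..<N}. lab i = None}"
      using K(1) unfolding none by (simp add: N_def)
    show "of_nat (fact (card {i\<in>{..<N}. lab i = None})) *
      (of_bool (set [] \<subseteq> {j. Some j \<in> lab ` {..<N}}) * val start ({j. Some j \<in> lab ` {..<N}} - set [])) =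
      of_nat (fact K) * val start \<Lambda>"
      unfolding none lets by (simp add: N_def)
  qed simp
  define M where "M = card hop_states"
  obtain g where g: "bij_betw g {..<M} hop_states"
    using ex_bij_betw_nat_finite[OF finite_hop_states] unfolding M_def atLeast0LessThan by blast
  define D where "D = (\<lambda>i a b. if a < M \<and> b < M then hop (lab i) (g a) (g b) else 0)"
  have "([], start) \<in> g ` {..<M}" "([], fin) \<in> g ` {..<M}"
    using start fin_S bij_betw_imp_surj_on[OF g] by (auto simp: hop_states_def)
  then obtain k l where kl: "k < M" "g k = ([], start)" "l < M" "g l = ([], fin)"
    by (metis (no_types, lifting) imageE lessThan_iff)
  have M: "M \<le> N"
    using K(2) by (simp add: M_def N_def)
  have "walk_sum {..<N} l D {..<N} k = of_nat (fact K) * val start \<Lambda>"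
    unfolding walk_sum[symmetric] walk_sum_def D_def
    using walk_reindex[OF g M kl(3,1), of "\<lambda>i. hop (lab i)"] kl by simp
  moreover have "D i a b \<in> Wt" for i a b
  proof (cases "a < M \<and> b < M")
    case True
    then have "g a \<in> hop_states"
      using bij_betw_imp_surj_on[OF g] by auto
    then have "snd (g a) \<in> S"
      using hop_states_distinct by blast
    then show ?thesis
      using Wt True unfolding D_def hop_def by (auto split: option.splits)
  qed (auto simp: D_def Wt)
  ultimately show ?thesis
    using kl M by (intro that[of k l D]) auto
qed

end

section \<open>Traversing parse trees\<close>

text \<open>\<^term>\<open>Node v p q\<close> is about to expand symbol \<^term>\<open>v\<close> between the positions \<^term>\<open>p\<close> and
  \<^term>\<open>q\<close> of the word; \<^term>\<open>Leaf v p i\<close> reads the letter at position \<^term>\<open>p\<close> after having looked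
  at the first \<^term>\<open>i\<close> summation bits; \<^term>\<open>Pos t\<close> resumes at the right child that starts at
  position \<^term>\<open>t\<close>.\<close>

datatype cell = Start nat | Node nat nat nat | Leaf nat nat nat | Pos nat

text \<open>\<^term>\<open>Push t v q\<close> stores the right child \<^term>\<open>v\<close> between \<^term>\<open>t\<close> and \<^term>\<open>q\<close>. The start
  positions of right children are distinct, so no stack is needed. \<^term>\<open>Bit b i p\<close> is
  available at position \<^term>\<open>p\<close> iff the summation bit \<^term>\<open>i\<close> is \<^term>\<open>b\<close>.\<close>

datatype token = Push nat nat nat | Bit bool nat nat

text \<open>The order in which the traversal exhausts the tokens: the pushes for position t are
  finished on resuming at t, and then the bits at t are read by the leaf there. Pushes have even and
  bits odd levels, so \<open>2 * t\<close> and \<open>2 * t + 1\<close> separate these two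
  moments.\<close>

fun level :: "token \<Rightarrow> nat" where
  "level (Push t v q) = 2 * t"
| "level (Bit b i p) = 2 * p + 1"

text \<open>Transitions carry lists, but some consume whole sets of tokens; any fixed order will
  do.\<close>

definition list_of_set :: "'a set \<Rightarrow> 'a list" where
  "list_of_set A = (SOME xs. set xs = A \<and> distinct xs)"

lemma list_of_set:
  assumes "finite A"
  shows "set (list_of_set A) = A" "distinct (list_of_set A)"
  using someI_ex[OF finite_distinct_list[OF assms]] by (simp_all add: list_of_set_def)

text \<open>\<open>V e v k\<close> stands for the total weight of the parse trees with root symbol
  \<open>v\<close> over words of length \<open>k\<close>, where \<open>e\<close> is the set of
  summation bits that are 1. A symbol is rewritten into a smaller one with weight
  \<open>lin\<close>, split into two symbols by \<open>mul\<close>, or becomes a leaf, which may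
  require a bit to be 1. Both parts of a split have positive length.\<close>

locale parse_automaton =
  fixes s d r root :: nat and lin :: "nat \<Rightarrow> nat \<Rightarrow> 'r::ring_1" and mul :: "nat \<Rightarrow> (nat \<times> nat) option"
    and bit :: "nat \<Rightarrow> nat option" and leaf :: "nat \<Rightarrow> 'r" and V :: "nat set \<Rightarrow> nat \<Rightarrow> nat \<Rightarrow> 'r"
  assumes d: "0 < d" and root: "root < s"
    and mul: "v < s \<Longrightarrow> mul v = Some (i, j) \<Longrightarrow> i < v \<and> j < v"
    and bit: "v < s \<Longrightarrow> bit v = Some i \<Longrightarrow> i < r"
    and V: "e \<subseteq> {..<r} \<Longrightarrow> v < s \<Longrightarrow> 0 < k \<Longrightarrow> V e v k =
      (\<Sum>v'<v. lin v v' * V e v' k) +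
      (case mul v of None \<Rightarrow> 0 | Some (i, j) \<Rightarrow> \<Sum>t\<in>{0<..<k}. V e i t * V e j (k - t)) +
      of_bool (k = 1 \<and> (\<forall>i. bit v = Some i \<longrightarrow> i \<in> e)) * leaf v"
begin

definition cells :: "cell set" where
  "cells = Start ` {..r} \<union> (\<lambda>(v, p, q). Node v p q) ` ({..<s} \<times> {(p, q). p < q \<and> q \<le> d}) \<union>
     (\<lambda>(v, p, i). Leaf v p i) ` ({..<s} \<times> {..<d} \<times> {..r}) \<union> Pos ` {0<..d}"

definition pushes :: "nat \<Rightarrow> token set" where
  "pushes t = (\<lambda>(v, q). Push t v q) ` ({..<s} \<times> {t<..d})"

definition tokens :: "token set" where
  "tokens = (\<Union>t\<in>{0<..<d}. pushes t) \<union> (\<lambda>(b, i, p). Bit b i p) ` (UNIV \<times> {..<r} \<times> {..<d})"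

text \<open>\<open>Start i\<close> consumes all copies of one value of bit \<open>i\<close>, so that
  leaves can only read the other value. A leaf reads one copy of every bit, needed or not, because
  all copies must be used up. \<open>Pos t\<close> guesses the stored child by consuming every push
  for \<open>t\<close> except the guessed one.\<close>

primrec trans :: "cell \<Rightarrow> (token list \<times> cell) set" where
  "trans (Start i) = (if i < r then (\<lambda>b. (list_of_set (Bit b i ` {..<d}), Start (Suc i))) ` UNIV
     else {([], Node root 0 d)})"
| "trans (Node v p q) = (\<lambda>v'. ([], Node v' p q)) ` {..<v} \<union>
     ((case mul v of None \<Rightarrow> {} | Some (i, j) \<Rightarrow> (\<lambda>t. ([Push t j q], Node i p t)) ` {p<..<q}) \<union>
     (if q = Suc p then {([], Leaf v p 0)} else {}))"
| "trans (Leaf v p i) = (if i < r then (\<lambda>b. ([Bit b i p], Leaf v p (Suc i))) ` UNIV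
     else {([], Pos (Suc p))})"
| "trans (Pos t) = (if t < d
     then (\<lambda>(v, q). (list_of_set (pushes t - {Push t v q}), Node v t q)) ` ({..<s} \<times> {t<..d}) else {})"

text \<open>Only rewriting and the end of a leaf carry polynomial weights; they are multiplied in
  the order of the traversal, which visits the left child of a product before the right one. A leaf
  is killed when its own bit reads \<open>False\<close>.\<close>

primrec weight :: "cell \<Rightarrow> token list \<times> cell \<Rightarrow> 'r" where
  "weight (Start i) y = 1"
| "weight (Node v p q) y = (case y of ([], Node v' _ _) \<Rightarrow> lin v v' | _ \<Rightarrow> 1)"
| "weight (Leaf v p i) y =
     (if i < r then of_bool (\<not> (fst y = [Bit False i p] \<and> bit v = Some i)) else leaf v)"
| "weight (Pos t) y = 1"

text \<open>Lexicographic: the remaining positions, in blocks of size s + r + 4, and then the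
  progress at the current position. The offset of a node is below the block size and above that of
  every leaf at its position.\<close>

primrec rank :: "cell \<Rightarrow> nat" where
  "rank (Start i) = d * (s + r + 4) + Suc (r - i)"
| "rank (Node v p q) = (d - Suc p) * (s + r + 4) + v + r + 3"
| "rank (Leaf v p i) = (d - Suc p) * (s + r + 4) + Suc (r - i)"
| "rank (Pos t) = (d - t) * (s + r + 4)"

lemma cells_simps [simp]:
  "Start i \<in> cells \<longleftrightarrow> i \<le> r"
  "Node v p q \<in> cells \<longleftrightarrow> v < s \<and> p < q \<and> q \<le> d"
  "Leaf v p i \<in> cells \<longleftrightarrow> v < s \<and> p < d \<and> i \<le> r"
  "Pos t \<in> cells \<longleftrightarrow> 0 < t \<and> t \<le> d"
  by (auto simp: cells_def image_iff)

lemma Push_in_pushes [simp]: "Push t v q \<in> pushes t' \<longleftrightarrow> t = t' \<and> v < s \<and> t < q \<and> q \<le> d"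
  by (auto simp: pushes_def image_iff)

lemma Bit_in_pushes [simp]: "Bit b i p \<notin> pushes t"
  by (auto simp: pushes_def)

lemma level_pushes: "x \<in> pushes t \<Longrightarrow> level x = 2 * t"
  by (auto simp: pushes_def)

lemma tokens_simps [simp]:
  "Push t v q \<in> tokens \<longleftrightarrow> 0 < t \<and> t < d \<and> v < s \<and> t < q \<and> q \<le> d"
  "Bit b i p \<in> tokens \<longleftrightarrow> i < r \<and> p < d"
  by (auto simp: tokens_def image_iff)

lemma finite_pushes [simp]: "finite (pushes t)"
  by (simp add: pushes_def)

lemma finite_pairs: "finite {(p, q). p < q \<and> q \<le> (d::nat)}"
  by (rule finite_subset[of _ "{..d} \<times> {..d}"]) auto

lemma rank_Suc:
  assumes "p < d"
  shows "(d - p) * (s + r + 4) = (d - Suc p) * (s + r + 4) + (s + r + 4)"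
  using assms by (metis Suc_diff_Suc add.commute mult_Suc)

sublocale once_automaton cells "Pos d" trans weight rank tokens
proof
  show "finite cells"
    using finite_pairs by (simp add: cells_def)
  show "Pos d \<in> cells"
    using d by simp
  show "finite tokens"
    by (simp add: tokens_def)
  show "finite (trans a)" if "a \<in> cells" for a
    by (cases a) (auto split: option.splits)
  show "snd y \<in> cells \<and> distinct (fst y) \<and> set (fst y) \<subseteq> tokens \<and> rank (snd y) < rank a"
    if a: "a \<in> cells" and y: "y \<in> trans a" for a y
  proof (cases a)
    case (Start i)
    show ?thesis
    proof (cases "i < r")
      case True
      then show ?thesis
        using y list_of_set[of "Bit _ i ` {..<d}"] by (auto simp: Start)
    next
      case False
      then show ?thesis
        using y d root rank_Suc[of 0] by (auto simp: Start)
    qed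
  next
    case (Node v p q)
    then have v: "v < s" "p < q" "q \<le> d" using a by auto
    from y consider v' where "v' < v" "y = ([], Node v' p q)"
      | i j t where "mul v = Some (i, j)" "p < t" "t < q" "y = ([Push t j q], Node i p t)"
      | "q = Suc p" "y = ([], Leaf v p 0)"
      unfolding Node by (auto split: option.splits if_splits)
    then show ?thesis
    proof cases
      case 2
      then show ?thesis
        using mul[OF v(1) 2(1)] v by (auto simp: Node)
    qed (use v in \<open>auto simp: Node\<close>)
  next
    case (Leaf v p i)
    then have v: "v < s" "p < d" "i \<le> r" using a by auto
    then show ?thesis
      using y by (auto simp: Leaf split: if_splits)
  next
    case (Pos t)
    then have t: "0 < t" "t \<le> d" using a by auto
    then have "t < d" using y by (auto simp: Pos split: if_splits)
    then obtain v q where vq: "v < s" "t < q" "q \<le> d" "y = (list_of_set (pushes t - {Push t v q}), Node v t q)"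
      using y by (auto simp: Pos)
    have "pushes t - {Push t v q} \<subseteq> tokens"
      using t \<open>t < d\<close> by (auto simp: tokens_def)
    then show ?thesis
      using vq \<open>t < d\<close> rank_Suc[of t] list_of_set[of "pushes t - {Push t v q}"] by (auto simp: Pos)
  qed
qed simp

section \<open>Values of the cells of the traversal\<close>

definition full :: "nat set \<Rightarrow> token set" where
  "full e = {x \<in> tokens. \<forall>b i p. x = Bit b i p \<longrightarrow> b = (i \<in> e)}"

text \<open>Describes the tokens left when a position is reached: whatever the route, those below
  the corresponding level are gone. \<open>full e\<close> is what the guessing of the bits leaves
  for the traversal.\<close>

definition cut :: "nat \<Rightarrow> token set \<Rightarrow> token set" where
  "cut t A = {x\<in>A. t \<le> level x}"

lemma full_simps [simp]:
  "Push t v q \<in> full e \<longleftrightarrow> Push t v q \<in> tokens"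
  "Bit b i p \<in> full e \<longleftrightarrow> i < r \<and> p < d \<and> b = (i \<in> e)"
  by (auto simp: full_def)

text \<open>Only the copy with the correct value of each bit is present, so the run is forced. It
  survives iff the bit that the leaf may depend on is 1, and it uses up everything below level
  \<open>2 * Suc p\<close>.\<close>

lemma val_Leaf:
  assumes "v < s" "p < d" "i \<le> r"
    and "\<And>x. level x < 2 * Suc p \<Longrightarrow> x \<in> A \<longleftrightarrow> (\<exists>i'. x = Bit (i' \<in> e) i' p \<and> i \<le> i' \<and> i' < r)"
  shows "val (Leaf v p i) A = of_bool (\<forall>i'. i \<le> i' \<longrightarrow> bit v = Some i' \<longrightarrow> i' \<in> e) *
    (leaf v * val (Pos (Suc p)) (cut (2 * Suc p) A))"
  using assms(3,4)
proof (induction i arbitrary: A rule: inc_induct)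
  case base
  have "\<not> level x < 2 * Suc p" if "x \<in> A" for x
    using base[of x] that by auto
  then have "cut (2 * Suc p) A = A"
    by (auto simp: cut_def not_less)
  moreover have "(\<forall>i'. r \<le> i' \<longrightarrow> bit v = Some i' \<longrightarrow> i' \<in> e)"
    using bit[OF assms(1)] by (auto simp: leD)
  ultimately show ?case
    using assms by (subst val_rec) auto
next
  case (step i)
  define x where "x = (\<lambda>b. Bit b i p)"
  have x_in: "x b \<in> A \<longleftrightarrow> b = (i \<in> e)" for b
    using step.prems[of "x b"] step.hyps by (auto simp: x_def)
  let ?A = "A - {x (i \<in> e)}"
  have IH: "val (Leaf v p (Suc i)) ?A = of_bool (\<forall>i'. Suc i \<le> i' \<longrightarrow> bit v = Some i' \<longrightarrow> i' \<in> e) *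
    (leaf v * val (Pos (Suc p)) (cut (2 * Suc p) ?A))"
  proof (rule step.IH)
    fix y assume y: "level y < 2 * Suc p"
    show "y \<in> ?A \<longleftrightarrow> (\<exists>i'. y = Bit (i' \<in> e) i' p \<and> Suc i \<le> i' \<and> i' < r)"
      using step.prems[OF y] by (auto simp: x_def Suc_le_eq le_less)
  qed
  have cut: "cut (2 * Suc p) ?A = cut (2 * Suc p) A"
    by (auto simp: cut_def x_def)
  have "val (Leaf v p i) A = (\<Sum>b\<in>UNIV. of_bool (x b \<in> A) *
      (of_bool (\<not> (\<not> b \<and> bit v = Some i)) * val (Leaf v p (Suc i)) (A - {x b})))"
  proof -
    have inj: "inj (\<lambda>b. ([x b], Leaf v p (Suc i)))"
      by (auto simp: inj_def x_def)
    have tr: "trans (Leaf v p i) = range (\<lambda>b. ([x b], Leaf v p (Suc i)))"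
      using step.hyps by (simp add: x_def)
    have "val (Leaf v p i) A = (\<Sum>y\<in>trans (Leaf v p i). of_bool (set (fst y) \<subseteq> A) *
        (weight (Leaf v p i) y * val (snd y) (A - set (fst y))))"
      using assms step.hyps by (intro val_rec) auto
    also have "\<dots> = (\<Sum>b\<in>UNIV. of_bool (x b \<in> A) *
        (of_bool (\<not> (\<not> b \<and> bit v = Some i)) * val (Leaf v p (Suc i)) (A - {x b})))"
      unfolding tr sum.reindex[OF inj] using step.hyps by (intro sum.cong refl) (auto simp: x_def)
    finally show ?thesis .
  qed
  also have "\<dots> = of_bool (bit v = Some i \<longrightarrow> i \<in> e) * val (Leaf v p (Suc i)) ?A"
  proof -
    have "(\<Sum>b\<in>UNIV. f b) = f True + f False" for f :: "bool \<Rightarrow> 'r"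
      by (simp add: UNIV_bool add.commute)
    then show ?thesis
      unfolding x_in by (cases "i \<in> e") auto
  qed
  also have "\<dots> = of_bool (\<forall>i'. i \<le> i' \<longrightarrow> bit v = Some i' \<longrightarrow> i' \<in> e) *
    (leaf v * val (Pos (Suc p)) (cut (2 * Suc p) A))"
  proof -
    have "(\<forall>i'. i \<le> i' \<longrightarrow> bit v = Some i' \<longrightarrow> i' \<in> e) \<longleftrightarrow>
        (bit v = Some i \<longrightarrow> i \<in> e) \<and> (\<forall>i'. Suc i \<le> i' \<longrightarrow> bit v = Some i' \<longrightarrow> i' \<in> e)"
      by (metis Suc_leD le_SucE le_antisym not_less_eq_eq)
    then show ?thesis
      by (simp only: IH cut of_bool_conj mult.assoc)
  qed
  finally show ?case .
qed

text \<open>A wrong guess has to consume \<open>Push t j q\<close>, which is already gone since it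
  was consumed to store the child. Hence a single term of the sum survives.\<close>

lemma val_Pos:
  assumes "0 < t" "t < q" "q \<le> d" "j < s"
    and A: "\<And>x. level x \<le> 2 * t \<Longrightarrow> x \<in> A \<longleftrightarrow> x \<in> pushes t - {Push t j q}"
  shows "val (Pos t) A = val (Node j t q) (cut (2 * t + 1) A)"
proof -
  define B where "B = (\<lambda>(v, q). pushes t - {Push t v q})"
  have B: "set (list_of_set (B vq)) = B vq" for vq
    by (cases vq) (simp add: B_def list_of_set)
  have sub: "B vq \<subseteq> A \<longleftrightarrow> vq = (j, q)" if vq: "vq \<in> {..<s} \<times> {t<..d}" for vq
  proof (cases "vq = (j, q)")
    case True
    have "x \<in> A" if x: "x \<in> B (j, q)" for x
      using x A[of x] level_pushes[of x t] by (simp add: B_def)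
    then show ?thesis using True by blast
  next
    case False
    then have "Push t j q \<in> B vq" using assms vq by (auto simp: B_def)
    moreover have "Push t j q \<notin> A" using A[of "Push t j q"] by simp
    ultimately show ?thesis using False by auto
  qed
  have "A - B (j, q) = cut (2 * t + 1) A"
  proof (rule Set.set_eqI)
    fix x
    show "x \<in> A - B (j, q) \<longleftrightarrow> x \<in> cut (2 * t + 1) A"
    proof (cases "level x \<le> 2 * t")
      case True
      then show ?thesis using A[OF True] by (auto simp: B_def cut_def)
    next
      case False
      then have "x \<notin> pushes t" by (auto simp: pushes_def)
      then show ?thesis using False by (auto simp: B_def cut_def)
    qed
  qed
  moreover have "val (Pos t) A = (\<Sum>(v, q)\<in>{..<s} \<times> {t<..d}. of_bool (B (v, q) \<subseteq> A) * val (Node v t q) (A - B (v, q)))"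
  proof -
    have inj: "inj_on (\<lambda>(v, q). (list_of_set (B (v, q)), Node v t q)) ({..<s} \<times> {t<..d})"
      by (auto simp: inj_on_def)
    have tr: "trans (Pos t) = (\<lambda>(v, q). (list_of_set (B (v, q)), Node v t q)) ` ({..<s} \<times> {t<..d})"
      using assms by (simp add: B_def)
    have "val (Pos t) A = (\<Sum>y\<in>trans (Pos t). of_bool (set (fst y) \<subseteq> A) * (weight (Pos t) y * val (snd y) (A - set (fst y))))"
      using assms by (intro val_rec) auto
    then show ?thesis
      unfolding tr sum.reindex[OF inj] by (simp add: case_prod_unfold comp_def B del: trans.simps)
  qed
  moreover have "\<dots> = (\<Sum>vq\<in>{(j, q)}. case vq of (v, q) \<Rightarrow> of_bool (B (v, q) \<subseteq> A) * val (Node v t q) (A - B (v, q)))"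
    using assms by (intro sum.mono_neutral_right) (auto simp: sub of_bool_def split: if_splits)
  ultimately show ?thesis
    using sub[of "(j, q)"] assms by simp
qed

text \<open>The invariant of the traversal. Below level \<open>2 * q\<close> the tokens of the
  segment are untouched; above it \<open>A\<close> is arbitrary, because enclosing products have
  already stored their right children there. At a split at t the token \<open>Push t j q\<close> is
  removed; its level is \<open>2 * t\<close>, so the hypothesis for the left child, which speaks of
  levels below \<open>2 * t\<close>, is not affected, and \<open>val_Pos\<close> then recovers the
  right child.\<close>

lemma val_Node:
  assumes e: "e \<subseteq> {..<r}" and "v < s" "p < q" "q \<le> d"
    and "\<And>x. level x < 2 * q \<Longrightarrow> x \<in> A \<longleftrightarrow> x \<in> full e \<and> 2 * p < level x"
  shows "val (Node v p q) A = V e v (q - p) * val (Pos q) (cut (2 * q) A)"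
  using assms(2-)
proof (induction v arbitrary: p q A rule: less_induct)
  case (less v)
  define X where "X = val (Pos q) (cut (2 * q) A)"
  define f where "f = (\<lambda>y. of_bool (set (fst y) \<subseteq> A) * (weight (Node v p q) y * val (snd y) (A - set (fst y))))"
  define T1 where "T1 = (\<lambda>v'. ([] :: token list, Node v' p q)) ` {..<v}"
  define T2 where "T2 = (case mul v of None \<Rightarrow> {} | Some (i, j) \<Rightarrow> (\<lambda>t. ([Push t j q], Node i p t)) ` {p<..<q})"
  define T3 where "T3 = (if q = Suc p then {([] :: token list, Leaf v p 0)} else {})"
  have "val (Node v p q) A = sum f (trans (Node v p q))"
    unfolding f_def using less.prems by (intro val_rec) auto
  also have "trans (Node v p q) = T1 \<union> (T2 \<union> T3)"
    by (simp add: T1_def T2_def T3_def)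
  also have "sum f \<dots> = sum f T1 + (sum f T2 + sum f T3)"
  proof -
    have "finite T1" "finite T2" "finite T3" "T1 \<inter> (T2 \<union> T3) = {}" "T2 \<inter> T3 = {}"
      by (auto simp: T1_def T2_def T3_def split: option.splits)
    then show ?thesis
      by (simp add: sum.union_disjoint)
  qed
  also have "sum f T1 = (\<Sum>v'<v. lin v v' * V e v' (q - p)) * X"
  proof -
    have "sum f T1 = (\<Sum>v'<v. lin v v' * val (Node v' p q) A)"
      unfolding T1_def by (subst sum.reindex) (auto simp: inj_on_def f_def)
    also have "\<dots> = (\<Sum>v'<v. lin v v' * (V e v' (q - p) * X))"
      unfolding X_def using less.prems by (intro sum.cong arg_cong2[where f = "(*)"] less.IH refl) auto
    finally show ?thesis
      by (simp add: sum_distrib_right mult.assoc)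
  qed
  also have "sum f T2 = (case mul v of None \<Rightarrow> 0
      | Some (i, j) \<Rightarrow> \<Sum>t\<in>{0<..<q - p}. V e i t * V e j (q - p - t)) * X"
  proof (cases "mul v")
    case None
    then show ?thesis by (simp add: T2_def)
  next
    case (Some ij)
    obtain i j where ij: "mul v = Some (i, j)" using Some by (cases ij) auto
    have lt: "i < v" "j < v" using mul[OF less.prems(1) ij] by auto
    have push: "f ([Push t j q], Node i p t) = V e i (t - p) * V e j (q - t) * X" if t: "p < t" "t < q" for t
    proof -
      let ?A = "A - {Push t j q}"
      have "Push t j q \<in> A"
        using less.prems(4)[of "Push t j q"] less.prems t lt by simp
      then have "f ([Push t j q], Node i p t) = val (Node i p t) ?A"
        by (simp add: f_def)
      also have "\<dots> = V e i (t - p) * val (Pos t) (cut (2 * t) ?A)"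
        using less.prems t lt by (intro less.IH) (auto simp: less.prems(4))
      also have "val (Pos t) (cut (2 * t) ?A) = val (Node j t q) (cut (2 * t + 1) (cut (2 * t) ?A))"
      proof (rule val_Pos)
        fix x assume x: "level x \<le> 2 * t"
        have "level x < 2 * q" using x t by simp
        note xA = less.prems(4)[OF this]
        show "x \<in> cut (2 * t) ?A \<longleftrightarrow> x \<in> pushes t - {Push t j q}"
        proof (cases x)
          case (Push t' v' q')
          then show ?thesis
            using x xA t less.prems by (auto simp: cut_def)
        next
          case (Bit b i' p')
          \<comment> \<open>A bit has odd level, so a level of at most \<open>2 * t\<close> is
            strictly smaller.\<close>
          then have "\<not> 2 * t \<le> level x"
            using x by simp presburger
          then show ?thesis
            by (auto simp: cut_def dest: level_pushes)
        qed
      qed (use less.prems t lt in auto)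
      also have "cut (2 * t + 1) (cut (2 * t) ?A) = cut (2 * t + 1) A"
        by (auto simp: cut_def)
      also have "val (Node j t q) (cut (2 * t + 1) A) = V e j (q - t) * val (Pos q) (cut (2 * q) (cut (2 * t + 1) A))"
        using less.prems t lt by (intro less.IH) (auto simp: less.prems(4) cut_def)
      also have "cut (2 * q) (cut (2 * t + 1) A) = cut (2 * q) A"
        using t by (auto simp: cut_def)
      finally show ?thesis
        by (simp add: X_def mult.assoc)
    qed
    have "sum f T2 = (\<Sum>t\<in>{p<..<q}. f ([Push t j q], Node i p t))"
      unfolding T2_def ij by (simp add: sum.reindex inj_on_def)
    also have "\<dots> = (\<Sum>t\<in>{p<..<q}. V e i (t - p) * V e j (q - t) * X)"
      using push by (intro sum.cong) auto
    also have "\<dots> = (\<Sum>t\<in>{0<..<q - p}. V e i t * V e j (q - p - t) * X)"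
      by (intro sum.reindex_bij_witness[of _ "\<lambda>t. t + p" "\<lambda>t. t - p"]) auto
    finally show ?thesis
      by (simp add: ij sum_distrib_right)
  qed
  also have "sum f T3 = of_bool (q - p = 1 \<and> (\<forall>i. bit v = Some i \<longrightarrow> i \<in> e)) * leaf v * X"
  proof (cases "q = Suc p")
    case True
    have "val (Leaf v p 0) A = of_bool (\<forall>i'. 0 \<le> i' \<longrightarrow> bit v = Some i' \<longrightarrow> i' \<in> e) *
        (leaf v * val (Pos (Suc p)) (cut (2 * Suc p) A))"
    proof (rule val_Leaf)
      fix x assume x: "level x < 2 * Suc p"
      show "x \<in> A \<longleftrightarrow> (\<exists>i'. x = Bit (i' \<in> e) i' p \<and> 0 \<le> i' \<and> i' < r)"
        using less.prems(4)[of x] x True less.prems by (cases x) auto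
    qed (use less.prems True in auto)
    then show ?thesis
      using True by (simp add: T3_def f_def X_def mult.assoc)
  qed (use less.prems in \<open>auto simp: T3_def\<close>)
  finally show ?case
    using V[OF e less.prems(1), of "q - p"] less.prems by (simp add: X_def algebra_simps)
qed

text \<open>The token set is what is left once the bits below \<open>i\<close> have been fixed to
  \<open>e\<close>. The two transitions decide whether \<open>i\<close> belongs to the set of bits,
  which splits the subsets of \<open>{i..<r}\<close> into two halves.\<close>

lemma val_Start:
  assumes "i \<le> r" "e \<subseteq> {..<i}"
  shows "val (Start i) {x\<in>tokens. \<forall>b i' p. x = Bit b i' p \<longrightarrow> i' < i \<longrightarrow> b = (i' \<in> e)} =
    (\<Sum>E\<in>Pow {i..<r}. V (e \<union> E) root d)"
  using assms
proof (induction i arbitrary: e rule: inc_induct)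
  case base
  have tok: "{x\<in>tokens. \<forall>b i' p. x = Bit b i' p \<longrightarrow> i' < r \<longrightarrow> b = (i' \<in> e)} = full e"
  proof (rule Set.set_eqI)
    fix x show "x \<in> {x\<in>tokens. \<forall>b i' p. x = Bit b i' p \<longrightarrow> i' < r \<longrightarrow> b = (i' \<in> e)} \<longleftrightarrow> x \<in> full e"
      by (cases x) auto
  qed
  have "val (Start r) (full e) = val (Node root 0 d) (full e)"
    by (subst val_rec) auto
  also have "\<dots> = V e root (d - 0) * val (Pos d) (cut (2 * d) (full e))"
  proof (rule val_Node)
    fix x show "x \<in> full e \<longleftrightarrow> x \<in> full e \<and> 2 * 0 < level x"
      by (cases x) auto
  qed (use base d root in auto)
  also have "cut (2 * d) (full e) = {}"
  proof -
    have "\<not> 2 * d \<le> level x" if "x \<in> full e" for x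
      using that by (cases x) auto
    then show ?thesis by (auto simp: cut_def)
  qed
  finally show ?case
    unfolding tok by simp
next
  case (step i)
  define A where "A = (\<lambda>i e. {x\<in>tokens. \<forall>b i' p. x = Bit b i' p \<longrightarrow> i' < i \<longrightarrow> b = (i' \<in> e)})"
  define B where "B = (\<lambda>b. Bit b i ` {..<d})"
  have atLeastLessThan_eq: "insert i {Suc i..<r} = {i..<r}"
    using step.hyps by auto
  have B: "set (list_of_set (B b)) = B b" for b
    by (simp add: B_def list_of_set)
  have sub: "B b \<subseteq> A i e" for b
    using step.hyps by (auto simp: A_def B_def)
  have inj: "inj (\<lambda>b. (list_of_set (B b), Start (Suc i)))"
  proof (rule injI)
    fix b b' assume "(list_of_set (B b), Start (Suc i)) = (list_of_set (B b'), Start (Suc i))"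
    then have "B b = B b'" using B by (metis prod.inject)
    then show "b = b'" using d by (auto simp: B_def)
  qed
  \<comment> \<open>Consuming the copies for \<open>True\<close> leaves those for
    \<open>False\<close>, so the branch with \<open>b\<close> true sets bit \<open>i\<close> to
    0.\<close>
  have diff: "A i e - B b = A (Suc i) (if b then e else insert i e)" for b
  proof (rule Set.set_eqI)
    fix x show "x \<in> A i e - B b \<longleftrightarrow> x \<in> A (Suc i) (if b then e else insert i e)"
    proof (cases x)
      case (Bit b' i' p)
      then show ?thesis
        using step.prems by (cases "i' < i"; cases "i' = i") (auto simp: A_def B_def)
    qed (auto simp: A_def B_def)
  qed
  have tr: "trans (Start i) = range (\<lambda>b. (list_of_set (B b), Start (Suc i)))"
    using step.hyps by (simp add: B_def)
  have "val (Start i) (A i e) =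
      (\<Sum>y\<in>trans (Start i). of_bool (set (fst y) \<subseteq> A i e) * (weight (Start i) y * val (snd y) (A i e - set (fst y))))"
    using step.hyps by (intro val_rec) auto
  also have "\<dots> = (\<Sum>b\<in>UNIV. val (Start (Suc i)) (A (Suc i) (if b then e else insert i e)))"
    unfolding tr sum.reindex[OF inj] by (simp add: B sub diff comp_def del: trans.simps)
  also have "\<dots> = (\<Sum>E\<in>Pow {Suc i..<r}. V (e \<union> E) root d) + (\<Sum>E\<in>Pow {Suc i..<r}. V (insert i e \<union> E) root d)"
  proof -
    have "e \<subseteq> {..<Suc i}" "insert i e \<subseteq> {..<Suc i}" using step.prems by auto
    then show ?thesis
      using step.IH[of e] step.IH[of "insert i e"] by (simp add: UNIV_bool A_def add.commute)
  qed
  also have "(\<Sum>E\<in>Pow {Suc i..<r}. V (insert i e \<union> E) root d) = (\<Sum>E\<in>insert i ` Pow {Suc i..<r}. V (e \<union> E) root d)"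
  proof (subst sum.reindex)
    show "inj_on (insert i) (Pow {Suc i..<r})"
      by (auto simp: inj_on_def) (metis Suc_n_not_le_n atLeastLessThan_iff insert_iff subsetD)+
  qed simp
  also have "(\<Sum>E\<in>Pow {Suc i..<r}. V (e \<union> E) root d) + \<dots> =
      (\<Sum>E\<in>Pow {Suc i..<r} \<union> insert i ` Pow {Suc i..<r}. V (e \<union> E) root d)"
    by (rule sum.union_disjoint[symmetric]) auto
  also have "Pow {Suc i..<r} \<union> insert i ` Pow {Suc i..<r} = Pow {i..<r}"
    using atLeastLessThan_eq step.hyps by (simp flip: Pow_insert)
  finally show ?case
    by (simp add: A_def)
qed

lemma val_Start_0: "val (Start 0) tokens = (\<Sum>E\<in>Pow {..<r}. V E root d)"
  using val_Start[of 0 "{}"] by (simp add: lessThan_atLeast0)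

end

section \<open>Size of the traversal automaton\<close>

context parse_automaton
begin

text \<open>Crude powers suffice. As Q \<ge> 4, a factor of up to 4 costs one more exponent: there
  are at most 4 Q^3 cells, 3 Q^3 tokens and Q^2 transitions per cell, which gives at most 3 Q^10
  states with pending letters.\<close>

lemma card_bounds:
  defines "Q \<equiv> s + d + r + 2"
  shows "card tokens \<le> Q ^ 4" "card hop_states \<le> Q ^ 11" "rank (Start 0) \<le> Q ^ 11"
proof -
  have Q4: "4 \<le> Q"
    using d root by (simp add: Q_def)
  then have Q1: "1 \<le> Q" by simp
  let ?I = "{..<Q}"
  have card3: "card (f ` (?I \<times> ?I \<times> ?I)) \<le> Q ^ 3" for f :: "nat \<times> nat \<times> nat \<Rightarrow> 'b"
    using card_image_le[of "?I \<times> ?I \<times> ?I" f] by (simp add: card_cartesian_product power3_eq_cube)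
  have card1: "card (f ` ?I) \<le> Q" for f :: "nat \<Rightarrow> 'b"
    using card_image_le[of ?I f] by simp
  have pow: "4 * Q ^ k \<le> Q ^ Suc k" for k
    using Q4 by simp
  have "cells \<subseteq> ((\<lambda>(v, p, q). Node v p q) ` (?I \<times> ?I \<times> ?I) \<union> (\<lambda>(v, p, q). Leaf v p q) ` (?I \<times> ?I \<times> ?I)) \<union>
      (Start ` ?I \<union> Pos ` ?I)"
  proof
    fix x assume "x \<in> cells"
    then show "x \<in> ((\<lambda>(v, p, q). Node v p q) ` (?I \<times> ?I \<times> ?I) \<union> (\<lambda>(v, p, q). Leaf v p q) ` (?I \<times> ?I \<times> ?I)) \<union>
      (Start ` ?I \<union> Pos ` ?I)"
      by (cases x) (auto simp: Q_def image_iff)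
  qed
  then have "card cells \<le> (Q ^ 3 + Q ^ 3) + (Q + Q)"
    by (elim order_trans[OF card_mono[rotated]])
      (auto intro!: order_trans[OF card_Un_le] add_mono card3 card1)
  also have "\<dots> \<le> 4 * Q ^ 3"
    using self_le_power[OF Q1, of 3] by simp
  finally have cells: "card cells \<le> Q ^ 4"
    using pow[of 3] by simp
  have "tokens \<subseteq> (\<lambda>(v, p, q). Push v p q) ` (?I \<times> ?I \<times> ?I) \<union> ((\<lambda>(v, p, q). Bit True p q) ` (?I \<times> ?I \<times> ?I)
      \<union> (\<lambda>(v, p, q). Bit False p q) ` (?I \<times> ?I \<times> ?I))"
  proof
    fix x assume "x \<in> tokens"
    then show "x \<in> (\<lambda>(v, p, q). Push v p q) ` (?I \<times> ?I \<times> ?I) \<union> ((\<lambda>(v, p, q). Bit True p q) ` (?I \<times> ?I \<times> ?I)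
      \<union> (\<lambda>(v, p, q). Bit False p q) ` (?I \<times> ?I \<times> ?I))"
      by (cases x) (auto simp: Q_def image_iff)
  qed
  then have "card tokens \<le> Q ^ 3 + (Q ^ 3 + Q ^ 3)"
    by (elim order_trans[OF card_mono[rotated]])
      (auto intro!: order_trans[OF card_Un_le] add_mono card3)
  then show tokens: "card tokens \<le> Q ^ 4"
    using pow[of 3] by simp
  have trans: "card (trans a) \<le> Q ^ 2" if "a \<in> cells" for a
  proof (cases a)
    case (Start i)
    have "card (trans a) \<le> 2"
      using card_image_le[of UNIV "\<lambda>b. (list_of_set (Bit b i ` {..<d}), cell.Start (Suc i))"] by (simp add: Start)
    then show ?thesis
      using Q4 self_le_power[OF Q1, of 2] by simp
  next
    case (Node v p q)
    have "card (trans a) \<le> card ((\<lambda>v'. ([] :: token list, cell.Node v' p q)) ` {..<v}) +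
       (card (case mul v of None \<Rightarrow> {} | Some (i, j) \<Rightarrow> (\<lambda>t. ([Push t j q], cell.Node i p t)) ` {p<..<q}) +
       card (if q = Suc p then {([] :: token list, cell.Leaf v p 0)} else {}))"
      unfolding Node trans.simps by (intro order_trans[OF card_Un_le] add_mono order.refl)
    also have "\<dots> \<le> v + (q + 1)"
      by (intro add_mono)
        (auto intro!: order_trans[OF card_image_le] split: option.splits)
    also have "\<dots> \<le> Q + (Q + 1)"
      using that by (auto simp: Node Q_def)
    also have "\<dots> \<le> 4 * Q" using Q1 by simp
    also have "\<dots> \<le> Q ^ 2" using Q4 by (simp add: power2_eq_square)
    finally show ?thesis .
  next
    case (Leaf v p i)
    have "card (trans a) \<le> 2"
      using card_image_le[of UNIV "\<lambda>b. ([Bit b i p], cell.Leaf v p (Suc i))"] by (simp add: Leaf)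
    then show ?thesis
      using Q4 self_le_power[OF Q1, of 2] by simp
  next
    case (Pos t)
    have "card (trans a) \<le> s * (d - t)"
      using card_image_le[of "{..<s} \<times> {t<..d}" "\<lambda>(v, q). (list_of_set (pushes t - {Push t v q}), cell.Node v t q)"]
      by (simp add: Pos)
    also have "\<dots> \<le> Q * Q"
      by (intro mult_le_mono) (auto simp: Q_def)
    finally show ?thesis by (simp add: power2_eq_square)
  qed
  have "card hop_states \<le> card cells + card cells * (Q ^ 2 * (card tokens + 1))"
    using trans by (rule card_hop_states_le)
  also have "\<dots> \<le> Q ^ 4 + Q ^ 4 * (Q ^ 2 * (Q ^ 4 + Q ^ 4))"
    using cells tokens Q1 by (intro add_mono mult_le_mono) auto
  also have "\<dots> = Q ^ 4 + (Q ^ 10 + Q ^ 10)"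
    by (simp add: distrib_left flip: power_add)
  also have "\<dots> \<le> Q ^ 10 + (Q ^ 10 + Q ^ 10)"
    using Q1 by (intro add_mono power_increasing) auto
  also have "\<dots> \<le> Q ^ 11"
    using pow[of 10] by simp
  finally show "card hop_states \<le> Q ^ 11" .
  have "rank (Start 0) \<le> Q * (2 * Q) + Q"
    unfolding rank.simps by (intro add_mono mult_le_mono) (auto simp: Q_def)
  also have "\<dots> \<le> 4 * Q ^ 2"
    using self_le_power[OF Q1, of 2] by (simp add: power2_eq_square)
  also have "\<dots> \<le> Q ^ 3"
    using pow[of 2] by (simp add: numeral_3_eq_3)
  also have "\<dots> \<le> Q ^ 11"
    using Q1 by (intro power_increasing) auto
  finally show "rank (Start 0) \<le> Q ^ 11" .
qed

end

text \<open>A single oracle call, whose value is K! / N! times the sum; this factor is undone by a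
  constant. The exponents come from N \<le> R^4 + R^11 \<le> Q^12 and from the N^4 arguments of the
  call, each a single gate.\<close>

lemma computable_over_parse_sum:
  fixes lin :: "nat \<Rightarrow> nat \<Rightarrow> ('v, 'f::field_char_0) ncpoly"
  assumes "parse_automaton s d r v0 lin mul bt leaf V"
    and lin: "\<And>v v'. lin v v' \<in> range nc_const \<union> range nc_var"
    and leaf: "\<And>v. leaf v \<in> range nc_const \<union> range nc_var"
    and Q: "s + d + r + 2 \<le> Q"
  shows "computable_over (\<Union>j\<in>{1..Q ^ 12}. sdet_family (\<lambda>n. n) j) {} (Q ^ 49)
    (\<Sum>E\<in>Pow {..<r}. V E v0 d)"
proof -
  interpret parse_automaton s d r v0 lin mul bt leaf V
    by fact
  define Wt :: "('v, 'f) ncpoly set" where "Wt = range nc_const \<union> range nc_var"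
  \<comment> \<open>\<open>R\<close> is the size parameter of this automaton. \<open>Q\<close> is
    only an upper bound, so that one bound can serve all degrees.\<close>
  define R K where "R = s + d + r + 2" and "K = R ^ 11"
  define N where "N = card tokens + K"
  have "2 \<le> R" "R \<le> Q" using Q by (auto simp: R_def)
  then have "1 \<le> R" "2 \<le> Q" by auto
  have "0 \<in> Wt" "1 \<in> Wt"
    using nc_const_0 nc_const_1 unfolding Wt_def by (metis UnI1 rangeI)+
  moreover have "weight a y \<in> Wt" for a y
  proof (cases a)
    case (Node v p q)
    then show ?thesis
      using \<open>1 \<in> Wt\<close> lin by (auto simp: Wt_def split: prod.splits list.splits cell.splits)
  next
    case (Leaf v p i)
    then show ?thesis
      using \<open>0 \<in> Wt\<close> \<open>1 \<in> Wt\<close> leaf by (auto simp: Wt_def of_bool_def)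
  qed (use \<open>1 \<in> Wt\<close> in auto)
  moreover have "rank (Start 0) \<le> K" "card hop_states \<le> card tokens + K"
    using card_bounds by (auto simp: R_def K_def)
  ultimately obtain D k l where D: "k < N" "l < N" "\<And>i a b. D i a b \<in> Wt"
    "walk_sum {..<N} l D {..<N} k = of_nat (fact K) * val (Start 0) tokens"
    unfolding N_def by (elim walk_sum_encoding[of "Start 0" K Wt, rotated]) auto
  define h :: "(nat \<times> nat \<times> nat \<times> nat, 'f) ncpoly"
    where "h = sdet (mat_algebra N) N (generic_matrix N N) $$ (k, l)"
  define S where "S = (\<lambda>(i, j, a, b). if i = j then D i a b else 0)"
  have "R ^ 4 \<le> R ^ 11" "2 * R ^ 11 \<le> R ^ 12"
    using \<open>2 \<le> R\<close> by (auto intro!: power_increasing simp: power_Suc[of R 11, simplified])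
  then have "N \<le> R ^ 12"
    using card_bounds(1) unfolding N_def K_def R_def[symmetric] by linarith
  also have "\<dots> \<le> Q ^ 12"
    using \<open>R \<le> Q\<close> by (rule power_mono) simp
  finally have N: "N \<le> Q ^ 12" .
  have subst: "nc_subst S h = nc_const (1 / fact N) * (of_nat (fact K) * val (Start 0) tokens)"
    unfolding h_def S_def nc_subst_sdet_diagonal[OF D(1,2)] D(4)[symmetric] walk_sum_def ..
  have fact_K: "nc_const (fact K) = (of_nat (fact K) :: ('v, 'f) ncpoly)"
    by (metis nc_const_of_nat of_nat_fact)
  have "nc_const (fact N / fact K) * nc_subst S h =
      nc_const (fact N / fact K) * nc_const (1 / fact N) * nc_const (fact K) * val (Start 0) tokens"
    unfolding subst by (simp only: fact_K mult.assoc)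
  also have "nc_const (fact N / fact K) * nc_const (1 / fact N) * nc_const (fact K) = (1 :: ('v, 'f) ncpoly)"
    by (simp flip: nc_const_mult)
  finally have val: "val (Start 0) tokens = nc_const (fact N / fact K) * nc_subst S h"
    by simp
  let ?X = "{..<N} \<times> {..<N} \<times> {..<N} \<times> {..<N}"
  let ?H = "\<Union>j\<in>{1..Q ^ 12}. sdet_family (\<lambda>n. n) j :: (nat \<times> nat \<times> nat \<times> nat, 'f) ncpoly set"
  have vars_h: "nc_vars h \<subseteq> ?X"
    unfolding h_def using D(1,2) by (rule nc_vars_sdet_generic_matrix)
  have "h \<in> sdet_family (\<lambda>n. n) N"
    using D(1,2) by (auto simp: sdet_family_def h_def)
  then have "h \<in> ?H"
    using N D(1) by (intro UN_I[of N]) auto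
  moreover have "computable_over ?H {} 1 (S x)" for x
  proof -
    have "S x \<in> Wt"
      using D(3) \<open>0 \<in> Wt\<close> by (auto simp: S_def split: prod.splits)
    then show ?thesis
      by (auto simp: Wt_def computable_over_var computable_over_const simp del: One_nat_def)
  qed
  ultimately have "computable_over ?H {} (card ?X * 1 + 1) (nc_subst S h)"
    using vars_h by (intro computable_over_oracle) (simp_all only: finite_SigmaI finite_lessThan)
  then have "computable_over ?H {} (1 + (card ?X * 1 + 1) + 1) (val (Start 0) tokens)"
    unfolding val by (intro computable_over_times computable_over_const)
  moreover have "1 + (card ?X * 1 + 1) + 1 = N ^ 4 + 3"
    by (simp add: card_cartesian_product power4_eq_xxxx mult.assoc)
  ultimately have "computable_over ?H {} (N ^ 4 + 3) (\<Sum>E\<in>Pow {..<r}. V E v0 d)"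
    by (simp only: val_Start_0)
  moreover have "N ^ 4 + 3 \<le> Q ^ 49"
  proof -
    have "N ^ 4 \<le> (Q ^ 12) ^ 4"
      using N by (rule power_mono) simp
    then have "N ^ 4 \<le> Q ^ 48" by (simp flip: power_mult)
    moreover have "2 ^ 48 \<le> Q ^ 48"
      using \<open>2 \<le> Q\<close> by (rule power_mono) simp
    ultimately have "N ^ 4 + 3 \<le> 2 * Q ^ 48" by simp
    also have "\<dots> \<le> Q * Q ^ 48" using \<open>2 \<le> Q\<close> by simp
    also have "\<dots> = Q ^ 49" by (simp flip: power_Suc)
    finally show ?thesis .
  qed
  ultimately show ?thesis
    by (rule computable_over_mono)
qed

section \<open>Hardness for VNP\<close>

text \<open>Functions in \<open>PiE\<close> are \<open>undefined\<close> outside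
  \<open>{..<r}\<close>, whereas indicator functions are 0 there; hence the hypothesis that
  \<open>F\<close> depends on the values below \<open>r\<close> only.\<close>

lemma sum_PiE_01:
  fixes F :: "(nat \<Rightarrow> 'f::zero_neq_one) \<Rightarrow> 'a::comm_monoid_add"
  assumes "\<And>e e'. (\<And>i. i < r \<Longrightarrow> e i = e' i) \<Longrightarrow> F e = F e'"
  shows "(\<Sum>e\<in>{..<r} \<rightarrow>\<^sub>E {0, 1}. F e) = (\<Sum>E\<in>Pow {..<r}. F (\<lambda>i. of_bool (i \<in> E)))"
proof (rule sum.reindex_bij_witness[of _ "\<lambda>E. \<lambda>i\<in>{..<r}. of_bool (i \<in> E)" "\<lambda>e. {i. i < r \<and> e i = 1}"])
  fix e :: "nat \<Rightarrow> 'f" assume e: "e \<in> {..<r} \<rightarrow>\<^sub>E {0, 1}"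
  then show "(\<lambda>i\<in>{..<r}. of_bool (i \<in> {i. i < r \<and> e i = 1})) = e"
    by (intro ext) (auto simp: PiE_def extensional_def Pi_def)
  show "F (\<lambda>i. of_bool (i \<in> {i. i < r \<and> e i = 1})) = F e"
    using e by (intro assms) (auto simp: PiE_def Pi_def)
qed auto

text \<open>The parts of degree 0 of the factors of a product are constants, so they contribute to
  \<^term>\<open>lin\<close>.\<close>

lemma parse_automaton_circuit:
  fixes C :: "('v + nat, 'u, 'f::field_char_0) circuit"
  assumes wf: "wf_circuit C" and no_oracles: "circuit_oracles C = {}" and d: "0 < d"
  defines "vals \<equiv> circuit_values C"
  defines "hval \<equiv> \<lambda>E v k. nc_subst_hom (case_sum nc_var (\<lambda>i. nc_const (of_bool (i \<in> E)))) k (vals ! v)"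
  obtains lin mul bt leaf where
    "parse_automaton (length C) d r (length C - 1) lin mul bt leaf hval"
    "\<And>v v'. lin v v' \<in> range nc_const \<union> range nc_var"
    "\<And>v. leaf v \<in> range nc_const \<union> range nc_var"
proof -
  define c where "c i = Poly_Mapping.lookup (vals ! i) 0" for i
  \<comment> \<open>The two conditionals are added rather than nested, so that a gate whose
    arguments coincide counts them twice.\<close>
  define lin :: "nat \<Rightarrow> nat \<Rightarrow> ('v, 'f) ncpoly" where "lin v v' = nc_const (case C ! v of
      Add i j \<Rightarrow> (if v' = i then 1 else 0) + (if v' = j then 1 else 0)
    | Mult i j \<Rightarrow> (if v' = j then c i else 0) + (if v' = i then c j else 0)
    | _ \<Rightarrow> 0)" for v v'
  define mul where "mul v = (case C ! v of Mult i j \<Rightarrow> Some (i, j) | _ \<Rightarrow> None)" for v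
  define bt where "bt v = (case C ! v of Input (Inr i) \<Rightarrow> if i < r then Some i else None | _ \<Rightarrow> None)" for v
  \<comment> \<open>A bit variable with index at least \<open>r\<close> has value 0 for every
    \<open>e \<subseteq> {..<r}\<close>; its leaf gets weight 0 instead of a condition on a
    bit.\<close>
  define leaf :: "nat \<Rightarrow> ('v, 'f) ncpoly" where "leaf v = (case C ! v of
      Input (Inl x) \<Rightarrow> nc_var x | Input (Inr i) \<Rightarrow> nc_const (of_bool (i < r)) | _ \<Rightarrow> nc_const 0)" for v
  have args: "gate_args (C ! v) \<subseteq> {..<v}" if "v < length C" for v
    using wf that by (simp add: wf_circuit_def)
  have vals: "vals ! v = gate_value (take v vals) (C ! v)" if "v < length C" for v
    unfolding vals_def using that by (rule circuit_values_nth)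
  have hval0: "hval E i 0 = nc_const (c i)" for E i
    by (simp add: hval_def c_def nc_subst_hom_0)
  have sum_if: "(\<Sum>v'<v. nc_const (if v' = i then a else 0) * f v') = nc_const a * f i" if "i < v"
    for v i :: nat and a :: 'f and f :: "nat \<Rightarrow> ('v, 'f) ncpoly"
  proof -
    have "(\<Sum>v'<v. nc_const (if v' = i then a else 0) * f v') = (\<Sum>v'<v. if v' = i then nc_const a * f i else 0)"
      by (rule sum.cong) auto
    then show ?thesis using that by simp
  qed
  have "parse_automaton (length C) d r (length C - 1) lin mul bt leaf hval"
  proof
    show "0 < d" by fact
    show "length C - 1 < length C" using wf by (auto simp: wf_circuit_def)
    show "i < v \<and> j < v" if "v < length C" "mul v = Some (i, j)" for v i j
      using args[OF that(1)] that(2) by (auto simp: mul_def split: gate.splits)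
    show "i < r" if "bt v = Some i" for v i
      using that by (auto simp: bt_def split: gate.splits sum.splits if_splits)
    show "hval e v k = (\<Sum>v'<v. lin v v' * hval e v' k) +
        (case mul v of None \<Rightarrow> 0 | Some (i, j) \<Rightarrow> \<Sum>t\<in>{0<..<k}. hval e i t * hval e j (k - t)) +
        of_bool (k = 1 \<and> (\<forall>i. bt v = Some i \<longrightarrow> i \<in> e)) * leaf v"
      if e: "e \<subseteq> {..<r}" and v: "v < length C" and k: "0 < k" for e v k
    proof (cases "C ! v")
      case (Input x)
      show ?thesis
      proof (cases x)
        case (Inl x')
        then show ?thesis
          using Input v by (simp add: hval_def vals nc_subst_hom_var lin_def mul_def bt_def leaf_def)
      next
        case (Inr i)
        then show ?thesis
          using Input v e by (auto simp: hval_def vals nc_subst_hom_var lin_def mul_def bt_def leaf_def)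
      qed
    next
      case (Const a)
      then show ?thesis
        using v k by (simp add: hval_def vals nc_subst_hom_const lin_def mul_def bt_def leaf_def)
    next
      case (Add i j)
      then have lt: "i < v" "j < v" using args[OF v] by auto
      then have "hval e v k = hval e i k + hval e j k"
        using vals[OF v] by (simp add: hval_def Add nc_subst_hom_add)
      then show ?thesis
        using lt by (simp add: Add lin_def mul_def leaf_def nc_const_add distrib_right sum.distrib sum_if)
    next
      case (Mult i j)
      then have lt: "i < v" "j < v" using args[OF v] by auto
      have "{..k} = insert 0 (insert k {0<..<k})" using k by auto
      then have "(\<Sum>t\<le>k. hval e i t * hval e j (k - t)) =
          hval e i 0 * hval e j k + (hval e i k * hval e j 0 + (\<Sum>t\<in>{0<..<k}. hval e i t * hval e j (k - t)))"
        using k by simp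
      moreover have "hval e v k = (\<Sum>t\<le>k. hval e i t * hval e j (k - t))"
        using vals[OF v] lt by (simp add: hval_def Mult nc_subst_hom_times)
      \<comment> \<open>The weights \<open>lin\<close> multiply from the left, so a constant right
        factor is moved across.\<close>
      moreover have "hval e i k * hval e j 0 = nc_const (c j) * hval e i k"
        unfolding hval0 by (rule nc_const_commute[symmetric])
      ultimately show ?thesis
        using lt by (simp add: Mult lin_def mul_def leaf_def nc_const_add distrib_right sum.distrib sum_if hval0 add.assoc)
    next
      case (Oracle h a)
      then have "h \<in> circuit_oracles C"
        using v by (force simp: circuit_oracles_def in_set_conv_nth)
      then show ?thesis using no_oracles by simp
    qed
  qed
  moreover have "lin v v' \<in> range nc_const \<union> range nc_var" for v v'
    by (simp add: lin_def)
  moreover have "leaf v \<in> range nc_const \<union> range nc_var" for v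
    by (auto simp: leaf_def simp del: nc_const_0 split: gate.splits sum.splits)
  ultimately show ?thesis
    by (rule that)
qed

text \<open>The automaton reads words of one fixed positive length, so the polynomial is split into
  its homogeneous components. The exponent 51 covers d + 1 computations of size at most Q^49 and
  their sum.\<close>

lemma computable_over_exponential_sum:
  fixes g :: "('v + nat, 'f::field_char_0) ncpoly" and C :: "('v + nat, 'u, 'f) circuit"
  assumes C: "computes C g" "circuit_oracles C = {}" "length C \<le> s"
    and deg: "nc_degree g \<le> d" and vars: "nc_vars g \<subseteq> range Inl \<union> Inr ` {..<r}"
  defines "Q \<equiv> s + d + r + 2"
  shows "computable_over (\<Union>j\<in>{1..Q ^ 12}. sdet_family (\<lambda>n. n) j) {} (Q ^ 51)
    (\<Sum>e\<in>{..<r} \<rightarrow>\<^sub>E {0, 1}. nc_subst (case_sum nc_var (\<lambda>i. nc_const (e i))) g)"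
    (is "computable_over ?H {} _ ?f")
proof -
  define hval where "hval E v k = nc_subst_hom (case_sum nc_var (\<lambda>i. nc_const (of_bool (i \<in> E)))) k
    (circuit_values C ! v)" for E v k
  define v0 where "v0 = length C - 1"
  have wf: "wf_circuit C" and "C \<noteq> []"
    using C(1) by (auto simp: computes_def wf_circuit_def)
  then have "circuit_values C \<noteq> []"
    using length_circuit_values by (metis length_0_conv)
  then have g: "circuit_values C ! v0 = g"
    using C(1) by (simp add: computes_def v0_def last_conv_nth)
  have "?f = (\<Sum>E\<in>Pow {..<r}. nc_subst (case_sum nc_var (\<lambda>i. nc_const (of_bool (i \<in> E)))) g)"
    using vars by (intro sum_PiE_01 nc_subst_cong) (auto split: sum.splits)
  also have "\<dots> = (\<Sum>E\<in>Pow {..<r}. \<Sum>k\<le>d. hval E v0 k)"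
    unfolding hval_def g nc_subst_eq_sum_hom[OF deg] ..
  also have "\<dots> = (\<Sum>k\<le>d. \<Sum>E\<in>Pow {..<r}. hval E v0 k)"
    by (rule sum.swap)
  finally have f: "?f = (\<Sum>k\<le>d. \<Sum>E\<in>Pow {..<r}. hval E v0 k)" .
  have Q: "2 \<le> Q" by (simp add: Q_def)
  have "computable_over ?H {} (Q ^ 49) (\<Sum>E\<in>Pow {..<r}. hval E v0 k)" if k: "k \<in> {..d}" for k
  proof (cases "k = 0")
    case True
    \<comment> \<open>The component of degree 0 is the same constant for all bits, so its
      exponentially long sum is a single constant gate.\<close>
    have "(\<Sum>E\<in>Pow {..<r}. hval E v0 k) = nc_const (\<Sum>E\<in>Pow {..<r}. Poly_Mapping.lookup g 0)"
      unfolding True hval_def g nc_subst_hom_0 nc_const_sum ..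
    then have "computable_over ?H {} 1 (\<Sum>E\<in>Pow {..<r}. hval E v0 k)"
      by (simp only: computable_over_const)
    then show ?thesis
      by (rule computable_over_mono) (use Q in simp)
  next
    case False
    then have "0 < k" by simp
    from parse_automaton_circuit[OF wf C(2) this, of r]
    obtain lin mul bt leaf where
      "parse_automaton (length C) k r v0 lin mul bt leaf hval"
      "\<And>v v'. lin v v' \<in> range nc_const \<union> range nc_var"
      "\<And>v. leaf v \<in> range nc_const \<union> range nc_var"
      unfolding v0_def hval_def by blast
    then show ?thesis
      using k C(3) by (intro computable_over_parse_sum) (auto simp: Q_def)
  qed
  then have "computable_over ?H {} (card {..d} * (Q ^ 49 + 1) + 1) ?f"
    unfolding f by (intro computable_over_sum) auto
  then show ?thesis
  proof (rule computable_over_mono)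
    have "card {..d} * (Q ^ 49 + 1) + 1 \<le> (d + 2) * (Q ^ 49 + 1)" by simp
    also have "\<dots> \<le> Q * (2 * Q ^ 49)"
      using Q by (intro mult_le_mono) (auto simp: Q_def)
    also have "\<dots> \<le> Q * (Q * Q ^ 49)"
      using Q by (intro mult_le_mono) auto
    also have "\<dots> = Q ^ 51" by (simp flip: power_Suc)
    finally show "card {..d} * (Q ^ 49 + 1) + 1 \<le> Q ^ 51" .
  qed
qed

lemma VNP_c_reduces_sdet_family:
  fixes f :: "nat \<Rightarrow> ('v, 'f::field_char_0) ncpoly"
  assumes "f \<in> VNP"
  shows "c_reduces f (sdet_family (\<lambda>n. n))"
proof -
  obtain g :: "nat \<Rightarrow> ('v + nat, 'f) ncpoly" and r where g: "g \<in> VP" and r: "poly_bounded r"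
    and f: "\<And>n. n \<ge> 1 \<Longrightarrow> nc_vars (g n) \<subseteq> range Inl \<union> Inr ` {..<r n} \<and>
      f n = (\<Sum>e\<in>{..<r n} \<rightarrow>\<^sub>E {0, 1}. nc_subst (case_sum nc_var (\<lambda>i. nc_const (e i))) (g n))"
    using assms unfolding VNP_def by blast
  obtain s where d: "poly_bounded (\<lambda>n. nc_degree (g n))" and s: "poly_bounded s"
    and C: "\<And>n. n \<ge> 1 \<Longrightarrow> \<exists>C :: ('v + nat, 'v + nat, 'f) circuit.
      circuit_oracles C = {} \<and> length C \<le> s n \<and> computes C (g n)"
    using g unfolding VP_def by blast
  define Q where "Q n = s n + nc_degree (g n) + r n + 2" for n
  have Q: "poly_bounded Q"
    unfolding Q_def using s d r by (intro poly_bounded_add poly_bounded_const)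
  show ?thesis
    unfolding c_reduces_def
  proof (rule exI[of _ "\<lambda>n. Q n ^ 51 + 2"], rule exI[of _ "\<lambda>n. Q n ^ 12"], intro conjI allI impI)
    show "poly_bounded (\<lambda>n. Q n ^ 51 + 2)"
      using Q by (intro poly_bounded_add poly_bounded_power poly_bounded_const)
    show "poly_bounded (\<lambda>n. Q n ^ 12)"
      using Q by (rule poly_bounded_power)
    fix n :: nat assume n: "1 \<le> n"
    obtain C :: "('v + nat, 'v + nat, 'f) circuit" where
      "circuit_oracles C = {}" "length C \<le> s n" "computes C (g n)"
      using C[OF n] by blast
    then have "computable_over (\<Union>j\<in>{1..Q n ^ 12}. sdet_family (\<lambda>n. n) j) {} (Q n ^ 51)
        (\<Sum>e\<in>{..<r n} \<rightarrow>\<^sub>E {0, 1}. nc_subst (case_sum nc_var (\<lambda>i. nc_const (e i))) (g n))"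
      using f[OF n] unfolding Q_def by (intro computable_over_exponential_sum[of C]) auto
    then have "computable_over (\<Union>j\<in>{1..Q n ^ 12}. sdet_family (\<lambda>n. n) j) {} (Q n ^ 51) (f n)"
      using f[OF n] by simp
    then show "\<exists>C :: ('v, nat \<times> nat \<times> nat \<times> nat, 'f) circuit.
        circuit_oracles C \<subseteq> (\<Union>j\<in>{1..Q n ^ 12}. sdet_family (\<lambda>n. n) j) \<and> length C \<le> Q n ^ 51 + 2 \<and> computes C (f n)"
      by (elim computable_over_computes) blast
  qed
qed

section \<open>The sign of a permutation as a product over pairs\<close>

definition ordered_pairs :: "nat \<Rightarrow> (nat \<times> nat) set" where
  "ordered_pairs n = {(i, j). i < j \<and> j < n}"

text \<open>For a permutation this is the sign, by counting inversions. Because of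
  \<open>sgn\<close> it vanishes on functions that are not injective on \<open>{..<n}\<close>, so in
  the verifier it tests injectivity and yields the sign at the same time.\<close>

definition pair_sign :: "nat \<Rightarrow> (nat \<Rightarrow> nat) \<Rightarrow> int" where
  "pair_sign n \<sigma> = (\<Prod>(i, j)\<in>ordered_pairs n. sgn (int (\<sigma> j) - int (\<sigma> i)))"

lemma finite_ordered_pairs [simp]: "finite (ordered_pairs n)"
  by (rule finite_subset[of _ "{..<n} \<times> {..<n}"]) (auto simp: ordered_pairs_def)

lemma pair_sign_eq_0_iff: "pair_sign n \<sigma> = 0 \<longleftrightarrow> \<not> inj_on \<sigma> {..<n}"
proof -
  have "pair_sign n \<sigma> = 0 \<longleftrightarrow> (\<exists>i j. i < j \<and> j < n \<and> \<sigma> i = \<sigma> j)"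
    unfolding pair_sign_def prod_zero_iff[OF finite_ordered_pairs]
    by (auto simp: ordered_pairs_def sgn_eq_0_iff) metis+
  also have "\<dots> \<longleftrightarrow> \<not> inj_on \<sigma> {..<n}"
  proof
    assume "\<exists>i j. i < j \<and> j < n \<and> \<sigma> i = \<sigma> j"
    then show "\<not> inj_on \<sigma> {..<n}"
      by (metis inj_onD lessThan_iff less_irrefl less_trans)
  next
    assume "\<not> inj_on \<sigma> {..<n}"
    then obtain i j where "i < n" "j < n" "i \<noteq> j" "\<sigma> i = \<sigma> j"
      by (auto simp: inj_on_def)
    then show "\<exists>i j. i < j \<and> j < n \<and> \<sigma> i = \<sigma> j"
      by (metis linorder_neqE_nat)
  qed
  finally show ?thesis .
qed

text \<open>The map \<open>h\<close> sends a pair to its sorted image under \<tau> and permutes the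
  ordered pairs. If \<tau> reverses a pair, sorting flips the factor of \<sigma>, and the factor -1
  of \<tau> compensates for this.\<close>

lemma pair_sign_comp:
  assumes "\<tau> permutes {..<n}"
  shows "pair_sign n (\<sigma> \<circ> \<tau>) = pair_sign n \<sigma> * pair_sign n \<tau>"
proof -
  define h where "h = (\<lambda>(i, j). (min (\<tau> i) (\<tau> j), max (\<tau> i) (\<tau> j)))"
  have inj: "inj \<tau>" using assms by (rule permutes_inj)
  have lt: "\<tau> i < n" if "i < n" for i
    using permutes_in_image[OF assms, of i] that by simp
  have "h ` ordered_pairs n \<subseteq> ordered_pairs n"
  proof
    fix x assume "x \<in> h ` ordered_pairs n"
    then obtain i j where ij: "x = h (i, j)" "i < j" "j < n" by (auto simp: ordered_pairs_def)
    then have "\<tau> i \<noteq> \<tau> j" using inj_eq[OF inj] by simp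
    then show "x \<in> ordered_pairs n"
      using ij lt[of i] lt[of j] by (auto simp: h_def ordered_pairs_def)
  qed
  moreover have inj_h: "inj_on h (ordered_pairs n)"
  proof (rule inj_onI)
    fix x y assume "x \<in> ordered_pairs n" "y \<in> ordered_pairs n" "h x = h y"
    then obtain i j i' j' where xy: "x = (i, j)" "i < j" "y = (i', j')" "i' < j'"
      "min (\<tau> i) (\<tau> j) = min (\<tau> i') (\<tau> j')" "max (\<tau> i) (\<tau> j) = max (\<tau> i') (\<tau> j')"
      by (auto simp: ordered_pairs_def h_def)
    then have "\<tau> i = \<tau> i' \<and> \<tau> j = \<tau> j' \<or> \<tau> i = \<tau> j' \<and> \<tau> j = \<tau> i'"
      by linarith
    then have "i = i' \<and> j = j' \<or> i = j' \<and> j = i'"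
      using inj_eq[OF inj] by simp
    then show "x = y" using xy by (elim disjE) simp_all
  qed
  ultimately have "bij_betw h (ordered_pairs n) (ordered_pairs n)"
    by (simp add: bij_betw_def endo_inj_surj)
  then have "pair_sign n \<sigma> = (\<Prod>x\<in>ordered_pairs n. case h x of (i, j) \<Rightarrow> sgn (int (\<sigma> j) - int (\<sigma> i)))"
    unfolding pair_sign_def by (rule prod.reindex_bij_betw[symmetric])
  then have "pair_sign n \<sigma> * pair_sign n \<tau> = (\<Prod>x\<in>ordered_pairs n.
      (case h x of (i, j) \<Rightarrow> sgn (int (\<sigma> j) - int (\<sigma> i))) * (case x of (i, j) \<Rightarrow> sgn (int (\<tau> j) - int (\<tau> i))))"
    unfolding pair_sign_def[of n \<tau>] by (simp only: prod.distrib)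
  also have "\<dots> = pair_sign n (\<sigma> \<circ> \<tau>)"
    unfolding pair_sign_def
  proof (rule prod.cong[OF refl])
    fix x assume "x \<in> ordered_pairs n"
    then obtain i j where x: "x = (i, j)" "i < j" by (auto simp: ordered_pairs_def)
    then have "\<tau> i \<noteq> \<tau> j" using inj_eq[OF inj] by simp
    moreover have "sgn (int (\<sigma> (\<tau> i)) - int (\<sigma> (\<tau> j))) = - sgn (int (\<sigma> (\<tau> j)) - int (\<sigma> (\<tau> i)))"
      by (simp add: sgn_if)
    ultimately show "(case h x of (i, j) \<Rightarrow> sgn (int (\<sigma> j) - int (\<sigma> i))) * (case x of (i, j) \<Rightarrow> sgn (int (\<tau> j) - int (\<tau> i))) =
        (case x of (i, j) \<Rightarrow> sgn (int ((\<sigma> \<circ> \<tau>) j) - int ((\<sigma> \<circ> \<tau>) i)))"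
      by (cases "\<tau> i < \<tau> j") (simp_all add: x h_def min_def max_def)
  qed
  finally show ?thesis ..
qed

text \<open>By conjugation with \<rho> the transposition is moved to 0 and 1, whose only inversion
  is the pair (0, 1). The value at \<rho> is nonzero and cancels.\<close>

lemma pair_sign_transpose:
  assumes "a < n" "b < n" "a \<noteq> b"
  shows "pair_sign n (transpose a b) = - 1"
proof -
  have n: "1 < n" using assms by linarith
  \<comment> \<open>\<open>c\<close> is the image of 1 under the transposition of 0 and
    \<open>a\<close>. Exchanging \<open>c\<close> and \<open>b\<close> afterwards gives \<rho> 0 = a
    and \<rho> 1 = b.\<close>
  define c where "c = transpose 0 a 1"
  define \<rho> where "\<rho> = transpose c b \<circ> transpose 0 a"
  have c: "c < n" "c \<noteq> a" using assms n by (auto simp: c_def transpose_def)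
  have perm: "transpose i j permutes {..<n}" if "i < n" "j < n" for i j
    using that by (intro permutes_swap_id) auto
  have \<rho>: "\<rho> permutes {..<n}"
    unfolding \<rho>_def using assms c n by (intro permutes_compose perm) auto
  have "bij \<rho>" using \<rho> by (rule permutes_bij)
  have "\<rho> 0 = a" "\<rho> 1 = b"
    using assms c by (auto simp: \<rho>_def c_def transpose_def split: if_splits)
  then have "inv_into UNIV \<rho> a = 0" "inv_into UNIV \<rho> b = 1"
    using inv_into_f_f[OF bij_is_inj[OF \<open>bij \<rho>\<close>]] by auto
  then have "transpose a b \<circ> \<rho> = \<rho> \<circ> transpose 0 1"
    using transpose_comp_eq[OF \<open>bij \<rho>\<close>, of a b] by simp
  then have "pair_sign n (transpose a b) * pair_sign n \<rho> = pair_sign n \<rho> * pair_sign n (transpose 0 1)"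
    using pair_sign_comp[OF \<rho>, of "transpose a b"] pair_sign_comp[OF perm, of 0 1 \<rho>] n by simp
  moreover have "pair_sign n \<rho> \<noteq> 0"
    using permutes_inj_on[OF \<rho>] by (simp add: pair_sign_eq_0_iff)
  ultimately have "pair_sign n (transpose a b) = pair_sign n (transpose 0 1)"
    by simp
  also have "\<dots> = - 1"
  proof -
    have "(0, 1) \<in> ordered_pairs n" using n by (simp add: ordered_pairs_def)
    moreover have "(\<Prod>(i, j)\<in>ordered_pairs n - {(0, 1)}. sgn (int (transpose 0 1 j) - int (transpose 0 1 i))) = 1"
      by (intro prod.neutral) (auto simp: ordered_pairs_def transpose_def sgn_if split: if_splits)
    ultimately show ?thesis
      unfolding pair_sign_def by (subst prod.remove[of _ "(0, 1)"]) (auto simp: transpose_def)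
  qed
  finally show ?thesis .
qed

lemma sign_eq_pair_sign:
  assumes "\<sigma> permutes {..<n}"
  shows "sign \<sigma> = pair_sign n \<sigma>"
  using assms finite_lessThan
proof (induction rule: permutes_induct)
  case id
  have "pair_sign n id = 1"
    unfolding pair_sign_def by (intro prod.neutral) (auto simp: ordered_pairs_def)
  then show ?case by (simp add: id_def)
next
  case (swap a b p)
  have "sign (transpose a b \<circ> p) = sign (transpose a b) * sign p"
    by (rule sign_compose[OF permutation_swap_id permutes_imp_permutation[OF finite_lessThan swap.hyps(4)]])
  also have "\<dots> = pair_sign n (transpose a b) * pair_sign n p"
    using swap by (simp add: sign_swap_id pair_sign_transpose)
  also have "\<dots> = pair_sign n (transpose a b \<circ> p)"
    using swap.hyps by (intro pair_sign_comp[symmetric])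
  finally show ?case .
qed

section \<open>Membership in VNP\<close>

lemma nc_degree_add: "nc_degree (p + q) \<le> max (nc_degree p) (nc_degree q)"
proof (rule nc_degree_leI)
  fix w assume "w \<in> Poly_Mapping.keys (p + q)"
  then have "w \<in> Poly_Mapping.keys p \<or> w \<in> Poly_Mapping.keys q"
    using keys_add[of p q] by blast
  then show "length (letters w) \<le> max (nc_degree p) (nc_degree q)"
    using length_le_nc_degree[of w p] length_le_nc_degree[of w q] by auto
qed

lemma nc_degree_times: "nc_degree (p * q) \<le> nc_degree p + nc_degree q"
proof (rule nc_degree_leI)
  fix w assume "w \<in> Poly_Mapping.keys (p * q)"
  then obtain u v where "w = u + v" "u \<in> Poly_Mapping.keys p" "v \<in> Poly_Mapping.keys q"
    using keys_mult[of p q] by blast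
  then show "length (letters w) \<le> nc_degree p + nc_degree q"
    by (simp add: add_mono length_le_nc_degree)
qed

lemma nc_degree_const [simp]: "nc_degree (nc_const c) = 0"
  by (simp add: nc_degree_def nc_const_def)

lemma nc_degree_var: "nc_degree (nc_var v) \<le> 1"
  by (rule nc_degree_leI) (auto simp: nc_var_def split: if_splits)

text \<open>What \<open>VP\<close> asks of each polynomial, with one number bounding degree and
  size. This is economical as long as polynomials are composed like formulas; only
  \<open>walk\<close> shares values and needs separate arguments for degree and size.\<close>

definition nc_bounded :: "'v set \<Rightarrow> nat \<Rightarrow> ('v, 'f::ring_1) ncpoly \<Rightarrow> bool" where
  "nc_bounded X s p \<longleftrightarrow> nc_vars p \<subseteq> X \<and> nc_degree p \<le> s \<and>
     computable_over ({} :: ('v, 'f) ncpoly set) {} s p"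

lemma nc_bounded_mono: "nc_bounded X s p \<Longrightarrow> s \<le> t \<Longrightarrow> nc_bounded X t p"
  unfolding nc_bounded_def by (meson computable_over_mono le_trans)

lemma nc_bounded_var: "v \<in> X \<Longrightarrow> nc_bounded X 1 (nc_var v)"
  unfolding nc_bounded_def
  by (intro conjI subset_trans[OF nc_vars_var] nc_degree_var computable_over_var) simp

lemma nc_bounded_const: "nc_bounded X 1 (nc_const c)"
  unfolding nc_bounded_def using computable_over_const by simp

lemma nc_bounded_add:
  assumes "nc_bounded X s p" "nc_bounded X t q"
  shows "nc_bounded X (s + t + 1) (p + q)"
  using assms nc_vars_add[of p q] nc_degree_add[of p q] computable_over_add[of "{}" "{}" s p t q]
  unfolding nc_bounded_def by auto

lemma nc_bounded_times:
  assumes "nc_bounded X s p" "nc_bounded X t q"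
  shows "nc_bounded X (s + t + 1) (p * q)"
  using assms nc_vars_times[of p q] nc_degree_times[of p q] computable_over_times[of "{}" "{}" s p t q]
  unfolding nc_bounded_def by auto

lemma nc_bounded_sum:
  assumes "finite I" "\<And>x. x \<in> I \<Longrightarrow> nc_bounded X s (p x)"
  shows "nc_bounded X (card I * (s + 1) + 1) (sum p I)"
  using assms
proof (induction I rule: finite_induct)
  case empty
  then show ?case
    using nc_bounded_const[of X 0] by simp
next
  case (insert x I)
  have "nc_bounded X (s + (card I * (s + 1) + 1) + 1) (p x + sum p I)"
    by (rule nc_bounded_add) (use insert in auto)
  then show ?case
    using insert.hyps by (simp add: algebra_simps)
qed

lemma nc_bounded_prod_list:
  assumes "\<And>p. p \<in> set ps \<Longrightarrow> nc_bounded X s p" "length ps \<le> m"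
  shows "nc_bounded X (m * (s + 1) + 1) (prod_list ps)"
  using assms
proof (induction ps arbitrary: m)
  case Nil
  show ?case
    by (rule nc_bounded_mono[of X 1]) (use nc_bounded_const[of X 1] in simp_all)
next
  case (Cons p ps)
  then obtain m' where m: "m = Suc m'" "length ps \<le> m'"
    by (cases m) auto
  have "nc_bounded X (s + (m' * (s + 1) + 1) + 1) (p * prod_list ps)"
    by (rule nc_bounded_times) (use Cons m in auto)
  then show ?case
    by (simp add: m(1) algebra_simps)
qed

lemma nc_degree_sum:
  assumes "\<And>x. x \<in> I \<Longrightarrow> nc_degree (p x) \<le> s"
  shows "nc_degree (sum p I) \<le> s"
  using assms
proof (induction I rule: infinite_finite_induct)
  case (insert x I)
  then have "nc_degree (p x) \<le> s" "nc_degree (sum p I) \<le> s" by auto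
  then show ?case
    using insert.hyps le_trans[OF nc_degree_add max.boundedI] by simp
qed (simp_all add: nc_degree_def)

lemma nc_degree_walk:
  assumes "\<And>F a c. F \<in> set Fs \<Longrightarrow> a \<in> X \<Longrightarrow> c \<in> X \<Longrightarrow> nc_degree (F a c) \<le> s" "a \<in> X"
  shows "nc_degree (walk X z Fs a) \<le> length Fs * s"
  using assms
proof (induction Fs arbitrary: a)
  case Nil
  then show ?case
    by (simp add: nc_degree_def)
next
  case (Cons F Fs)
  have "nc_degree (F a c * walk X z Fs c) \<le> s + length Fs * s" if c: "c \<in> X" for c
  proof (rule order_trans[OF nc_degree_times add_mono])
    show "nc_degree (F a c) \<le> s"
      using Cons.prems c by simp
    show "nc_degree (walk X z Fs c) \<le> length Fs * s"
      using Cons.prems c by (intro Cons.IH) simp_all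
  qed
  then show ?case
    by (simp add: nc_degree_sum)
qed

text \<open>The values of the suffixes of a walk have to be shared, since computing each of them from scratch
  is exponential. Hence the lemma speaks of an arbitrary \<^term>\<open>q\<close> that is computed afterwards.\<close>

lemma computable_over_walk_cut:
  assumes "finite X" "\<And>F a c. F \<in> set Fs \<Longrightarrow> a \<in> X \<Longrightarrow> c \<in> X \<Longrightarrow> computable_over H A s (F a c)"
    and "computable_over H (A \<union> walk X z Fs ` X) t q"
  shows "computable_over H A (Suc (length Fs) * (card X * (card X * (s + 2) + 1)) + t) q"
  using assms(2,3)
proof (induction Fs arbitrary: t q)
  case Nil
  have "computable_over H A 1 (walk X z [] a)" for a
    using computable_over_const[of H A "of_bool (a = z)"] by (simp add: nc_const_of_bool)
  then have *: "computable_over H A (card X * (s + 2) + 1) (walk X z [] a)" for a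
    by (rule computable_over_mono) simp
  have "computable_over H A (card X * (card X * (s + 2) + 1) + t) q"
    by (rule computable_over_cut[OF assms(1) * Nil(2)])
  then show ?case by simp
next
  case (Cons F Fs)
  let ?B = "A \<union> walk X z Fs ` X"
  have w: "computable_over H ?B (card X * (s + 2) + 1) (walk X z (F # Fs) a)" if a: "a \<in> X" for a
  proof -
    have "computable_over H ?B (s + 0 + 1) (F a c * walk X z Fs c)" if c: "c \<in> X" for c
    proof (rule computable_over_times)
      show "computable_over H ?B s (F a c)"
        by (rule computable_over_weaken[OF Cons.prems(1)[OF _ a c]]) auto
      show "computable_over H ?B 0 (walk X z Fs c)"
        using c by (intro computable_over_mem) auto
    qed
    then have "computable_over H ?B (card X * ((s + 0 + 1) + 1) + 1) (walk X z (F # Fs) a)"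
      unfolding walk.simps by (rule computable_over_sum[OF assms(1)])
    then show ?thesis
      by (rule computable_over_mono) simp
  qed
  have q: "computable_over H (?B \<union> walk X z (F # Fs) ` X) t q"
    using Cons.prems(2) by (rule computable_over_weaken) blast
  have "computable_over H ?B (card X * (card X * (s + 2) + 1) + t) q"
    by (rule computable_over_cut[OF assms(1) w q])
  then have "computable_over H A (Suc (length Fs) * (card X * (card X * (s + 2) + 1)) +
      (card X * (card X * (s + 2) + 1) + t)) q"
    using Cons.prems(1) by (intro Cons.IH) simp_all
  then show ?case
    by (rule computable_over_mono) simp
qed

lemma nc_bounded_walk:
  fixes Fs :: "('x \<Rightarrow> 'x \<Rightarrow> ('v, 'f::ring_1) ncpoly) list"
  assumes "finite X" "a \<in> X" "length Fs = m"
    and F: "\<And>F a c. F \<in> set Fs \<Longrightarrow> a \<in> X \<Longrightarrow> c \<in> X \<Longrightarrow> nc_bounded V s (F a c)"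
  shows "nc_bounded V (Suc m * (card X * (card X * (s + 2) + 1))) (walk X z Fs a)"
  unfolding nc_bounded_def assms(3)[symmetric]
proof (intro conjI)
  show "nc_vars (walk X z Fs a) \<subseteq> V"
    using F assms(2) by (intro nc_vars_walk) (auto simp: nc_bounded_def)
  have "nc_degree (walk X z Fs a) \<le> length Fs * s"
    using F assms(2) by (intro nc_degree_walk) (auto simp: nc_bounded_def)
  also have "\<dots> \<le> Suc (length Fs) * (card X * (card X * (s + 2) + 1))"
  proof (rule mult_le_mono)
    have "0 < card X"
      using assms(1,2) by (auto simp: card_gt_0_iff)
    then obtain k where "card X = Suc k" using gr0_implies_Suc by blast
    then show "s \<le> card X * (card X * (s + 2) + 1)" by simp
  qed simp
  finally show "nc_degree (walk X z Fs a) \<le> Suc (length Fs) * (card X * (card X * (s + 2) + 1))" .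
  \<comment> \<open>With t = 0 the cut rule for walks already gives the bound, since the walk is
    itself one of the shared values.\<close>
  have "computable_over ({} :: ('v, 'f) ncpoly set) {} (Suc (length Fs) * (card X * (card X * (s + 2) + 1)) + 0) (walk X z Fs a)"
    using F assms by (intro computable_over_walk_cut computable_over_mem) (auto simp: nc_bounded_def)
  then show "computable_over ({} :: ('v, 'f) ncpoly set) {} (Suc (length Fs) * (card X * (card X * (s + 2) + 1))) (walk X z Fs a)"
    by simp
qed

text \<open>A pair of functions from \<^term>\<open>{..<n}\<close> to itself is encoded by the bits \<^term>\<open>i * n + u\<close>,
  \<^term>\<open>i < 2 * n\<close>, \<^term>\<open>u < n\<close>: the first function maps \<^term>\<open>i\<close> to \<^term>\<open>u\<close>, or the
  second one maps \<^term>\<open>i - n\<close> to \<^term>\<open>u\<close>.\<close>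

definition bit_var :: "nat \<Rightarrow> nat \<Rightarrow> nat \<Rightarrow> ('v + nat, 'f::comm_ring_1) ncpoly" where
  "bit_var n i u = nc_var (Inr (i * n + u))"

text \<open>Tests that exactly one bit of row \<open>i\<close> is set: the summand for
  \<open>u\<close> becomes 1 if \<open>u\<close> is the only one, and 0 otherwise.\<close>

definition row_valid :: "nat \<Rightarrow> nat \<Rightarrow> ('v + nat, 'f::comm_ring_1) ncpoly" where
  "row_valid n i = (\<Sum>u<n. bit_var n i u *
     prod_list (map (\<lambda>v. 1 + nc_const (- 1) * bit_var n i v) (filter (\<lambda>v. v \<noteq> u) [0..<n])))"

text \<open>On bits whose rows encode a function f this is the sign of f j - f i, the factor of
  \<open>pair_sign\<close> for the pair.\<close>

definition pair_order :: "nat \<Rightarrow> nat \<Rightarrow> nat \<Rightarrow> ('v + nat, 'f::comm_ring_1) ncpoly" where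
  "pair_order n i j = (\<Sum>u<n. \<Sum>v<n.
     nc_const (of_int (sgn (int v - int u))) * (bit_var n i u * bit_var n j v))"

text \<open>A list, because products of non-commuting polynomials need an order.\<close>

definition pair_list :: "nat \<Rightarrow> (nat \<times> nat) list" where
  "pair_list n = filter (\<lambda>(i, j). i < j) (List.product [0..<n] [0..<n])"

definition sign_poly :: "nat \<Rightarrow> nat \<Rightarrow> ('v + nat, 'f::comm_ring_1) ncpoly" where
  "sign_poly n a = prod_list (map (\<lambda>(i, j). pair_order n (a + i) (a + j)) (pair_list n))"

definition entry_poly ::
    "nat \<Rightarrow> nat \<Rightarrow> nat \<Rightarrow> nat \<Rightarrow> ((nat \<times> nat \<times> nat \<times> nat) + nat, 'f::comm_ring_1) ncpoly" where
  "entry_poly n i a b =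
     (\<Sum>u<n. \<Sum>v<n. (bit_var n i u * bit_var n (n + i) v) * nc_var (Inl (u, v, a, b)))"

text \<open>The row tests discard bits that encode no pair of functions, and the two sign factors
  discard functions that are not injective. After the substitution of bits all factors before the
  walk are constants.\<close>

definition sdet_verifier ::
    "nat \<Rightarrow> nat \<Rightarrow> nat \<Rightarrow> ((nat \<times> nat \<times> nat \<times> nat) + nat, 'f::field_char_0) ncpoly" where
  "sdet_verifier n k l = nc_const (1 / fact n) * (prod_list (map (row_valid n) [0..<2 * n]) *
     ((sign_poly n 0 * sign_poly n n) * walk {..<n} l (map (entry_poly n) [0..<n]) k))"

abbreviation bit_subst :: "nat set \<Rightarrow> 'v + nat \<Rightarrow> ('v, 'f::comm_ring_1) ncpoly" where
  "bit_subst E \<equiv> case_sum nc_var (\<lambda>i. nc_const (of_bool (i \<in> E)))"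

definition bit_row :: "nat \<Rightarrow> nat set \<Rightarrow> nat \<Rightarrow> nat set" where
  "bit_row n E i = {u. u < n \<and> i * n + u \<in> E}"

lemma pair_list: "set (pair_list n) = ordered_pairs n" "distinct (pair_list n)" "length (pair_list n) \<le> n * n"
proof -
  show "set (pair_list n) = ordered_pairs n"
    by (auto simp: pair_list_def ordered_pairs_def)
  show "distinct (pair_list n)"
    by (simp add: pair_list_def distinct_product)
  show "length (pair_list n) \<le> n * n"
    unfolding pair_list_def by (rule order_trans[OF length_filter_le]) simp
qed

section \<open>Evaluation of the verifier at given bits\<close>

lemma subst_bit_var: "u < n \<Longrightarrow> nc_subst (bit_subst E) (bit_var n i u) = nc_const (of_bool (u \<in> bit_row n E i))"
  by (simp add: bit_var_def bit_row_def)

lemma prod_list_nc_const: "(\<Prod>x\<leftarrow>xs. nc_const (h x)) = nc_const (\<Prod>x\<leftarrow>xs. h x :: 'f::ring_1)"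
  by (induction xs) (simp_all add: nc_const_mult)

lemma prod_list_eq_0: "0 \<in> set xs \<Longrightarrow> prod_list xs = (0 :: 'a::semiring_1)"
  by (induction xs) auto

lemma prod_list_negated_bools:
  "prod_list (map (\<lambda>v. 1 + nc_const (- 1) * nc_const (of_bool (P v))) xs) =
    (nc_const (of_bool (\<forall>v\<in>set xs. \<not> P v)) :: ('v, 'f::comm_ring_1) ncpoly)"
proof (induction xs)
  case (Cons x xs)
  have "1 + nc_const (- 1) * nc_const (of_bool (P x)) = (nc_const (of_bool (\<not> P x)) :: ('v, 'f) ncpoly)"
    by (simp add: nc_const_uminus)
  then show ?case
    using Cons by (cases "P x") simp_all
qed simp

lemma sum_nc_const_of_bool_eq:
  fixes f :: "nat \<Rightarrow> ('v, 'f::comm_ring_1) ncpoly"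
  assumes "u < n"
  shows "(\<Sum>v<n. nc_const (of_bool (v = u)) * f v) = f u"
proof -
  have "(\<Sum>v<n. nc_const (of_bool (v = u)) * f v) = (\<Sum>v<n. if v = u then f u else 0)"
    by (intro sum.cong) auto
  then show ?thesis using assms by simp
qed

lemma subst_row_valid:
  "nc_subst (bit_subst E) (row_valid n i) =
    (nc_const (of_bool (\<exists>u. bit_row n E i = {u})) :: ('v, 'f::comm_ring_1) ncpoly)"
proof -
  let ?R = "bit_row n E i"
  have "nc_subst (bit_subst E) (bit_var n i u *
      prod_list (map (\<lambda>v. 1 + nc_const (- 1) * bit_var n i v) (filter (\<lambda>v. v \<noteq> u) [0..<n]))) =
      (nc_const (of_bool (?R = {u})) :: ('v, 'f) ncpoly)" if u: "u < n" for u
  proof -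
    have "map (nc_subst (bit_subst E) \<circ> (\<lambda>v. 1 + nc_const (- 1) * bit_var n i v)) (filter (\<lambda>v. v \<noteq> u) [0..<n]) =
        (map (\<lambda>v. 1 + nc_const (- 1) * nc_const (of_bool (v \<in> ?R))) (filter (\<lambda>v. v \<noteq> u) [0..<n]) ::
          ('v, 'f) ncpoly list)"
      by (rule map_cong) (auto simp: subst_bit_var)
    then have "nc_subst (bit_subst E) (bit_var n i u *
        prod_list (map (\<lambda>v. 1 + nc_const (- 1) * bit_var n i v) (filter (\<lambda>v. v \<noteq> u) [0..<n]))) =
        (nc_const (of_bool (u \<in> ?R \<and> (\<forall>v\<in>set (filter (\<lambda>v. v \<noteq> u) [0..<n]). v \<notin> ?R))) :: ('v, 'f) ncpoly)"
      using u by (simp only: nc_subst_times nc_subst_prod_list map_map subst_bit_var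
          prod_list_negated_bools of_bool_conj nc_const_mult)
    moreover have "(u \<in> ?R \<and> (\<forall>v\<in>set (filter (\<lambda>v. v \<noteq> u) [0..<n]). v \<notin> ?R)) \<longleftrightarrow> ?R = {u}"
      by (auto simp: bit_row_def)
    ultimately show ?thesis by (simp only:)
  qed
  then have "nc_subst (bit_subst E) (row_valid n i) = (\<Sum>u<n. nc_const (of_bool (?R = {u})) :: ('v, 'f) ncpoly)"
    unfolding row_valid_def nc_subst_sum by (intro sum.cong) auto
  also have "\<dots> = nc_const (of_bool (\<exists>u. ?R = {u}))"
  proof (cases "\<exists>u. ?R = {u}")
    case True
    then obtain u where u: "?R = {u}" by blast
    then have "u < n" by (auto simp: bit_row_def)
    have "(\<Sum>v<n. nc_const (of_bool (?R = {v})) :: ('v, 'f) ncpoly) = (\<Sum>v<n. nc_const (of_bool (v = u)) * 1)"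
      unfolding u by (intro sum.cong) auto
    then show ?thesis
      using u by (simp only: sum_nc_const_of_bool_eq[OF \<open>u < n\<close>]) simp
  next
    case False
    then have "?R \<noteq> {u}" for u by blast
    then show ?thesis by simp
  qed
  finally show ?thesis .
qed

context
  fixes n :: nat and E :: "nat set" and f :: "nat \<Rightarrow> nat"
  assumes f: "\<And>i. i < 2 * n \<Longrightarrow> bit_row n E i = {f i}"
begin

lemma f_less: "i < 2 * n \<Longrightarrow> f i < n"
  using f[of i] by (auto simp: bit_row_def)

lemma subst_bit_var_eq: "i < 2 * n \<Longrightarrow> u < n \<Longrightarrow>
    nc_subst (bit_subst E) (bit_var n i u) = nc_const (of_bool (u = f i))"
  by (simp add: subst_bit_var f)

lemma subst_pair_order:
  assumes "i < 2 * n" "j < 2 * n"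
  shows "nc_subst (bit_subst E) (pair_order n i j) = nc_const (of_int (sgn (int (f j) - int (f i))))"
proof -
  have "nc_subst (bit_subst E) (pair_order n i j) =
      (\<Sum>u<n. nc_const (of_bool (u = f i)) * (\<Sum>v<n. nc_const (of_bool (v = f j)) *
        nc_const (of_int (sgn (int v - int u)))))"
    unfolding pair_order_def nc_subst_sum nc_subst_times nc_subst_const sum_distrib_left
    by (intro sum.cong refl)
      (simp only: lessThan_iff subst_bit_var_eq[OF assms(1)] subst_bit_var_eq[OF assms(2)]
        nc_const_mult[symmetric] mult_ac)
  then show ?thesis
    using assms by (simp only: sum_nc_const_of_bool_eq f_less)
qed

lemma subst_sign_poly:
  assumes "a \<le> n"
  shows "nc_subst (bit_subst E) (sign_poly n a) = nc_const (of_int (pair_sign n (\<lambda>i. f (a + i))))"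
proof -
  have "nc_subst (bit_subst E) (sign_poly n a) =
      prod_list (map (\<lambda>(i, j). nc_const (of_int (sgn (int (f (a + j)) - int (f (a + i)))))) (pair_list n))"
    unfolding sign_poly_def nc_subst_prod_list map_map
    using pair_list(1)[of n] assms
    by (intro arg_cong[where f = prod_list] map_cong refl) (auto simp: ordered_pairs_def subst_pair_order)
  also have "\<dots> = nc_const (\<Prod>(i, j)\<leftarrow>pair_list n. of_int (sgn (int (f (a + j)) - int (f (a + i)))))"
    unfolding prod_list_nc_const[symmetric] by (simp add: case_prod_unfold)
  also have "(\<Prod>(i, j)\<leftarrow>pair_list n. of_int (sgn (int (f (a + j)) - int (f (a + i))))) =
      (of_int (pair_sign n (\<lambda>i. f (a + i))) :: 'b)"
    using prod.distinct_set_conv_list[OF pair_list(2)[of n],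
        of "\<lambda>(i, j). of_int (sgn (int (f (a + j)) - int (f (a + i)))) :: 'b"]
    by (simp add: pair_list(1) pair_sign_def case_prod_unfold of_int_prod)
  finally show ?thesis .
qed

lemma subst_entry_poly:
  assumes "i < n"
  shows "nc_subst (bit_subst E) (entry_poly n i a b) = nc_var (f i, f (n + i), a, b)"
proof -
  have "nc_subst (bit_subst E) (entry_poly n i a b) =
      (\<Sum>u<n. nc_const (of_bool (u = f i)) * (\<Sum>v<n. nc_const (of_bool (v = f (n + i))) * nc_var (u, v, a, b)))"
    unfolding entry_poly_def nc_subst_sum nc_subst_times sum_distrib_left
    using assms by (intro sum.cong refl) (simp add: subst_bit_var_eq mult.assoc)
  then show ?thesis
    using assms by (simp only: sum_nc_const_of_bool_eq f_less)
qed

lemma subst_sdet_verifier_valid: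
  "nc_subst (bit_subst E) (sdet_verifier n k l) = nc_const (1 / fact n) *
    (nc_const (of_int (pair_sign n f) * of_int (pair_sign n (\<lambda>i. f (n + i)))) *
     walk {..<n} l (map (\<lambda>i a b. nc_var (f i, f (n + i), a, b)) [0..<n]) k :: (_, 'f::field_char_0) ncpoly)"
proof -
  have r: "map (nc_subst (bit_subst E) \<circ> row_valid n) [0..<2 * n] =
      (map (\<lambda>_. 1) [0..<2 * n] :: (nat \<times> nat \<times> nat \<times> nat, 'f) ncpoly list)"
    using f by (intro map_cong) (auto simp: subst_row_valid)
  have w: "map ((\<lambda>F a c. nc_subst (bit_subst E) (F a c)) \<circ> entry_poly n) [0..<n] =
      (map (\<lambda>i a b. nc_var (f i, f (n + i), a, b)) [0..<n] :: (nat \<Rightarrow> nat \<Rightarrow> (_, 'f) ncpoly) list)"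
    by (intro map_cong) (auto simp: subst_entry_poly fun_eq_iff)
  have "nc_subst (bit_subst E) (prod_list (map (row_valid n) [0..<2 * n])) =
      (1 :: (nat \<times> nat \<times> nat \<times> nat, 'f) ncpoly)"
    by (simp only: nc_subst_prod_list map_map r) (simp add: map_replicate_const)
  moreover have "nc_subst (bit_subst E) (walk {..<n} l (map (entry_poly n) [0..<n]) k) =
      (walk {..<n} l (map (\<lambda>i a b. nc_var (f i, f (n + i), a, b)) [0..<n]) k :: (_, 'f) ncpoly)"
    by (simp only: nc_subst_walk map_map w)
  ultimately show ?thesis
    by (simp add: sdet_verifier_def subst_sign_poly nc_const_mult del: nc_subst_prod_list)
qed

end

lemma subst_sdet_verifier_invalid:
  assumes "i < 2 * n" "\<nexists>u. bit_row n E i = {u}"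
  shows "nc_subst (bit_subst E) (sdet_verifier n k l) = (0 :: (_, 'f::field_char_0) ncpoly)"
proof -
  have "nc_subst (bit_subst E) (row_valid n i) = (0 :: (nat \<times> nat \<times> nat \<times> nat, 'f) ncpoly)"
    unfolding subst_row_valid using assms(2) by simp
  then have "(0 :: (nat \<times> nat \<times> nat \<times> nat, 'f) ncpoly) \<in>
      nc_subst (bit_subst E) ` set (map (row_valid n) [0..<2 * n])"
    using assms(1) by (intro image_eqI[of _ _ "row_valid n i"]) auto
  then have "nc_subst (bit_subst E) (prod_list (map (row_valid n) [0..<2 * n])) =
      (0 :: (nat \<times> nat \<times> nat \<times> nat, 'f) ncpoly)"
    unfolding nc_subst_prod_list by (intro prod_list_eq_0) (simp only: set_map)
  then show ?thesis
    by (simp add: sdet_verifier_def del: nc_subst_prod_list)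
qed

lemma inj_on_extend_permutes:
  fixes f :: "nat \<Rightarrow> nat"
  assumes "inj_on f {..<n}" "\<And>i. i < n \<Longrightarrow> f i < n"
  shows "(\<lambda>i. if i < n then f i else i) permutes {..<n}"
proof (rule bij_imp_permutes)
  have "f ` {..<n} = {..<n}"
    using assms by (intro endo_inj_surj) auto
  then show "bij_betw (\<lambda>i. if i < n then f i else i) {..<n} {..<n}"
    using assms(1) by (auto simp: bij_betw_def inj_on_def)
qed auto

text \<open>The map \<open>code\<close> embeds the pairs of permutations into the sets of bits. On
  its image the verifier is the corresponding term of the determinant; everywhere else it
  vanishes.\<close>

lemma sum_subst_sdet_verifier:
  assumes "k < n" "l < n"
  shows "(\<Sum>E\<in>Pow {..<2 * n * n}. nc_subst (bit_subst E) (sdet_verifier n k l)) =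
    (sdet (mat_algebra n) n (generic_matrix n n) $$ (k, l) :: (_, 'f::field_char_0) ncpoly)"
proof -
  define G :: "nat set \<Rightarrow> (nat \<times> nat \<times> nat \<times> nat, 'f) ncpoly"
    where "G = (\<lambda>E. nc_subst (bit_subst E) (sdet_verifier n k l))"
  define P where "P = {\<sigma>. \<sigma> permutes {..<n}}"
  define comb where "comb = (\<lambda>(\<sigma>, \<tau>) i. if i < n then \<sigma> i else \<tau> (i - n) :: nat)"
  define code where "code = (\<lambda>st. (\<lambda>i. i * n + comb st i) ` {..<2 * n})"
  have comb_less: "comb st i < n" if st_i: "st \<in> P \<times> P" "i < 2 * n" for st i
  proof -
    obtain \<sigma> \<tau> where st: "st = (\<sigma>, \<tau>)" "\<sigma> permutes {..<n}" "\<tau> permutes {..<n}"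
      using st_i(1) unfolding P_def by blast
    show ?thesis
      using st_i(2) permutes_in_image[OF st(2), of i] permutes_in_image[OF st(3), of "i - n"]
      by (auto simp: st(1) comb_def)
  qed
  have row: "bit_row n (code st) i = {comb st i}" if st: "st \<in> P \<times> P" and i: "i < 2 * n" for st i
  proof -
    \<comment> \<open>All values are below \<open>n\<close>, so division by \<open>n\<close>
      recovers the row and the remainder recovers the value.\<close>
    have *: "u = comb st i" if u: "u < n" "i * n + u = j * n + comb st j" "j < 2 * n" for u j
    proof -
      have "(i * n + u) div n = (j * n + comb st j) div n" "(i * n + u) mod n = (j * n + comb st j) mod n"
        using u by simp_all
      then show ?thesis
        using u(1) comb_less[OF st u(3)] by simp
    qed
    show ?thesis
    proof (intro equalityI subsetI)
      fix u assume "u \<in> bit_row n (code st) i"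
      then obtain j where "u < n" "i * n + u = j * n + comb st j" "j < 2 * n"
        unfolding bit_row_def code_def by blast
      then show "u \<in> {comb st i}" using * by blast
    next
      fix u assume "u \<in> {comb st i}"
      then show "u \<in> bit_row n (code st) i"
        using comb_less[OF st i] i unfolding bit_row_def code_def by blast
    qed
  qed
  have "code ` (P \<times> P) \<subseteq> Pow {..<2 * n * n}"
  proof -
    have "i * n + comb st i < 2 * n * n" if "st \<in> P \<times> P" "i < 2 * n" for st i
    proof -
      have "i * n + comb st i < Suc i * n" using comb_less[OF that] by simp
      also have "\<dots> \<le> 2 * n * n" using that(2) by (intro mult_le_mono1) simp
      finally show ?thesis .
    qed
    then show ?thesis by (auto simp: code_def)
  qed
  moreover have "G E = 0" if E: "E \<in> Pow {..<2 * n * n} - code ` (P \<times> P)" for E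
  proof (rule ccontr)
    assume "G E \<noteq> 0"
    then have "\<forall>i. i < 2 * n \<longrightarrow> (\<exists>u. bit_row n E i = {u})"
      using subst_sdet_verifier_invalid unfolding G_def by blast
    then obtain f where f: "\<And>i. i < 2 * n \<Longrightarrow> bit_row n E i = {f i}"
      by metis
    have less: "f i < n" if "i < 2 * n" for i
      using f_less[of n E f] f that by blast
    \<comment> \<open>Valid rows only provide functions; their injectivity comes from the sign
      factors, which cannot vanish here.\<close>
    have "pair_sign n f \<noteq> 0" "pair_sign n (\<lambda>i. f (n + i)) \<noteq> 0"
      using \<open>G E \<noteq> 0\<close> subst_sdet_verifier_valid[of n E f k l] f unfolding G_def by auto
    then have inj: "inj_on f {..<n}" "inj_on (\<lambda>i. f (n + i)) {..<n}"
      by (simp_all add: pair_sign_eq_0_iff)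
    define \<sigma> \<tau> where "\<sigma> = (\<lambda>i. if i < n then f i else i)" and "\<tau> = (\<lambda>i. if i < n then f (n + i) else i)"
    have st: "(\<sigma>, \<tau>) \<in> P \<times> P"
      using inj_on_extend_permutes[OF inj(1)] inj_on_extend_permutes[OF inj(2)] less
      by (simp add: P_def \<sigma>_def \<tau>_def)
    have comb: "comb (\<sigma>, \<tau>) i = f i" if "i < 2 * n" for i
      using that by (auto simp: comb_def \<sigma>_def \<tau>_def)
    \<comment> \<open>Every bit below \<open>2 * n * n\<close> lies in one of the
      \<open>2 * n\<close> rows, so the rows determine \<open>E\<close> completely.\<close>
    have "E = code (\<sigma>, \<tau>)"
    proof (intro equalityI subsetI)
      fix x assume x: "x \<in> E"
      then have "x < 2 * n * n" using E by auto
      then have "0 < n" "x div n < 2 * n"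
        by (auto simp: less_mult_imp_div_less intro: gr0I)
      then have "x mod n \<in> bit_row n E (x div n)"
        using x by (simp add: bit_row_def)
      then have "x mod n = f (x div n)" using f[OF \<open>x div n < 2 * n\<close>] by simp
      then have "x = x div n * n + comb (\<sigma>, \<tau>) (x div n)"
        using comb[OF \<open>x div n < 2 * n\<close>] by (metis div_mult_mod_eq)
      then show "x \<in> code (\<sigma>, \<tau>)"
        using \<open>x div n < 2 * n\<close> unfolding code_def by blast
    next
      fix x assume "x \<in> code (\<sigma>, \<tau>)"
      then obtain i where i: "i < 2 * n" "x = i * n + f i"
        using comb by (auto simp: code_def)
      then have "f i \<in> bit_row n E i" using f by simp
      then show "x \<in> E" using i by (simp add: bit_row_def)
    qed
    then show False using E st by blast
  qed
  ultimately have "(\<Sum>E\<in>Pow {..<2 * n * n}. G E) = sum G (code ` (P \<times> P))"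
    by (intro sum.mono_neutral_right) auto
  also have "\<dots> = (\<Sum>st\<in>P \<times> P. G (code st))"
  proof (rule sum.reindex[unfolded comp_def], rule inj_onI)
    fix x y assume xy: "x \<in> P \<times> P" "y \<in> P \<times> P" "code x = code y"
    have eq: "comb x i = comb y i" if "i < 2 * n" for i
      using row[OF xy(1) that] row[OF xy(2) that] xy(3) by simp
    obtain \<sigma> \<tau> where x: "x = (\<sigma>, \<tau>)" "\<sigma> permutes {..<n}" "\<tau> permutes {..<n}"
      using xy(1) unfolding P_def by blast
    obtain \<sigma>' \<tau>' where y: "y = (\<sigma>', \<tau>')" "\<sigma>' permutes {..<n}" "\<tau>' permutes {..<n}"
      using xy(2) unfolding P_def by blast
    have "\<sigma> i = \<sigma>' i" for i
      using eq[of i] x y by (cases "i < n") (auto simp: comb_def permutes_not_in)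
    moreover have "\<tau> i = \<tau>' i" for i
      using eq[of "n + i"] x y by (cases "i < n") (auto simp: comb_def permutes_not_in)
    ultimately show "x = y" using x y by auto
  qed
  also have "\<dots> = (\<Sum>(\<sigma>, \<tau>)\<in>P \<times> P. nc_const (1 / fact n) * (nc_const (of_int (sign \<sigma>) * of_int (sign \<tau>)) *
      walk {..<n} l (map (\<lambda>i a b. nc_var (\<sigma> i, \<tau> i, a, b)) [0..<n]) k))"
  proof (rule sum.cong[OF refl])
    fix st assume st: "st \<in> P \<times> P"
    then obtain \<sigma> \<tau> where x: "st = (\<sigma>, \<tau>)" "\<sigma> permutes {..<n}" "\<tau> permutes {..<n}"
      unfolding P_def by blast
    have c1: "pair_sign n (comb st) = pair_sign n \<sigma>"
      unfolding pair_sign_def by (intro prod.cong) (auto simp: ordered_pairs_def x comb_def)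
    have c2: "comb st (n + i) = \<tau> i" for i
      by (auto simp: x comb_def)
    have c3: "map (\<lambda>i a b. nc_var (comb st i, \<tau> i, a, b)) [0..<n] =
        (map (\<lambda>i a b. nc_var (\<sigma> i, \<tau> i, a, b)) [0..<n] :: (nat \<Rightarrow> nat \<Rightarrow> (_, 'f) ncpoly) list)"
      by (intro map_cong) (auto simp: x comb_def)
    have "G (code st) = nc_const (1 / fact n) * (nc_const (of_int (pair_sign n \<sigma>) * of_int (pair_sign n \<tau>)) *
        walk {..<n} l (map (\<lambda>i a b. nc_var (\<sigma> i, \<tau> i, a, b)) [0..<n]) k)"
      using subst_sdet_verifier_valid[of n "code st" "comb st" k l, where ?'f = 'f, OF row[OF st]]
      unfolding G_def c1 c2 c3 by blast
    then show "G (code st) = (case st of (\<sigma>, \<tau>) \<Rightarrow> nc_const (1 / fact n) *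
        (nc_const (of_int (sign \<sigma>) * of_int (sign \<tau>)) *
        walk {..<n} l (map (\<lambda>i a b. nc_var (\<sigma> i, \<tau> i, a, b)) [0..<n]) k))"
      using x by (simp add: sign_eq_pair_sign)
  qed
  also have "\<dots> = sdet (mat_algebra n) n (generic_matrix n n) $$ (k, l)"
    unfolding sdet_generic_matrix_index[OF assms] P_def[symmetric]
    by (simp add: sum_distrib_left case_prod_unfold)
  finally show ?thesis unfolding G_def .
qed

section \<open>Size of the verifier\<close>

definition verifier_vars :: "nat \<Rightarrow> ((nat \<times> nat \<times> nat \<times> nat) + nat) set" where
  "verifier_vars n = Inl ` ({..<n} \<times> {..<n} \<times> {..<n} \<times> {..<n}) \<union> Inr ` {..<2 * n * n}"

lemma nc_bounded_bit_var: "i < 2 * n \<Longrightarrow> u < n \<Longrightarrow> nc_bounded (verifier_vars n) 1 (bit_var n i u)"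
proof -
  assume *: "i < 2 * n" "u < n"
  then have "i * n + u < Suc i * n" by simp
  also have "\<dots> \<le> 2 * n * n" using *(1) by (intro mult_le_mono1) simp
  finally show ?thesis
    unfolding bit_var_def by (intro nc_bounded_var) (simp add: verifier_vars_def)
qed

lemma nc_bounded_row_valid:
  assumes "i < 2 * n"
  shows "nc_bounded (verifier_vars n) (n * (6 * n + 4) + 1) (row_valid n i :: (_, 'f::comm_ring_1) ncpoly)"
proof -
  have "nc_bounded (verifier_vars n) (6 * n + 3) (bit_var n i u *
     prod_list (map (\<lambda>v. 1 + nc_const (- 1) * bit_var n i v) (filter (\<lambda>v. v \<noteq> u) [0..<n])) :: (_, 'f) ncpoly)"
    if u: "u < n" for u
  proof -
    let ?xs = "map (\<lambda>v. 1 + nc_const (- 1) * bit_var n i v) (filter (\<lambda>v. v \<noteq> u) [0..<n]) :: (_, 'f) ncpoly list"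
    have "nc_bounded (verifier_vars n) (1 + (1 + 1 + 1) + 1) p" if p: "p \<in> set ?xs" for p
    proof -
      obtain v where v: "p = nc_const 1 + nc_const (- 1) * bit_var n i v" "v < n" using p by auto
      show ?thesis
        unfolding v(1) by (intro nc_bounded_add nc_bounded_times nc_bounded_const nc_bounded_bit_var assms v(2))
    qed
    moreover have "length ?xs \<le> n"
      using length_filter_le[of _ "[0..<n]"] by simp
    ultimately have "nc_bounded (verifier_vars n) (n * ((1 + (1 + 1 + 1) + 1) + 1) + 1) (prod_list ?xs)"
      by (intro nc_bounded_prod_list) auto
    then have "nc_bounded (verifier_vars n) (1 + (n * ((1 + (1 + 1 + 1) + 1) + 1) + 1) + 1) (bit_var n i u * prod_list ?xs)"
      by (intro nc_bounded_times nc_bounded_bit_var assms u)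
    then show ?thesis
      by (rule nc_bounded_mono) simp
  qed
  then have "nc_bounded (verifier_vars n) (card {..<n} * ((6 * n + 3) + 1) + 1) (row_valid n i :: (_, 'f) ncpoly)"
    unfolding row_valid_def by (intro nc_bounded_sum) auto
  then show ?thesis
    by (rule nc_bounded_mono) simp
qed

text \<open>The common shape of \<open>pair_order\<close> and \<open>entry_poly\<close>; 5 is the
  bound for a product of three factors of size 1.\<close>

lemma nc_bounded_double_sum:
  assumes "\<And>u v. u < n \<Longrightarrow> v < n \<Longrightarrow> nc_bounded X 5 (p u v)"
  shows "nc_bounded X (n * (6 * n + 2) + 1) (\<Sum>u<n. \<Sum>v<n. p u v)"
proof -
  have "nc_bounded X (card {..<n} * ((card {..<n} * (5 + 1) + 1) + 1) + 1) (\<Sum>u<n. \<Sum>v<n. p u v)"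
    by (intro nc_bounded_sum assms) auto
  then show ?thesis
    by (rule nc_bounded_mono) simp
qed

lemma nc_bounded_pair_order:
  assumes "i < 2 * n" "j < 2 * n"
  shows "nc_bounded (verifier_vars n) (n * (6 * n + 2) + 1) (pair_order n i j :: (_, 'f::comm_ring_1) ncpoly)"
  unfolding pair_order_def
proof (rule nc_bounded_double_sum)
  fix u v assume "u < n" "v < n"
  then have "nc_bounded (verifier_vars n) (1 + (1 + 1 + 1) + 1)
    (nc_const (of_int (sgn (int v - int u))) * (bit_var n i u * bit_var n j v) :: (_, 'f) ncpoly)"
    by (intro nc_bounded_times nc_bounded_const nc_bounded_bit_var assms)
  then show "nc_bounded (verifier_vars n) 5
    (nc_const (of_int (sgn (int v - int u))) * (bit_var n i u * bit_var n j v) :: (_, 'f) ncpoly)"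
    by (rule nc_bounded_mono) simp
qed

lemma nc_bounded_entry_poly:
  assumes "i < n" "a < n" "b < n"
  shows "nc_bounded (verifier_vars n) (n * (6 * n + 2) + 1) (entry_poly n i a b :: (_, 'f::comm_ring_1) ncpoly)"
  unfolding entry_poly_def
proof (rule nc_bounded_double_sum)
  fix u v assume "u < n" "v < n"
  then have "nc_bounded (verifier_vars n) ((1 + 1 + 1) + 1 + 1)
    (bit_var n i u * bit_var n (n + i) v * nc_var (Inl (u, v, a, b)) :: (_, 'f) ncpoly)"
    using assms by (intro nc_bounded_times nc_bounded_var nc_bounded_bit_var) (auto simp: verifier_vars_def)
  then show "nc_bounded (verifier_vars n) 5
    (bit_var n i u * bit_var n (n + i) v * nc_var (Inl (u, v, a, b)) :: (_, 'f) ncpoly)"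
    by (rule nc_bounded_mono) simp
qed

lemma nc_bounded_sign_poly:
  assumes "a \<le> n"
  shows "nc_bounded (verifier_vars n) (n * n * (n * (6 * n + 2) + 2) + 1) (sign_poly n a :: (_, 'f::comm_ring_1) ncpoly)"
proof -
  have "nc_bounded (verifier_vars n) (n * n * ((n * (6 * n + 2) + 1) + 1) + 1) (sign_poly n a :: (_, 'f) ncpoly)"
    unfolding sign_poly_def
  proof (intro nc_bounded_prod_list)
    fix p :: "((nat \<times> nat \<times> nat \<times> nat) + nat, 'f) ncpoly"
    assume "p \<in> set (map (\<lambda>(i, j). pair_order n (a + i) (a + j)) (pair_list n))"
    then obtain i j where ij: "i < j" "j < n" and p: "p = pair_order n (a + i) (a + j)"
      using pair_list(1)[of n] by (auto simp: ordered_pairs_def)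
    show "nc_bounded (verifier_vars n) (n * (6 * n + 2) + 1) p"
      unfolding p using ij assms by (intro nc_bounded_pair_order) auto
  qed (use pair_list(3)[of n] in simp)
  then show ?thesis
    by (rule nc_bounded_mono) simp
qed

text \<open>Follows the syntax of \<open>sdet_verifier\<close>, so that the composition rules for
  \<open>nc_bounded\<close> add up to exactly this expression.\<close>

definition verifier_size :: "nat \<Rightarrow> nat" where
  "verifier_size n = 1 + ((2 * n * ((n * (6 * n + 4) + 1) + 1) + 1) +
     (((n * n * (n * (6 * n + 2) + 2) + 1) + (n * n * (n * (6 * n + 2) + 2) + 1) + 1) +
      ((n + 1) * (n * (n * ((n * (6 * n + 2) + 1) + 2) + 1))) + 1) + 1) + 1"

lemma poly_bounded_verifier_size: "poly_bounded verifier_size"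
  unfolding verifier_size_def
  by (intro poly_bounded_add poly_bounded_mult poly_bounded_const poly_bounded_id)

lemma nc_bounded_sdet_verifier:
  assumes "k < n" "l < n"
  shows "nc_bounded (verifier_vars n) (verifier_size n) (sdet_verifier n k l :: (_, 'f::field_char_0) ncpoly)"
proof -
  have rows: "nc_bounded (verifier_vars n) (2 * n * ((n * (6 * n + 4) + 1) + 1) + 1)
      (prod_list (map (row_valid n) [0..<2 * n]) :: (_, 'f) ncpoly)"
  proof (rule nc_bounded_prod_list)
    fix p :: "((nat \<times> nat \<times> nat \<times> nat) + nat, 'f) ncpoly"
    assume "p \<in> set (map (row_valid n) [0..<2 * n])"
    then obtain i where i: "i < 2 * n" and p: "p = row_valid n i"
      by auto
    show "nc_bounded (verifier_vars n) (n * (6 * n + 4) + 1) p"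
      unfolding p using i by (rule nc_bounded_row_valid)
  qed simp
  have walk: "nc_bounded (verifier_vars n) ((n + 1) * (n * (n * ((n * (6 * n + 2) + 1) + 2) + 1)))
      (walk {..<n} l (map (entry_poly n) [0..<n]) k :: (_, 'f) ncpoly)"
  proof -
    have "nc_bounded (verifier_vars n) (Suc n * (card {..<n} * (card {..<n} * ((n * (6 * n + 2) + 1) + 2) + 1)))
      (walk {..<n} l (map (entry_poly n) [0..<n]) k :: (_, 'f) ncpoly)"
    proof (rule nc_bounded_walk)
      fix F :: "nat \<Rightarrow> nat \<Rightarrow> ((nat \<times> nat \<times> nat \<times> nat) + nat, 'f) ncpoly" and a c
      assume "F \<in> set (map (entry_poly n) [0..<n])" and ac: "a \<in> {..<n}" "c \<in> {..<n}"
      then obtain i where i: "i < n" and F: "F = entry_poly n i"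
        by auto
      show "nc_bounded (verifier_vars n) (n * (6 * n + 2) + 1) (F a c)"
        unfolding F using i ac by (intro nc_bounded_entry_poly) simp_all
    qed (use assms in simp_all)
    then show ?thesis by simp
  qed
  show "nc_bounded (verifier_vars n) (verifier_size n) (sdet_verifier n k l :: (_, 'f) ncpoly)"
    unfolding sdet_verifier_def verifier_size_def
    by (intro nc_bounded_times nc_bounded_const rows walk nc_bounded_sign_poly) auto
qed

text \<open>The chosen entry may vary arbitrarily with \<open>n\<close>; this is harmless because
  the bounds for the verifier do not depend on the indices of the entry.\<close>

lemma sdet_family_VNP:
  fixes h :: "nat \<Rightarrow> (nat \<times> nat \<times> nat \<times> nat, 'f::field_char_0) ncpoly"
  assumes "\<forall>n\<ge>1. h n \<in> sdet_family (\<lambda>n. n) n"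
  shows "h \<in> VNP"
proof -
  have "\<forall>n. \<exists>k l. n \<ge> 1 \<longrightarrow> k < n \<and> l < n \<and> h n = sdet (mat_algebra n) n (generic_matrix n n) $$ (k, l)"
    using assms unfolding sdet_family_def by blast
  then obtain k l where kl: "\<And>n. n \<ge> 1 \<Longrightarrow> k n < n \<and> l n < n \<and>
      h n = sdet (mat_algebra n) n (generic_matrix n n) $$ (k n, l n)"
    by metis
  define g :: "nat \<Rightarrow> ((nat \<times> nat \<times> nat \<times> nat) + nat, 'f) ncpoly"
    where "g n = sdet_verifier n (k n) (l n)" for n
  have g: "nc_bounded (verifier_vars n) (verifier_size n) (g n)" if "n \<ge> 1" for n
    unfolding g_def using kl[OF that] by (intro nc_bounded_sdet_verifier) auto
  have "g \<in> VP"
    unfolding VP_def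
  proof (intro CollectI conjI)
    show "poly_bounded (\<lambda>n. card (nc_vars (g n)))"
    proof (rule poly_bounded_mono)
      show "poly_bounded (\<lambda>n. n * (n * (n * n)) + 2 * n * n)"
        by (intro poly_bounded_add poly_bounded_mult poly_bounded_const poly_bounded_id)
      fix n :: nat assume n: "n \<ge> 1"
      have "card (nc_vars (g n)) \<le> card (verifier_vars n)"
        using g[OF n] by (intro card_mono) (auto simp: nc_bounded_def verifier_vars_def)
      also have "\<dots> \<le> card (Inl ` ({..<n} \<times> {..<n} \<times> {..<n} \<times> {..<n}) :: ((nat \<times> nat \<times> nat \<times> nat) + nat) set) +
          card (Inr ` {..<2 * n * n} :: ((nat \<times> nat \<times> nat \<times> nat) + nat) set)"
        unfolding verifier_vars_def by (rule card_Un_le)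
      also have "\<dots> = n * (n * (n * n)) + 2 * n * n"
        by (simp add: card_image card_cartesian_product)
      finally show "card (nc_vars (g n)) \<le> n * (n * (n * n)) + 2 * n * n" .
    qed
    show "poly_bounded (\<lambda>n. nc_degree (g n))"
      using poly_bounded_verifier_size by (rule poly_bounded_mono) (use g in \<open>auto simp: nc_bounded_def\<close>)
    show "\<exists>s. poly_bounded s \<and> (\<forall>n\<ge>1. \<exists>C :: ((nat \<times> nat \<times> nat \<times> nat) + nat,
        (nat \<times> nat \<times> nat \<times> nat) + nat, 'f) circuit. circuit_oracles C = {} \<and> length C \<le> s n \<and> computes C (g n))"
    proof (rule exI[of _ "\<lambda>n. verifier_size n + 2"], intro conjI allI impI)
      show "poly_bounded (\<lambda>n. verifier_size n + 2)"
        by (intro poly_bounded_add poly_bounded_verifier_size poly_bounded_const)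
      fix n :: nat assume "1 \<le> n"
      then have "computable_over ({} :: ((nat \<times> nat \<times> nat \<times> nat) + nat, 'f) ncpoly set) {} (verifier_size n) (g n)"
        using g by (simp add: nc_bounded_def)
      then show "\<exists>C :: ((nat \<times> nat \<times> nat \<times> nat) + nat, (nat \<times> nat \<times> nat \<times> nat) + nat, 'f) circuit.
          circuit_oracles C = {} \<and> length C \<le> verifier_size n + 2 \<and> computes C (g n)"
        by (elim computable_over_computes) blast
    qed
  qed
  moreover have "poly_bounded (\<lambda>n. 2 * n * n)"
    by (intro poly_bounded_mult poly_bounded_const poly_bounded_id)
  moreover have "nc_vars (g n) \<subseteq> range Inl \<union> Inr ` {..<2 * n * n} \<and>
      h n = (\<Sum>e\<in>{..<2 * n * n} \<rightarrow>\<^sub>E {0, 1}. nc_subst (case_sum nc_var (\<lambda>i. nc_const (e i))) (g n))"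
    if n: "n \<ge> 1" for n
  proof
    show vars: "nc_vars (g n) \<subseteq> range Inl \<union> Inr ` {..<2 * n * n}"
      using g[OF n] by (auto simp: nc_bounded_def verifier_vars_def)
    have "h n = sdet (mat_algebra n) n (generic_matrix n n) $$ (k n, l n)"
      using kl[OF n] by blast
    also have "\<dots> = (\<Sum>E\<in>Pow {..<2 * n * n}. nc_subst (bit_subst E) (g n))"
      unfolding g_def using kl[OF n] by (intro sum_subst_sdet_verifier[symmetric]) auto
    also have "\<dots> = (\<Sum>e\<in>{..<2 * n * n} \<rightarrow>\<^sub>E {0, 1}. nc_subst (case_sum nc_var (\<lambda>i. nc_const (e i))) (g n))"
      using vars by (intro sum_PiE_01[symmetric] nc_subst_cong) (auto split: sum.splits)
    finally show "h n = (\<Sum>e\<in>{..<2 * n * n} \<rightarrow>\<^sub>E {0, 1}. nc_subst (case_sum nc_var (\<lambda>i. nc_const (e i))) (g n))" .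
  qed
  ultimately show ?thesis
    unfolding VNP_def by blast
qed

theorem theorem5p4:
  shows "\<exists>m. poly_bounded m \<and> (\<forall>n\<ge>1. m n \<ge> 1) \<and>
    VNP_complete
      (sdet_family m :: nat \<Rightarrow> (nat \<times> nat \<times> nat \<times> nat, 'f::field_char_0) ncpoly set)"
proof (rule exI[of _ "\<lambda>n. n"], intro conjI allI impI)
  show "poly_bounded (\<lambda>n. n)" ..
  show "1 \<le> n" if "1 \<le> n" for n :: nat
    by (fact that)
  show "VNP_complete (sdet_family (\<lambda>n. n) ::
      nat \<Rightarrow> (nat \<times> nat \<times> nat \<times> nat, 'f) ncpoly set)"
    unfolding VNP_complete_def using sdet_family_VNP VNP_c_reduces_sdet_family by blast
qed

end
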